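(* Let $M$ be a compact Riemann surface of genus $g\ge 1$ with a conformal metric and associated form $\omega$, and let $L\to M$ be a line bundle with Hermitian metric $H$. Consider the two equations $$F(A)=\tfrac{i}{2}\left(|\psi_1|_H^2-|\psi_2|_H^2\right)\omega,\qquad 2\bar\partial\Phi=-i\langle\psi_1,\psi_2\rangle_H\,\omega \qquad ( * )$$ for a triple $(A,\Psi,\Phi)$ consisting of a unitary connection $A$ on $L$, a pair of sections $\Psi=(\psi_1,\psi_2)\in\Gamma(M,L\oplus L)$ and a form $\Phi\in\Omega^1(M,i\mathbb{R})$. (1) If $g=1$ and $L$ is the trivial line bundle, then $( * )$ has a solution with $\Psi\neq 0$ and $\Phi\neq 0$. (2) If $g>1$ and $L=K^{-1}$, where $K$ is the canonical bundle of $M$, then $( * )$ has a solution with $\Psi\neq 0$ and $\Phi\neq 0$. Thus in these cases the moduli spaces $\mathcal{M}$ and $\Sigma_{[\Psi]}$ (the latter for the $\Psi$ of such a solution) are non-empty.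
   Context: The conformal metric is $ds^2=h^2\,dz\otimes d\bar z$ and $\omega=i h^2\,dz\wedge d\bar z$. Sections are smooth; $\langle\cdot,\cdot\rangle_H$ is linear in the first and conjugate-linear in the second entry. $F(A)\in\Omega^2(M,i\mathbb{R})$ is the curvature of the unitary connection $A$. Writing $\Phi=\phi\,dz-\bar\phi\,d\bar z\in\Omega^1(M,i\mathbb{R})$, $\bar\partial\Phi$ means $\bar\partial(\phi\,dz)$. Here $\Psi\ne0$, $\Phi\neq 0$ mean not identically zero. Let $\mathcal{A}$ be the space of unitary connections on $L$, $\mathcal{H}=\Omega^1(M,i\mathbb{R})$, and $\mathcal{C}=\mathcal{A}\times\Gamma(M,L\oplus L)\times\mathcal{H}$. The gauge group $G=\mathrm{Maps}(M,U(1))$ acts on $\mathcal{C}$ by $u\cdot(A,\Psi,\Phi)=(A+u^{-1}du,\,u^{-1}\Psi,\,\Phi)$. Let $\tilde{\mathcal{S}}\subset\mathcal{C}$ be the set of solutions of $( * )$ with $\Psi$ not identically zero, and $\mathcal{M}=\tilde{\mathcal{S}}/G$. For a fixed $\Psi$ such that $\langle\psi_1,\psi_2\rangle_H\,\omega$ is $\bar\partial$-exact, let $\mathcal{W}=\mathcal{A}\times(G\cdot\Psi)\times\mathcal{H}$, $\mathcal{S}_1=\mathcal{W}\cap\tilde{\mathcal{S}}$, and $\Sigma_{[\Psi]}=\mathcal{S}_1/G$. *)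

theory Defs
  imports "HOL-Complex_Analysis.Complex_Analysis" "HOL-Homology.Homology"
begin

section \<open>Smooth functions and Wirtinger derivatives on open sets\<close>

text \<open>Only used on open sets, so that derivatives at a point do not depend on the
  values of the function outside the set.\<close>

primrec cont_diff_on :: "nat \<Rightarrow> 'a::real_normed_vector set \<Rightarrow> ('a \<Rightarrow> 'b::real_normed_vector) \<Rightarrow> bool" where
  "cont_diff_on 0 S f \<longleftrightarrow> continuous_on S f"
| "cont_diff_on (Suc k) S f \<longleftrightarrow> (\<forall>x\<in>S. f differentiable (at x)) \<and>
     (\<forall>v. cont_diff_on k S (\<lambda>x. frechet_derivative f (at x) v))"

definition smooth_on :: "'a::real_normed_vector set \<Rightarrow> ('a \<Rightarrow> 'b::real_normed_vector) \<Rightarrow> bool" where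
  "smooth_on S f \<longleftrightarrow> (\<forall>k. cont_diff_on k S f)"

definition wirt_z :: "(complex \<Rightarrow> complex) \<Rightarrow> complex \<Rightarrow> complex" where
  "wirt_z f z = (frechet_derivative f (at z) 1 - \<i> * frechet_derivative f (at z) \<i>) / 2"

definition wirt_zbar :: "(complex \<Rightarrow> complex) \<Rightarrow> complex \<Rightarrow> complex" where
  "wirt_zbar f z = (frechet_derivative f (at z) 1 + \<i> * frechet_derivative f (at z) \<i>) / 2"


section \<open>Compact Riemann surfaces\<close>

text \<open>A chart is a pair of a domain and a coordinate function; the values of the
  coordinate outside the domain are irrelevant.\<close>

type_synonym 'a chart = "'a set \<times> ('a \<Rightarrow> complex)"

record 'a surface =
  topol :: "'a topology"
  atlas :: "'a chart set"

abbreviation points :: "'a surface \<Rightarrow> 'a set" where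
  "points M \<equiv> topspace (topol M)"

definition chart_inv :: "'a chart \<Rightarrow> complex \<Rightarrow> 'a" where
  "chart_inv c = inv_into (fst c) (snd c)"

definition is_chart :: "'a topology \<Rightarrow> 'a chart \<Rightarrow> bool" where
  "is_chart X c \<longleftrightarrow> openin X (fst c) \<and> open (snd c ` fst c) \<and>
     homeomorphic_map (subtopology X (fst c)) (top_of_set (snd c ` fst c)) (snd c)"

definition riemann_surface :: "'a surface \<Rightarrow> bool" where
  "riemann_surface M \<longleftrightarrow>
     Hausdorff_space (topol M) \<and> connected_space (topol M) \<and> points M \<noteq> {} \<and>
     (\<forall>c\<in>atlas M. is_chart (topol M) c) \<and> (\<Union>c\<in>atlas M. fst c) = points M \<and>
     (\<forall>c\<in>atlas M. \<forall>d\<in>atlas M. (snd d \<circ> chart_inv c) holomorphic_on (snd c ` (fst c \<inter> fst d)))"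

definition compact_riemann_surface :: "'a surface \<Rightarrow> bool" where
  "compact_riemann_surface M \<longleftrightarrow> riemann_surface M \<and> compact_space (topol M)"

text \<open>The topological genus: \<open>H\<^sub>1(M; \<int>)\<close> is free abelian of rank \<open>2g\<close>.\<close>

definition has_genus :: "'a surface \<Rightarrow> nat \<Rightarrow> bool" where
  "has_genus M g \<longleftrightarrow> homology_group 1 (topol M) \<cong> free_Abelian_group {..<2 * g}"

text \<open>\<open>dz_ratio c d p\<close> is \<open>dz\<^sub>d / dz\<^sub>c\<close> at \<open>p\<close>.\<close>

definition dz_ratio :: "'a chart \<Rightarrow> 'a chart \<Rightarrow> 'a \<Rightarrow> complex" where
  "dz_ratio c d p = deriv (snd d \<circ> chart_inv c) (snd c p)"

definition smooth_fun :: "'a surface \<Rightarrow> 'a set \<Rightarrow> ('a \<Rightarrow> 'b::real_normed_vector) \<Rightarrow> bool" where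
  "smooth_fun M W f \<longleftrightarrow> (\<forall>c\<in>atlas M. smooth_on (snd c ` (fst c \<inter> W)) (f \<circ> chart_inv c))"


section \<open>Differential forms\<close>

text \<open>
  A complex 1-form on an open set \<open>W\<close> is given by its coefficients in every chart:
  \<open>\<alpha> c p = (a, b)\<close> stands for \<open>a dz\<^sub>c + b cnj(dz\<^sub>c)\<close> at \<open>p\<close>.
  A 2-form is given by its coefficients with respect to \<open>dz\<^sub>c \<and> cnj(dz\<^sub>c)\<close>.
  All coefficients are set to zero where they are not meaningful, so that equality of
  forms is equality of functions.
\<close>

type_synonym 'a form1 = "'a chart \<Rightarrow> 'a \<Rightarrow> complex \<times> complex"
type_synonym 'a form2 = "'a chart \<Rightarrow> 'a \<Rightarrow> complex"

definition one_forms :: "'a surface \<Rightarrow> 'a set \<Rightarrow> 'a form1 set" where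
  "one_forms M W = {\<alpha>.
     (\<forall>c\<in>atlas M. smooth_on (snd c ` (fst c \<inter> W)) (\<alpha> c \<circ> chart_inv c)) \<and>
     (\<forall>c\<in>atlas M. \<forall>d\<in>atlas M. \<forall>p\<in>fst c \<inter> fst d \<inter> W.
        fst (\<alpha> c p) = fst (\<alpha> d p) * dz_ratio c d p \<and>
        snd (\<alpha> c p) = snd (\<alpha> d p) * cnj (dz_ratio c d p)) \<and>
     (\<forall>c p. \<not> (c \<in> atlas M \<and> p \<in> fst c \<inter> W) \<longrightarrow> \<alpha> c p = (0, 0))}"

definition forms_10 :: "'a surface \<Rightarrow> 'a form1 set" where
  "forms_10 M = {\<alpha> \<in> one_forms M (points M). \<forall>c p. snd (\<alpha> c p) = 0}"

text \<open>The space of \<open>i\<real>\<close>-valued 1-forms; these are the forms \<open>\<phi> dz - cnj \<phi> cnj(dz)\<close>.\<close>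

definition imaginary_forms :: "'a surface \<Rightarrow> 'a form1 set" where
  "imaginary_forms M = {\<alpha> \<in> one_forms M (points M). \<forall>c p. snd (\<alpha> c p) = - cnj (fst (\<alpha> c p))}"

definition zero_form :: "'a form1" where
  "zero_form = (\<lambda>c p. (0, 0))"

text \<open>Logarithmic differential \<open>f\<^sup>-\<^sup>1 df\<close> of a nowhere vanishing function.\<close>

definition dlog :: "('a \<Rightarrow> complex) \<Rightarrow> 'a form1" where
  "dlog f = (\<lambda>c p. (wirt_z (f \<circ> chart_inv c) (snd c p) / f p,
                    wirt_zbar (f \<circ> chart_inv c) (snd c p) / f p))"

text \<open>With \<open>w = cnj z\<close>: \<open>d (a dz + b dw) = (\<partial>b/\<partial>z - \<partial>a/\<partial>w) dz \<and> dw\<close>.\<close>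

definition ext_d :: "'a surface \<Rightarrow> 'a set \<Rightarrow> 'a form1 \<Rightarrow> 'a form2" where
  "ext_d M W \<alpha> = (\<lambda>c p. if c \<in> atlas M \<and> p \<in> fst c \<inter> W
     then wirt_z (snd \<circ> \<alpha> c \<circ> chart_inv c) (snd c p) - wirt_zbar (fst \<circ> \<alpha> c \<circ> chart_inv c) (snd c p)
     else 0)"

text \<open>With \<open>w = cnj z\<close>: \<open>\<partial>a/\<partial>w dw \<and> dz = - \<partial>a/\<partial>w dz \<and> dw\<close>. The \<open>(0,1)\<close>-part of
  the argument does not contribute.\<close>

definition dbar :: "'a surface \<Rightarrow> 'a form1 \<Rightarrow> 'a form2" where
  "dbar M \<alpha> = (\<lambda>c p. if c \<in> atlas M \<and> p \<in> fst c
     then - wirt_zbar (fst \<circ> \<alpha> c \<circ> chart_inv c) (snd c p) else 0)"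

definition dbar_exact :: "'a surface \<Rightarrow> 'a form2 \<Rightarrow> bool" where
  "dbar_exact M \<tau> \<longleftrightarrow> (\<exists>\<eta>\<in>forms_10 M. \<tau> = dbar M \<eta>)"

text \<open>A conformal metric \<open>h\<^sup>2 dz \<otimes> cnj(dz)\<close>, given by its local factors \<open>h c\<close>, and its
  associated form \<open>\<omega> = i h\<^sup>2 dz \<and> cnj(dz)\<close>.\<close>

definition conformal_metric :: "'a surface \<Rightarrow> ('a chart \<Rightarrow> 'a \<Rightarrow> real) \<Rightarrow> bool" where
  "conformal_metric M h \<longleftrightarrow>
     (\<forall>c\<in>atlas M. smooth_on (snd c ` fst c) (h c \<circ> chart_inv c) \<and> (\<forall>p\<in>fst c. 0 < h c p)) \<and>
     (\<forall>c\<in>atlas M. \<forall>d\<in>atlas M. \<forall>p\<in>fst c \<inter> fst d. h c p = h d p * cmod (dz_ratio c d p))"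

definition area_form :: "'a surface \<Rightarrow> ('a chart \<Rightarrow> 'a \<Rightarrow> real) \<Rightarrow> 'a form2" where
  "area_form M h = (\<lambda>c p. if c \<in> atlas M \<and> p \<in> fst c then \<i> * complex_of_real ((h c p)\<^sup>2) else 0)"


section \<open>Line bundles\<close>

text \<open>
  A smooth complex line bundle is given by an open cover \<open>nbhd i\<close> (\<open>i \<in> idx\<close>) and a cocycle
  of transition functions. The components of a section over \<open>nbhd i \<inter> nbhd j\<close> are related by
  \<open>s i = transition i j * s j\<close>.
\<close>

record ('i, 'a) line_bundle_data =
  idx :: "'i set"
  nbhd :: "'i \<Rightarrow> 'a set"
  transition :: "'i \<Rightarrow> 'i \<Rightarrow> 'a \<Rightarrow> complex"

definition line_bundle :: "'a surface \<Rightarrow> ('i, 'a) line_bundle_data \<Rightarrow> bool" where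
  "line_bundle M L \<longleftrightarrow>
     (\<forall>i\<in>idx L. openin (topol M) (nbhd L i)) \<and> (\<Union>i\<in>idx L. nbhd L i) = points M \<and>
     (\<forall>i\<in>idx L. \<forall>j\<in>idx L. smooth_fun M (nbhd L i \<inter> nbhd L j) (transition L i j) \<and>
        (\<forall>p\<in>nbhd L i \<inter> nbhd L j. transition L i j p \<noteq> 0)) \<and>
     (\<forall>i\<in>idx L. \<forall>p\<in>nbhd L i. transition L i i p = 1) \<and>
     (\<forall>i\<in>idx L. \<forall>j\<in>idx L. \<forall>k\<in>idx L. \<forall>p\<in>nbhd L i \<inter> nbhd L j \<inter> nbhd L k.
        transition L i j p * transition L j k p = transition L i k p)"

definition bundle_isomorphic :: "'a surface \<Rightarrow> ('i, 'a) line_bundle_data \<Rightarrow> ('j, 'a) line_bundle_data \<Rightarrow> bool" where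
  "bundle_isomorphic M L L' \<longleftrightarrow> (\<exists>f :: 'j \<Rightarrow> 'i \<Rightarrow> 'a \<Rightarrow> complex.
     (\<forall>k\<in>idx L'. \<forall>i\<in>idx L. smooth_fun M (nbhd L' k \<inter> nbhd L i) (f k i) \<and>
        (\<forall>p\<in>nbhd L' k \<inter> nbhd L i. f k i p \<noteq> 0)) \<and>
     (\<forall>k\<in>idx L'. \<forall>i\<in>idx L. \<forall>j\<in>idx L. \<forall>p\<in>nbhd L' k \<inter> nbhd L i \<inter> nbhd L j.
        f k j p = f k i p * transition L i j p) \<and>
     (\<forall>k\<in>idx L'. \<forall>l\<in>idx L'. \<forall>i\<in>idx L. \<forall>p\<in>nbhd L' k \<inter> nbhd L' l \<inter> nbhd L i.
        f k i p = transition L' k l p * f l i p))"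

definition trivial_bundle :: "'a surface \<Rightarrow> (unit, 'a) line_bundle_data" where
  "trivial_bundle M = \<lparr>idx = UNIV, nbhd = (\<lambda>_. points M), transition = (\<lambda>_ _ _. 1)\<rparr>"

text \<open>Over a chart \<open>c\<close> the canonical bundle is trivialised by \<open>dz\<^sub>c\<close>, and
  \<open>s\<^sub>c dz\<^sub>c = s\<^sub>d dz\<^sub>d\<close> gives \<open>s\<^sub>c = (dz\<^sub>d / dz\<^sub>c) s\<^sub>d\<close>.\<close>

definition canonical_bundle :: "'a surface \<Rightarrow> ('a chart, 'a) line_bundle_data" where
  "canonical_bundle M = \<lparr>idx = atlas M, nbhd = fst, transition = dz_ratio\<rparr>"

definition dual_bundle :: "('i, 'a) line_bundle_data \<Rightarrow> ('i, 'a) line_bundle_data" where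
  "dual_bundle L = \<lparr>idx = idx L, nbhd = nbhd L,
     transition = (\<lambda>i j p. inverse (transition L i j p))\<rparr>"

text \<open>Like forms, sections are extended by zero.\<close>

type_synonym ('i, 'a) bsection = "'i \<Rightarrow> 'a \<Rightarrow> complex"

definition sections :: "'a surface \<Rightarrow> ('i, 'a) line_bundle_data \<Rightarrow> ('i, 'a) bsection set" where
  "sections M L = {s.
     (\<forall>i\<in>idx L. smooth_fun M (nbhd L i) (s i)) \<and>
     (\<forall>i\<in>idx L. \<forall>j\<in>idx L. \<forall>p\<in>nbhd L i \<inter> nbhd L j. s i p = transition L i j p * s j p) \<and>
     (\<forall>i p. \<not> (i \<in> idx L \<and> p \<in> nbhd L i) \<longrightarrow> s i p = 0)}"

definition zero_section :: "('i, 'a) bsection" where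
  "zero_section = (\<lambda>i p. 0)"

text \<open>A Hermitian metric is given by \<open>H i = |e\<^sub>i|\<^sup>2\<close>, where \<open>e\<^sub>i\<close> is the local frame over
  \<open>nbhd i\<close>; since \<open>e\<^sub>j = transition i j e\<^sub>i\<close>, we have \<open>H j = |transition i j|\<^sup>2 H i\<close>.\<close>

definition hermitian_metric :: "'a surface \<Rightarrow> ('i, 'a) line_bundle_data \<Rightarrow> ('i \<Rightarrow> 'a \<Rightarrow> real) \<Rightarrow> bool" where
  "hermitian_metric M L H \<longleftrightarrow>
     (\<forall>i\<in>idx L. smooth_fun M (nbhd L i) (H i) \<and> (\<forall>p\<in>nbhd L i. 0 < H i p)) \<and>
     (\<forall>i\<in>idx L. \<forall>j\<in>idx L. \<forall>p\<in>nbhd L i \<inter> nbhd L j. H j p = (cmod (transition L i j p))\<^sup>2 * H i p)"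

text \<open>Some trivialisation around \<open>p\<close>; the quantities computed with it below do not depend on
  the choice.\<close>

definition triv_at :: "('i, 'a) line_bundle_data \<Rightarrow> 'a \<Rightarrow> 'i" where
  "triv_at L p = (SOME i. i \<in> idx L \<and> p \<in> nbhd L i)"

definition herm :: "('i, 'a) line_bundle_data \<Rightarrow> ('i \<Rightarrow> 'a \<Rightarrow> real) \<Rightarrow>
    ('i, 'a) bsection \<Rightarrow> ('i, 'a) bsection \<Rightarrow> 'a \<Rightarrow> complex" where
  "herm L H s t p = (let i = triv_at L p in complex_of_real (H i p) * s i p * cnj (t i p))"

definition hnorm :: "('i, 'a) line_bundle_data \<Rightarrow> ('i \<Rightarrow> 'a \<Rightarrow> real) \<Rightarrow> ('i, 'a) bsection \<Rightarrow> 'a \<Rightarrow> real" where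
  "hnorm L H s p = sqrt (Re (herm L H s s p))"

text \<open>
  A connection is given by its local connection forms \<open>A i\<close>, i.e. the covariant derivative of
  \<open>s\<close> is \<open>d (s i) + A i * s i\<close> over \<open>nbhd i\<close>; the change of trivialisation gives
  \<open>A j = A i + g\<^sup>-\<^sup>1 dg\<close> with \<open>g = transition i j\<close>. It is unitary if
  \<open>d\<langle>s,t\<rangle> = \<langle>\<nabla>s,t\<rangle> + \<langle>s,\<nabla>t\<rangle>\<close>, i.e. \<open>A i + cnj (A i) = H\<^sub>i\<^sup>-\<^sup>1 dH\<^sub>i\<close>. The complex conjugate of
  \<open>a dz + b cnj(dz)\<close> is \<open>cnj b dz + cnj a cnj(dz)\<close>.
\<close>

type_synonym ('i, 'a) conn = "'i \<Rightarrow> 'a form1"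

definition cnj_form :: "'a form1 \<Rightarrow> 'a form1" where
  "cnj_form \<alpha> = (\<lambda>c p. (cnj (snd (\<alpha> c p)), cnj (fst (\<alpha> c p))))"

definition connections :: "'a surface \<Rightarrow> ('i, 'a) line_bundle_data \<Rightarrow> ('i, 'a) conn set" where
  "connections M L = {A.
     (\<forall>i\<in>idx L. A i \<in> one_forms M (nbhd L i)) \<and> (\<forall>i. i \<notin> idx L \<longrightarrow> A i = zero_form) \<and>
     (\<forall>i\<in>idx L. \<forall>j\<in>idx L. \<forall>c\<in>atlas M. \<forall>p\<in>nbhd L i \<inter> nbhd L j \<inter> fst c.
        A j c p = A i c p + dlog (transition L i j) c p)}"

definition unitary_connections ::
    "'a surface \<Rightarrow> ('i, 'a) line_bundle_data \<Rightarrow> ('i \<Rightarrow> 'a \<Rightarrow> real) \<Rightarrow> ('i, 'a) conn set" where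
  "unitary_connections M L H = {A \<in> connections M L.
     \<forall>i\<in>idx L. \<forall>c\<in>atlas M. \<forall>p\<in>nbhd L i \<inter> fst c.
       A i c p + cnj_form (A i) c p = dlog (\<lambda>q. complex_of_real (H i q)) c p}"

definition curvature :: "'a surface \<Rightarrow> ('i, 'a) line_bundle_data \<Rightarrow> ('i, 'a) conn \<Rightarrow> 'a form2" where
  "curvature M L A = (\<lambda>c p. let i = triv_at L p in ext_d M (nbhd L i) (A i) c p)"


section \<open>The equations, the gauge group and the moduli spaces\<close>

type_synonym ('i, 'a) section_pair = "('i, 'a) bsection \<times> ('i, 'a) bsection"
type_synonym ('i, 'a) config = "('i, 'a) conn \<times> ('i, 'a) section_pair \<times> 'a form1"

definition configs ::
    "'a surface \<Rightarrow> ('i, 'a) line_bundle_data \<Rightarrow> ('i \<Rightarrow> 'a \<Rightarrow> real) \<Rightarrow> ('i, 'a) config set" where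
  "configs M L H =
     unitary_connections M L H \<times> (sections M L \<times> sections M L) \<times> imaginary_forms M"

definition herm_form ::
    "'a surface \<Rightarrow> ('a chart \<Rightarrow> 'a \<Rightarrow> real) \<Rightarrow> ('i, 'a) line_bundle_data \<Rightarrow> ('i \<Rightarrow> 'a \<Rightarrow> real) \<Rightarrow>
     ('i, 'a) section_pair \<Rightarrow> 'a form2" where
  "herm_form M h L H = (\<lambda>(\<psi>1, \<psi>2) c p. herm L H \<psi>1 \<psi>2 p * area_form M h c p)"

definition solution ::
    "'a surface \<Rightarrow> ('a chart \<Rightarrow> 'a \<Rightarrow> real) \<Rightarrow> ('i, 'a) line_bundle_data \<Rightarrow> ('i \<Rightarrow> 'a \<Rightarrow> real) \<Rightarrow>
     ('i, 'a) config \<Rightarrow> bool" where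
  "solution M h L H = (\<lambda>(A, (\<psi>1, \<psi>2), \<Phi>).
     (A, (\<psi>1, \<psi>2), \<Phi>) \<in> configs M L H \<and>
     curvature M L A = (\<lambda>c p. \<i> / 2 *
       complex_of_real ((hnorm L H \<psi>1 p)\<^sup>2 - (hnorm L H \<psi>2 p)\<^sup>2) * area_form M h c p) \<and>
     (\<lambda>c p. 2 * dbar M \<Phi> c p) = (\<lambda>c p. - \<i> * herm_form M h L H (\<psi>1, \<psi>2) c p))"

definition nonzero_pair :: "('i, 'a) section_pair \<Rightarrow> bool" where
  "nonzero_pair \<Psi> \<longleftrightarrow> \<Psi> \<noteq> (zero_section, zero_section)"

definition nontrivial_solutions ::
    "'a surface \<Rightarrow> ('a chart \<Rightarrow> 'a \<Rightarrow> real) \<Rightarrow> ('i, 'a) line_bundle_data \<Rightarrow> ('i \<Rightarrow> 'a \<Rightarrow> real) \<Rightarrow>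
     ('i, 'a) config set" where
  "nontrivial_solutions M h L H =
     {(A, \<Psi>, \<Phi>). solution M h L H (A, \<Psi>, \<Phi>) \<and> nonzero_pair \<Psi>}"

definition gauge_group :: "'a surface \<Rightarrow> ('a \<Rightarrow> complex) set" where
  "gauge_group M = {u. smooth_fun M (points M) u \<and> (\<forall>p\<in>points M. cmod (u p) = 1) \<and>
     (\<forall>p. p \<notin> points M \<longrightarrow> u p = 1)}"

definition act_pair :: "('a \<Rightarrow> complex) \<Rightarrow> ('i, 'a) section_pair \<Rightarrow> ('i, 'a) section_pair" where
  "act_pair u = (\<lambda>(\<psi>1, \<psi>2). (\<lambda>i p. inverse (u p) * \<psi>1 i p, \<lambda>i p. inverse (u p) * \<psi>2 i p))"

definition act_conn ::
    "'a surface \<Rightarrow> ('i, 'a) line_bundle_data \<Rightarrow> ('a \<Rightarrow> complex) \<Rightarrow> ('i, 'a) conn \<Rightarrow> ('i, 'a) conn" where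
  "act_conn M L u A = (\<lambda>i c p. if i \<in> idx L \<and> c \<in> atlas M \<and> p \<in> nbhd L i \<inter> fst c
     then A i c p + dlog u c p else (0, 0))"

definition act ::
    "'a surface \<Rightarrow> ('i, 'a) line_bundle_data \<Rightarrow> ('a \<Rightarrow> complex) \<Rightarrow> ('i, 'a) config \<Rightarrow> ('i, 'a) config" where
  "act M L u = (\<lambda>(A, \<Psi>, \<Phi>). (act_conn M L u A, act_pair u \<Psi>, \<Phi>))"

text \<open>Quotient of a gauge invariant set of configurations.\<close>

definition gauge_quotient ::
    "'a surface \<Rightarrow> ('i, 'a) line_bundle_data \<Rightarrow> ('i, 'a) config set \<Rightarrow> ('i, 'a) config set set" where
  "gauge_quotient M L S = S // {(x, y). x \<in> S \<and> y \<in> S \<and> (\<exists>u\<in>gauge_group M. y = act M L u x)}"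

definition moduli_space ::
    "'a surface \<Rightarrow> ('a chart \<Rightarrow> 'a \<Rightarrow> real) \<Rightarrow> ('i, 'a) line_bundle_data \<Rightarrow> ('i \<Rightarrow> 'a \<Rightarrow> real) \<Rightarrow>
     ('i, 'a) config set set" where
  "moduli_space M h L H = gauge_quotient M L (nontrivial_solutions M h L H)"

definition orbit_configs ::
    "'a surface \<Rightarrow> ('i, 'a) line_bundle_data \<Rightarrow> ('i \<Rightarrow> 'a \<Rightarrow> real) \<Rightarrow> ('i, 'a) section_pair \<Rightarrow>
     ('i, 'a) config set" where
  "orbit_configs M L H \<Psi> =
     unitary_connections M L H \<times> ((\<lambda>u. act_pair u \<Psi>) ` gauge_group M) \<times> imaginary_forms M"

text \<open>Meaningful if \<open>herm_form M h L H \<Psi>\<close> is dbar-exact.\<close>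

definition sigma_space ::
    "'a surface \<Rightarrow> ('a chart \<Rightarrow> 'a \<Rightarrow> real) \<Rightarrow> ('i, 'a) line_bundle_data \<Rightarrow> ('i \<Rightarrow> 'a \<Rightarrow> real) \<Rightarrow>
     ('i, 'a) section_pair \<Rightarrow> ('i, 'a) config set set" where
  "sigma_space M h L H \<Psi> =
     gauge_quotient M L (orbit_configs M L H \<Psi> \<inter> nontrivial_solutions M h L H)"

end

theory Submission
  imports Defs
begin

text \<open>
  The equations do not couple \<open>A\<close> to \<open>\<Psi>\<close>. On \<open>M\<close> every smooth area form is, up to an exact one, a multiple of a
  fixed nonnegative form \<open>\<tau>\<close> supported in a coordinate disc: by the compactly supported Poincare lemma this
  holds locally, and the points where it holds form an open and closed set. Hence the
  curvature of a unitary connection can be moved to a real multiple \<open>\<rho> \<tau>\<close>. In the disc, where \<open>L\<close> is trivial,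
  there are explicit compactly supported sections \<open>\<psi>\<^sub>1, \<psi>\<^sub>2\<close> for which \<open>\<langle>\<psi>\<^sub>1, \<psi>\<^sub>2\<rangle> \<omega>\<close> is the image under
  the dbar operator of a compactly supported form and \<open>|\<psi>\<^sub>1|\<^sup>2 - |\<psi>\<^sub>2|\<^sup>2\<close> is any prescribed real multiple of the density of \<open>\<tau>\<close>.
\<close>

section \<open>Smooth functions\<close>

text \<open>The disc construction has to meet two requirements at once. If \<phi> has compact
  support in the disc, then \<open>\<partial>\<phi>/\<partial>(cnj z)\<close> integrates to zero
  against every holomorphic function, so a nonnegative nonzero function, such as the square of a
  bump, can never be the pairing of the two sections. Opposite angular factors \<zeta> and
  \<open>cnj \<zeta>\<close> on one common radial profile make the pairing \<zeta>^2 times a radial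
  function: all those integrals vanish, a primitive can be written down, and both norms still have
  the same shape. This shape dictates \<tau>, which up to the metric factor is |\<zeta>|^2 times the
  squared profile. The number \<rho> is fixed by the degree of L, but it never has to be computed:
  the amplitudes of the two sections absorb it, whatever its sign. Two different positive amplitudes
  leave the second equation intact, because only their product enters there. Compact support is what
  lets sections and forms extend by zero from the disc to all of M.\<close>

abbreviation fderiv :: "('a::real_normed_vector \<Rightarrow> 'b::real_normed_vector) \<Rightarrow> 'a \<Rightarrow> 'a \<Rightarrow> 'b" where
  "fderiv f x \<equiv> frechet_derivative f (at x)"

lemma frechet_derivative_cong_open:
  assumes "open S" "x \<in> S" "\<And>y. y \<in> S \<Longrightarrow> f y = g y"
  shows "fderiv f x = fderiv g x"
proof -
  have "(f has_derivative D) (at x) \<longleftrightarrow> (g has_derivative D) (at x)" for D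
    using assms by (metis has_derivative_transform_within_open)
  then show ?thesis by (simp add: frechet_derivative_def)
qed

lemma differentiable_cong_open:
  assumes "open S" "x \<in> S" "\<And>y. y \<in> S \<Longrightarrow> f y = g y" "f differentiable (at x)"
  shows "g differentiable (at x)"
  using assms has_derivative_transform_within_open unfolding differentiable_def by metis

section \<open>Calculus of functions of class C^k\<close>

lemma cont_diff_on_subset:
  "cont_diff_on k S f \<Longrightarrow> T \<subseteq> S \<Longrightarrow> cont_diff_on k T f"
  by (induction k arbitrary: f) (auto intro: continuous_on_subset)

lemma cont_diff_on_imp_continuous_on:
  "cont_diff_on k S f \<Longrightarrow> continuous_on S f"
  using differentiable_imp_continuous_on[of f S]
  by (cases k) (simp_all add: differentiable_on_def differentiable_at_withinI)

lemma cont_diff_on_SucD: "cont_diff_on (Suc k) S f \<Longrightarrow> cont_diff_on k S f"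
proof (induction k arbitrary: f)
  case 0
  then show ?case using cont_diff_on_imp_continuous_on[of "Suc 0"] by simp
next
  case (Suc k)
  have "cont_diff_on (Suc k) S (\<lambda>x. fderiv f x v)" for v
    using Suc.prems by simp
  then have "cont_diff_on k S (\<lambda>x. fderiv f x v)" for v
    using Suc.IH by blast
  then show ?case using Suc.prems by simp
qed

lemma cont_diff_on_cong:
  assumes "open S" "\<And>x. x \<in> S \<Longrightarrow> f x = g x" "cont_diff_on k S f"
  shows "cont_diff_on k S g"
  using assms
proof (induction k arbitrary: f g)
  case 0
  then show ?case using continuous_on_cong[of S S f g] by simp
next
  case (Suc k)
  have "fderiv f x = fderiv g x" if "x \<in> S" for x
    using frechet_derivative_cong_open[OF Suc.prems(1) that] Suc.prems(2) by blast
  then have "cont_diff_on k S (\<lambda>x. fderiv g x v)" for v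
    using Suc.IH[of "\<lambda>x. fderiv f x v" "\<lambda>x. fderiv g x v"]
      Suc.prems by simp
  moreover have "g differentiable (at x)" if "x \<in> S" for x
    using differentiable_cong_open[OF Suc.prems(1) that] Suc.prems(2,3) that by auto
  ultimately show ?case by simp
qed

text \<open>The entry point of the inductions on the order below: a concrete formula for the
  derivative replaces \<open>frechet_derivative\<close>, and each directional derivative is left to
  the induction hypothesis.\<close>

lemma cont_diff_on_SucI:
  assumes "open S" "\<And>x. x \<in> S \<Longrightarrow> (f has_derivative f' x) (at x)"
    and "\<And>v. cont_diff_on k S (\<lambda>x. f' x v)"
  shows "cont_diff_on (Suc k) S f"
proof -
  have "f' x = fderiv f x" if "x \<in> S" for x
    using frechet_derivative_at[OF assms(2)[OF that]] .
  then have "cont_diff_on k S (\<lambda>x. fderiv f x v)" for v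
    by (intro cont_diff_on_cong[OF assms(1) _ assms(3)[of v]]) simp
  then show ?thesis using assms(2) by (auto simp: differentiable_def)
qed

text \<open>Differentiability and continuity at a point only see a neighbourhood, and the same
  neighbourhood serves for every directional derivative.\<close>

lemma cont_diff_on_local:
  assumes "\<And>x. x \<in> S \<Longrightarrow> \<exists>U. open U \<and> x \<in> U \<and> cont_diff_on k U f"
  shows "cont_diff_on k S f"
  using assms
proof (induction k arbitrary: f)
  case 0
  then have "isCont f x" if "x \<in> S" for x
    using that continuous_on_eq_continuous_at by (metis cont_diff_on.simps(1))
  then show ?case by (simp add: continuous_at_imp_continuous_on)
next
  case (Suc k)
  have "f differentiable (at x)" if "x \<in> S" for x
    using Suc.prems[OF that] by auto
  moreover have "cont_diff_on k S (\<lambda>x. fderiv f x v)" for v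
    using Suc.prems by (intro Suc.IH) fastforce
  ultimately show ?case by simp
qed

lemma cont_diff_on_const: "open S \<Longrightarrow> cont_diff_on k S (\<lambda>x. c)"
proof (induction k arbitrary: c)
  case (Suc k)
  show ?case by (rule cont_diff_on_SucI[where f' = "\<lambda>x v. 0"]) (use Suc in auto)
qed simp

lemma cont_diff_on_linear_ident:
  "bounded_linear L \<Longrightarrow> open S \<Longrightarrow> cont_diff_on k S L"
proof (cases k)
  case (Suc j)
  assume "bounded_linear L" "open S"
  then show ?thesis unfolding Suc
    by (intro cont_diff_on_SucI[where f' = "\<lambda>x. L"] cont_diff_on_const)
      (auto intro: bounded_linear_imp_has_derivative)
qed (simp add: linear_continuous_on)

lemma cont_diff_has_derivative:
  "cont_diff_on (Suc k) S f \<Longrightarrow> x \<in> S \<Longrightarrow>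
    (f has_derivative fderiv f x) (at x)"
  using frechet_derivative_works by auto

lemma cont_diff_on_linear:
  assumes "bounded_linear L" "open S" "cont_diff_on k S f"
  shows "cont_diff_on k S (\<lambda>x. L (f x))"
  using assms(3)
proof (induction k arbitrary: f)
  case 0
  then show ?case using bounded_linear.continuous_on[OF assms(1)] by auto
next
  case (Suc k)
  show ?case
    by (rule cont_diff_on_SucI[OF assms(2) bounded_linear.has_derivative[OF assms(1)
            cont_diff_has_derivative[OF Suc.prems]]])
      (use Suc in auto)
qed

lemma cont_diff_on_add:
  assumes "open S" "cont_diff_on k S f" "cont_diff_on k S g"
  shows "cont_diff_on k S (\<lambda>x. f x + g x)"
  using assms(2,3)
proof (induction k arbitrary: f g)
  case 0
  then show ?case by (auto intro: continuous_intros)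
next
  case (Suc k)
  show ?case
    by (rule cont_diff_on_SucI[OF assms(1) has_derivative_add[OF
            cont_diff_has_derivative[OF Suc.prems(1)] cont_diff_has_derivative[OF Suc.prems(2)]]])
      (use Suc in auto)
qed

lemma cont_diff_on_bilinear:
  assumes "bounded_bilinear B" "open S" "cont_diff_on k S f" "cont_diff_on k S g"
  shows "cont_diff_on k S (\<lambda>x. B (f x) (g x))"
  using assms(3,4)
proof (induction k arbitrary: f g)
  case 0
  then show ?case using bounded_bilinear.continuous_on[OF assms(1)] by auto
next
  case (Suc k)
  show ?case
  proof (rule cont_diff_on_SucI[OF assms(2) bounded_bilinear.FDERIV[OF assms(1)
            cont_diff_has_derivative[OF Suc.prems(1)] cont_diff_has_derivative[OF Suc.prems(2)]]])
    fix v
    have "cont_diff_on k S f" "cont_diff_on k S g"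
      using Suc.prems cont_diff_on_SucD by blast+
    then show "cont_diff_on k S (\<lambda>x. B (f x) (fderiv g x v) +
         B (fderiv f x v) (g x))"
      using Suc.prems by (intro cont_diff_on_add assms(2) Suc.IH) auto
  qed
qed

lemma cont_diff_on_sum:
  assumes "open S" "\<And>i. i \<in> I \<Longrightarrow> cont_diff_on k S (f i)"
  shows "cont_diff_on k S (\<lambda>x. \<Sum>i\<in>I. f i x)"
  using assms(2)
  by (induction I rule: infinite_finite_induct)
    (auto intro: cont_diff_on_const cont_diff_on_add assms(1))

text \<open>The chain rule evaluates the derivative of \<open>g\<close> in a direction that varies
  with \<open>x\<close>, whereas the induction hypothesis covers fixed directions only. Expanding
  that direction in the finite basis of the space between separates the two; this is why it is
  Euclidean.\<close>

lemma cont_diff_on_compose: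
  fixes g :: "'b::euclidean_space \<Rightarrow> 'c::real_normed_vector"
  assumes "open S" "open T" "cont_diff_on k S f" "cont_diff_on k T g" "f ` S \<subseteq> T"
  shows "cont_diff_on k S (\<lambda>x. g (f x))"
  using assms(3,4)
proof (induction k arbitrary: g)
  case 0
  then show ?case using assms(5) by (auto intro: continuous_on_compose2)
next
  case (Suc k)
  have fT: "f x \<in> T" if "x \<in> S" for x using assms(5) that by blast
  have d: "((\<lambda>x. g (f x)) has_derivative
       (\<lambda>v. \<Sum>b\<in>Basis. (fderiv f x v \<bullet> b) *\<^sub>R fderiv g (f x) b)) (at x)"
    if "x \<in> S" for x
  proof -
    have lin: "linear (fderiv g (f x))"
      using cont_diff_has_derivative[OF Suc.prems(2) fT[OF that]] has_derivative_linear by blast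
    have "((\<lambda>x. g (f x)) has_derivative
       (\<lambda>v. fderiv g (f x) (fderiv f x v))) (at x)"
      using has_derivative_compose[OF cont_diff_has_derivative[OF Suc.prems(1) that]
          cont_diff_has_derivative[OF Suc.prems(2) fT[OF that]]] .
    moreover have "fderiv g (f x) w =
        (\<Sum>b\<in>Basis. (w \<bullet> b) *\<^sub>R fderiv g (f x) b)" for w
    proof -
      have "fderiv g (f x) w = fderiv g (f x) (\<Sum>b\<in>Basis. (w \<bullet> b) *\<^sub>R b)"
        by (simp only: euclidean_representation)
      then show ?thesis by (simp only: linear_sum[OF lin] linear_cmul[OF lin])
    qed
    ultimately show ?thesis by (rule has_derivative_eq_rhs[OF _ ext])
  qed
  show ?case
  proof (rule cont_diff_on_SucI[OF assms(1) d])
    fix v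
    have f: "cont_diff_on k S f" using Suc.prems(1) cont_diff_on_SucD by blast
    have "cont_diff_on k S (\<lambda>x. fderiv g (f x) b)" for b
      using Suc.prems by (intro Suc.IH[OF f, of "\<lambda>y. fderiv g y b"]) auto
    moreover have "cont_diff_on k S (\<lambda>x. fderiv f x v \<bullet> b)" for b
      using Suc.prems(1) by (intro cont_diff_on_linear[OF bounded_linear_inner_left assms(1)]) auto
    ultimately show "cont_diff_on k S (\<lambda>x. \<Sum>b\<in>Basis. (fderiv f x v \<bullet> b) *\<^sub>R
          fderiv g (f x) b)"
      by (intro cont_diff_on_sum[OF assms(1)] cont_diff_on_bilinear[OF bounded_bilinear_scaleR assms(1)])
  qed
qed

text \<open>The derivative is a product of \<open>fderiv f\<close> with the inverse itself, so order
  \<open>k\<close> of the inverse yields order \<open>Suc k\<close>.\<close>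

lemma cont_diff_on_inverse:
  fixes f :: "_ \<Rightarrow> 'b::real_normed_field"
  assumes "open S" "cont_diff_on k S f" "\<And>x. x \<in> S \<Longrightarrow> f x \<noteq> 0"
  shows "cont_diff_on k S (\<lambda>x. inverse (f x))"
  using assms(2)
proof (induction k)
  case 0
  then show ?case using assms(3) by (auto intro: continuous_on_inverse)
next
  case (Suc k)
  show ?case
  proof (rule cont_diff_on_SucI[OF assms(1) Deriv.has_derivative_inverse[OF _
            cont_diff_has_derivative[OF Suc.prems(1)]]])
    have i: "cont_diff_on k S (\<lambda>x. inverse (f x))"
      using Suc cont_diff_on_SucD by blast
    show "cont_diff_on k S (\<lambda>x. - (inverse (f x) * fderiv f x v * inverse (f x)))" for v
      using Suc.prems
      by (intro cont_diff_on_linear[OF bounded_linear_minus[OF bounded_linear_ident] assms(1)]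
          cont_diff_on_bilinear[OF bounded_bilinear_mult assms(1)] i) auto
  qed (use assms(3) in auto)
qed

lemma cont_diff_on_sqrt:
  fixes f :: "_ \<Rightarrow> real"
  assumes "open S" "cont_diff_on k S f" "\<And>x. x \<in> S \<Longrightarrow> f x > 0"
  shows "cont_diff_on k S (\<lambda>x. sqrt (f x))"
  using assms(2)
proof (induction k)
  case 0
  then show ?case by (auto intro: continuous_intros)
next
  case (Suc k)
  have d: "((\<lambda>x. sqrt (f x)) has_derivative (\<lambda>v. fderiv f x v * inverse (2 * sqrt (f x)))) (at x)"
    if "x \<in> S" for x
    by (rule has_derivative_eq_rhs[OF has_derivative_real_sqrt[OF _ cont_diff_has_derivative[OF Suc.prems that]]])
      (use assms(3)[OF that] in \<open>auto simp: field_simps\<close>)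
  show ?case
  proof (rule cont_diff_on_SucI[OF assms(1) d])
    have "cont_diff_on k S (\<lambda>x. sqrt (f x))"
      using Suc cont_diff_on_SucD by blast
    then have i: "cont_diff_on k S (\<lambda>x. inverse (2 * sqrt (f x)))"
      by (intro cont_diff_on_inverse cont_diff_on_linear[OF bounded_linear_mult_right] assms(1))
        (use assms(3) in force)+
    show "cont_diff_on k S (\<lambda>x. fderiv f x v * inverse (2 * sqrt (f x)))" for v
      using Suc.prems
      by (intro cont_diff_on_bilinear[OF bounded_bilinear_mult assms(1)] i) auto
  qed auto
qed

text \<open>The derivative in direction \<open>v\<close> is \<open>deriv f x * v\<close>, and
  \<open>deriv f\<close> is again holomorphic, so the induction runs over all holomorphic functions
  at once.\<close>

lemma cont_diff_on_holomorphic: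
  assumes "open S" "f holomorphic_on S"
  shows "cont_diff_on k S f"
  using assms(2)
proof (induction k arbitrary: f)
  case 0
  then show ?case by (simp add: holomorphic_on_imp_continuous_on)
next
  case (Suc k)
  show ?case
  proof (rule cont_diff_on_SucI[OF assms(1), where f' = "\<lambda>x v. deriv f x * v"])
    show "(f has_derivative (*) (deriv f x)) (at x)" if "x \<in> S" for x
      using holomorphic_derivI[OF Suc.prems assms(1) that] by (simp add: has_field_derivative_def)
    show "cont_diff_on k S (\<lambda>x. deriv f x * v)" for v
      by (intro cont_diff_on_linear[OF bounded_linear_mult_left assms(1)] Suc.IH
          holomorphic_deriv Suc.prems assms(1))
  qed
qed

text \<open>The functions \<open>x\<^sup>-\<^sup>n exp (-c / x)\<close>, \<open>x > 0\<close>, extended by zero, are closed under differentiation.\<close>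

definition flat_exp :: "real \<Rightarrow> nat \<Rightarrow> real \<Rightarrow> real" where
  "flat_exp c n x = (if x > 0 then inverse x ^ n * exp (- c * inverse x) else 0)"

lemma flat_exp_tendsto_0:
  assumes "c > 0"
  shows "(flat_exp c n \<longlongrightarrow> 0) (at 0)"
proof -
  \<comment> \<open>With y = 1/x the claim is that the exponential beats every power; the argument
    \<open>c * y\<close> fits the standard limit.\<close>
  have "((\<lambda>y::real. (c * y) ^ n / exp (c * y)) \<longlongrightarrow> 0) at_top"
    by (rule filterlim_compose[OF tendsto_power_div_exp_0])
      (use assms in \<open>simp add: filterlim_tendsto_pos_mult_at_top[OF tendsto_const _ filterlim_ident]\<close>)
  then have "((\<lambda>y::real. inverse (c ^ n) * ((c * y) ^ n / exp (c * y))) \<longlongrightarrow> inverse (c ^ n) * 0) at_top"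
    by (rule tendsto_mult_left)
  then have "((\<lambda>y::real. y ^ n * exp (- c * y)) \<longlongrightarrow> 0) at_top"
    using assms by (simp add: power_mult_distrib exp_minus field_simps)
  then have "((\<lambda>x. inverse x ^ n * exp (- c * inverse x)) \<longlongrightarrow> 0) (at_right 0)"
    by (rule filterlim_compose[OF _ filterlim_inverse_at_top_right])
  then have "(flat_exp c n \<longlongrightarrow> 0) (at_right 0)"
    by (rule Lim_transform_eventually)
      (auto simp: flat_exp_def eventually_at_filter)
  moreover have "(flat_exp c n \<longlongrightarrow> 0) (at_left 0)"
    by (rule Lim_transform_eventually[OF tendsto_const])
      (auto simp: flat_exp_def eventually_at_filter)
  ultimately show ?thesis by (simp add: filterlim_at_split)
qed

lemma flat_exp_has_derivative:
  assumes "c > 0"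
  shows "(flat_exp c n has_real_derivative c * flat_exp c (n + 2) x - real n * flat_exp c (n + 1) x) (at x)"
proof -
  consider "x > 0" | "x < 0" | "x = 0" by linarith
  then show ?thesis
  proof cases
    case 1
    have "((\<lambda>x. inverse x ^ n) has_real_derivative - real n * inverse x ^ (n + 1)) (at x)"
    proof (cases n)
      case (Suc m)
      have "((\<lambda>x. inverse x ^ Suc m) has_real_derivative
          (1 + real m) * (- (inverse x ^ Suc (Suc 0)) * inverse x ^ m)) (at x)"
        using 1 by (intro DERIV_power_Suc DERIV_inverse) auto
      then show ?thesis by (simp add: Suc algebra_simps)
    qed simp
    moreover have "((\<lambda>x. exp (- c * inverse x)) has_real_derivative
        c * inverse x ^ 2 * exp (- c * inverse x)) (at x)"
      using 1 by (auto intro!: derivative_eq_intros simp: power2_eq_square)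
    ultimately have "((\<lambda>x. inverse x ^ n * exp (- c * inverse x)) has_real_derivative
        c * flat_exp c (n + 2) x - real n * flat_exp c (n + 1) x) (at x)"
      using 1 by (auto intro!: DERIV_cong[OF DERIV_mult'] simp: flat_exp_def power_add power2_eq_square algebra_simps)
    then show ?thesis
      by (rule DERIV_cong_ev[THEN iffD1, rotated -1, OF _ refl _ refl])
        (use 1 eventually_nhds_in_open[of "{0<..}" x] in \<open>auto simp: flat_exp_def elim!: eventually_mono\<close>)
  next
    case 2
    have "((\<lambda>x. 0) has_real_derivative c * flat_exp c (n + 2) x - real n * flat_exp c (n + 1) x) (at x)"
      using 2 by (simp add: flat_exp_def)
    then show ?thesis
      by (rule DERIV_cong_ev[THEN iffD1, rotated -1, OF _ refl _ refl])
        (use 2 eventually_nhds_in_open[of "{..<0}" x] in \<open>auto simp: flat_exp_def elim!: eventually_mono\<close>)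
  next
    case 3
    \<comment> \<open>At 0 the difference quotient of order \<open>n\<close> is
      \<open>flat_exp c (Suc n)\<close>, on both sides of 0, and its limit is already known.\<close>
    have "((\<lambda>h. (flat_exp c n (0 + h) - flat_exp c n 0) / h) \<longlongrightarrow> 0) (at 0)"
      by (rule Lim_transform_eventually[OF flat_exp_tendsto_0[OF assms, of "Suc n"]])
        (auto simp: flat_exp_def eventually_at_filter divide_inverse)
    then show ?thesis using 3 by (simp add: DERIV_def flat_exp_def)
  qed
qed

lemma cont_diff_on_flat_exp: "c > 0 \<Longrightarrow> cont_diff_on k UNIV (flat_exp c n)"
proof (induction k arbitrary: n)
  case 0
  then show ?case
    by (auto intro!: continuous_at_imp_continuous_on DERIV_isCont flat_exp_has_derivative)
next
  case (Suc k)
  show ?case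
  proof (rule cont_diff_on_SucI[where f' = "\<lambda>x v. (c * flat_exp c (n + 2) x + - real n * flat_exp c (n + 1) x) * v"])
    show "(flat_exp c n has_derivative (*) (c * flat_exp c (n + 2) x + - real n * flat_exp c (n + 1) x)) (at x)" for x
      using flat_exp_has_derivative[OF Suc.prems, of n x] by (simp add: has_field_derivative_def)
    show "cont_diff_on k UNIV (\<lambda>x. (c * flat_exp c (n + 2) x + - real n * flat_exp c (n + 1) x) * v)" for v
      by (intro cont_diff_on_linear[OF bounded_linear_mult_left] cont_diff_on_add open_UNIV
          cont_diff_on_linear[OF bounded_linear_mult_right] Suc)
  qed simp
qed


section \<open>Smoothness at a point\<close>

text \<open>A property of germs: the open set is hidden in the quantifier, so the closure rules
  chain together without any bookkeeping of domains.\<close>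

definition smooth_at :: "('a::real_normed_vector \<Rightarrow> 'b::real_normed_vector) \<Rightarrow> 'a \<Rightarrow> bool" where
  "smooth_at f z \<longleftrightarrow> (\<exists>U. open U \<and> z \<in> U \<and> smooth_on U f)"

lemma smooth_on_iff_smooth_at: "open S \<Longrightarrow> smooth_on S f \<longleftrightarrow> (\<forall>z\<in>S. smooth_at f z)" (is "?O \<Longrightarrow> ?L \<longleftrightarrow> ?R")
proof
  assume ?R
  then show ?L unfolding smooth_on_def smooth_at_def by (meson cont_diff_on_local)
qed (auto simp: smooth_at_def)

lemma smooth_UNIV_iff: "smooth_on UNIV f \<longleftrightarrow> (\<forall>z. smooth_at f z)"
  by (simp add: smooth_on_iff_smooth_at)

lemma smooth_on_subset: "smooth_on S f \<Longrightarrow> T \<subseteq> S \<Longrightarrow> smooth_on T f"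
  unfolding smooth_on_def using cont_diff_on_subset by blast

lemma smooth_at_cong:
  assumes "eventually (\<lambda>x. f x = g x) (nhds z)" "smooth_at f z"
  shows "smooth_at g z"
proof -
  obtain S where S: "open S" "z \<in> S" "\<And>x. x \<in> S \<Longrightarrow> f x = g x"
    using assms(1) by (auto simp: eventually_nhds)
  obtain U where U: "open U" "z \<in> U" "smooth_on U f"
    using assms(2) by (auto simp: smooth_at_def)
  have "smooth_on (S \<inter> U) g"
    unfolding smooth_on_def
  proof
    fix k
    have "cont_diff_on k (S \<inter> U) f"
      using U(3) cont_diff_on_subset unfolding smooth_on_def by blast
    then show "cont_diff_on k (S \<inter> U) g"
      by (rule cont_diff_on_cong[rotated 2]) (use S U in auto)
  qed
  then show ?thesis unfolding smooth_at_def using S U by blast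
qed

lemma smooth_at_eventually: "smooth_at f z \<Longrightarrow> eventually (smooth_at f) (nhds z)"
  unfolding smooth_at_def eventually_nhds by blast

lemma smooth_at_common:
  assumes "smooth_at f z" "smooth_at g z"
  obtains U where "open U" "z \<in> U" "smooth_on U f" "smooth_on U g"
proof -
  obtain U V where "open U" "z \<in> U" "smooth_on U f" "open V" "z \<in> V" "smooth_on V g"
    using assms by (auto simp: smooth_at_def)
  then show ?thesis
    using that[of "U \<inter> V"] smooth_on_subset[of U f "U \<inter> V"] smooth_on_subset[of V g "U \<inter> V"] by auto
qed

lemma smooth_at_differentiable: "smooth_at f z \<Longrightarrow> f differentiable (at z)"
  using cont_diff_on.simps(2)[of 0] unfolding smooth_at_def smooth_on_def by blast

lemma smooth_at_has_derivative:
  "smooth_at f z \<Longrightarrow> (f has_derivative fderiv f z) (at z)"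
  using smooth_at_differentiable frechet_derivative_works by blast

lemma smooth_at_fderiv: "smooth_at f z \<Longrightarrow> smooth_at (\<lambda>x. fderiv f x v) z"
  using cont_diff_on.simps(2)[where f = f] unfolding smooth_at_def smooth_on_def by blast

lemma smooth_at_isCont: "smooth_at f z \<Longrightarrow> isCont f z"
  using smooth_at_differentiable differentiable_imp_continuous_within by blast

lemma smooth_on_imp_continuous_on: "smooth_on S f \<Longrightarrow> continuous_on S f"
  unfolding smooth_on_def using cont_diff_on_imp_continuous_on by blast

lemma smooth_at_const: "smooth_at (\<lambda>x. c) z"
  unfolding smooth_at_def smooth_on_def by (blast intro: cont_diff_on_const)

lemma smooth_at_bounded_linear: "bounded_linear L \<Longrightarrow> smooth_at L z"
  unfolding smooth_at_def smooth_on_def by (blast intro: cont_diff_on_linear_ident)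

lemma smooth_at_ident: "smooth_at (\<lambda>x. x) z"
  by (rule smooth_at_bounded_linear) (rule bounded_linear_ident)

lemma smooth_at_linear: "bounded_linear L \<Longrightarrow> smooth_at f z \<Longrightarrow> smooth_at (\<lambda>x. L (f x)) z"
  using cont_diff_on_linear unfolding smooth_at_def smooth_on_def by blast

lemma smooth_at_add:
  assumes "smooth_at f z" "smooth_at g z" shows "smooth_at (\<lambda>x. f x + g x) z"
  using smooth_at_common[OF assms] unfolding smooth_at_def smooth_on_def
  by (metis cont_diff_on_add)

lemma smooth_at_bilinear:
  assumes "bounded_bilinear B" "smooth_at f z" "smooth_at g z" shows "smooth_at (\<lambda>x. B (f x) (g x)) z"
  using smooth_at_common[OF assms(2,3)] unfolding smooth_at_def smooth_on_def
  by (metis cont_diff_on_bilinear[OF assms(1)])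

lemma smooth_at_minus: "smooth_at f z \<Longrightarrow> smooth_at (\<lambda>x. - f x) z"
  by (rule smooth_at_linear[OF bounded_linear_minus[OF bounded_linear_ident]])

lemma smooth_at_diff: "smooth_at f z \<Longrightarrow> smooth_at g z \<Longrightarrow> smooth_at (\<lambda>x. f x - g x) z"
  using smooth_at_add[of f z "\<lambda>x. - g x"] smooth_at_minus by auto

lemma smooth_at_mult:
  fixes f :: "_ \<Rightarrow> 'b::real_normed_algebra"
  shows "smooth_at f z \<Longrightarrow> smooth_at g z \<Longrightarrow> smooth_at (\<lambda>x. f x * g x) z"
  by (rule smooth_at_bilinear[OF bounded_bilinear_mult])

lemma smooth_at_scaleR: "smooth_at f z \<Longrightarrow> smooth_at g z \<Longrightarrow> smooth_at (\<lambda>x. f x *\<^sub>R g x) z"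
  by (rule smooth_at_bilinear[OF bounded_bilinear_scaleR])

lemma smooth_at_sum: "(\<And>i. i \<in> I \<Longrightarrow> smooth_at (f i) z) \<Longrightarrow> smooth_at (\<lambda>x. \<Sum>i\<in>I. f i x) z"
  by (induction I rule: infinite_finite_induct) (auto intro: smooth_at_const smooth_at_add)

lemma smooth_at_compose:
  fixes g :: "'b::euclidean_space \<Rightarrow> 'c::real_normed_vector"
  assumes "smooth_at f z" "smooth_at g (f z)"
  shows "smooth_at (\<lambda>x. g (f x)) z"
proof -
  obtain U V where U: "open U" "z \<in> U" "smooth_on U f" and V: "open V" "f z \<in> V" "smooth_on V g"
    using assms by (auto simp: smooth_at_def)
  have o: "open (U \<inter> f -` V)"
    using continuous_open_preimage[OF smooth_on_imp_continuous_on[OF U(3)] U(1) V(1)] .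
  have "cont_diff_on k (U \<inter> f -` V) (\<lambda>x. g (f x))" for k
  proof (rule cont_diff_on_compose[OF o V(1)])
    show "cont_diff_on k (U \<inter> f -` V) f"
      using U(3) cont_diff_on_subset unfolding smooth_on_def by blast
  qed (use V(3) in \<open>auto simp: smooth_on_def\<close>)
  then show ?thesis unfolding smooth_at_def smooth_on_def using o U V by blast
qed

lemma smooth_at_eventually_in:
  assumes "smooth_at f z" "open T" "f z \<in> T"
  shows "\<exists>U. open U \<and> z \<in> U \<and> smooth_on U f \<and> f ` U \<subseteq> T"
proof -
  obtain U where U: "open U" "z \<in> U" "smooth_on U f" using assms by (auto simp: smooth_at_def)
  have "open (U \<inter> f -` T)"
    using continuous_open_preimage[OF smooth_on_imp_continuous_on[OF U(3)] U(1) assms(2)] .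
  then show ?thesis
    using U assms smooth_on_subset[OF U(3), of "U \<inter> f -` T"]
    by (intro exI[of _ "U \<inter> f -` T"]) auto
qed

lemma smooth_at_inverse:
  fixes f :: "_ \<Rightarrow> 'b::real_normed_field"
  assumes "smooth_at f z" "f z \<noteq> 0" shows "smooth_at (\<lambda>x. inverse (f x)) z"
proof -
  obtain U where "open U" "z \<in> U" "smooth_on U f" "f ` U \<subseteq> -{0}"
    using smooth_at_eventually_in[OF assms(1) open_Compl[OF closed_singleton[of 0]]] assms(2) by blast
  then show ?thesis unfolding smooth_at_def smooth_on_def
    by (intro exI[of _ U] conjI allI cont_diff_on_inverse) auto
qed

lemma smooth_at_divide:
  fixes f :: "_ \<Rightarrow> 'b::real_normed_field"
  assumes "smooth_at f z" "smooth_at g z" "g z \<noteq> 0" shows "smooth_at (\<lambda>x. f x / g x) z"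
  unfolding divide_inverse by (intro smooth_at_mult smooth_at_inverse assms)

lemma smooth_at_sqrt:
  fixes f :: "_ \<Rightarrow> real"
  assumes "smooth_at f z" "f z > 0" shows "smooth_at (\<lambda>x. sqrt (f x)) z"
proof -
  obtain U where "open U" "z \<in> U" "smooth_on U f" "f ` U \<subseteq> {0<..}"
    using smooth_at_eventually_in[OF assms(1) open_greaterThan[of 0]] assms(2) by blast
  then show ?thesis unfolding smooth_at_def smooth_on_def
    by (intro exI[of _ U] conjI allI cont_diff_on_sqrt) auto
qed

lemma smooth_at_power:
  fixes f :: "_ \<Rightarrow> 'b::real_normed_algebra_1"
  shows "smooth_at f z \<Longrightarrow> smooth_at (\<lambda>x. f x ^ n) z"
  by (induction n) (auto intro: smooth_at_const smooth_at_mult)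

lemma smooth_at_holomorphic: "open S \<Longrightarrow> f holomorphic_on S \<Longrightarrow> z \<in> S \<Longrightarrow> smooth_at f z"
  unfolding smooth_at_def smooth_on_def using cont_diff_on_holomorphic by blast

lemma smooth_at_flat_exp: "c > 0 \<Longrightarrow> smooth_at f z \<Longrightarrow> smooth_at (\<lambda>x. flat_exp c n (f x)) z"
  by (rule smooth_at_compose) (auto simp: smooth_at_def smooth_on_def intro!: exI[of _ UNIV] cont_diff_on_flat_exp)

lemma smooth_at_Pair:
  assumes "smooth_at f z" "smooth_at g z" shows "smooth_at (\<lambda>x. (f x, g x)) z"
proof -
  have "smooth_at (\<lambda>x. (f x, 0) + (0, g x)) z"
    by (intro smooth_at_add smooth_at_linear[where L = "\<lambda>y. (y, 0)"] smooth_at_linear[where L = "\<lambda>y. (0, y)"]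
        bounded_linear_Pair bounded_linear_ident bounded_linear_zero assms)
  then show ?thesis by simp
qed

lemmas smooth_at_fst = smooth_at_linear[OF bounded_linear_fst]
  and smooth_at_snd = smooth_at_linear[OF bounded_linear_snd]
  and smooth_at_Re = smooth_at_linear[OF bounded_linear_Re]
  and smooth_at_Im = smooth_at_linear[OF bounded_linear_Im]
  and smooth_at_cnj = smooth_at_linear[OF bounded_linear_cnj]
  and smooth_at_of_real = smooth_at_linear[OF bounded_linear_of_real]

lemmas smooth_intros = smooth_at_const smooth_at_ident smooth_at_add smooth_at_minus smooth_at_diff
  smooth_at_mult smooth_at_scaleR smooth_at_sum smooth_at_inverse smooth_at_divide smooth_at_sqrt
  smooth_at_power smooth_at_flat_exp smooth_at_Pair smooth_at_fst smooth_at_snd smooth_at_Re smooth_at_Im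
  smooth_at_cnj smooth_at_of_real

section \<open>Symmetry of second derivatives\<close>

lemma frechet_derivative_linear_comp:
  assumes "bounded_linear L" "f differentiable (at x)"
  shows "fderiv (\<lambda>x. L (f x)) x v = L (fderiv f x v)"
  using frechet_derivative_at[OF bounded_linear.has_derivative[OF assms(1)
        assms(2)[unfolded frechet_derivative_works]]] by metis

text \<open>The mean value theorem is applied twice, along \<open>u\<close> to the increment of
  \<open>f\<close> under the shift by \<open>h *\<^sub>R v\<close>, then along \<open>v\<close> to
  the derivative in direction \<open>u\<close>. The point is that the second difference on the left
  is symmetric in \<open>u\<close> and \<open>v\<close>.\<close>

lemma second_difference:
  fixes f :: "'a::real_normed_vector \<Rightarrow> real"
  assumes "smooth_on (ball z r) f" "0 < h" "h * (norm u + norm v) < r"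
  shows "\<exists>p. dist z p \<le> h * (norm u + norm v) \<and>
    f (z + h *\<^sub>R u + h *\<^sub>R v) - f (z + h *\<^sub>R u) - f (z + h *\<^sub>R v) + f z =
      h\<^sup>2 * fderiv (\<lambda>x. fderiv f x u) p v"
proof -
  \<comment> \<open>The whole parallelogram spanned by the two increments stays in the ball where
    \<open>f\<close> is smooth.\<close>
  have near: "z + s *\<^sub>R u + t *\<^sub>R v \<in> ball z r" "dist z (z + s *\<^sub>R u + t *\<^sub>R v) \<le> h * (norm u + norm v)"
    if "0 \<le> s" "s \<le> h" "0 \<le> t" "t \<le> h" for s t
  proof -
    have "norm (s *\<^sub>R u + t *\<^sub>R v) \<le> s * norm u + t * norm v"
      using that norm_triangle_ineq[of "s *\<^sub>R u" "t *\<^sub>R v"] by simp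
    also have "\<dots> \<le> h * (norm u + norm v)"
      using that by (simp add: distrib_left add_mono mult_right_mono)
    finally show "dist z (z + s *\<^sub>R u + t *\<^sub>R v) \<le> h * (norm u + norm v)"
      by (metis add.assoc add_diff_cancel_left' dist_commute dist_norm)
    then show "z + s *\<^sub>R u + t *\<^sub>R v \<in> ball z r" using assms(3) by simp
  qed
  have df: "(f has_derivative fderiv f x) (at x)"
    "((\<lambda>x. fderiv f x u) has_derivative
        fderiv (\<lambda>x. fderiv f x u) x) (at x)" if "x \<in> ball z r" for x
  proof -
    have "smooth_at f x" using that assms(1) by (simp add: smooth_on_iff_smooth_at)
    then show "(f has_derivative fderiv f x) (at x)"
      "((\<lambda>x. fderiv f x u) has_derivative
        fderiv (\<lambda>x. fderiv f x u) x) (at x)"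
      by (auto intro: smooth_at_has_derivative smooth_at_fderiv)
  qed
  have line: "((\<lambda>s. g (a + s *\<^sub>R w)) has_real_derivative g' w) (at s)"
    if "(g has_derivative g') (at (a + s *\<^sub>R w))" for g :: "'a \<Rightarrow> real" and g' a w s
  proof -
    have "((\<lambda>s. g (a + s *\<^sub>R w)) has_derivative (\<lambda>t. g' (t *\<^sub>R w))) (at s)"
      by (rule has_derivative_compose[where f = "\<lambda>s. a + s *\<^sub>R w", OF _ that]) (auto intro!: derivative_eq_intros)
    moreover have "g' (t *\<^sub>R w) = t * g' w" for t
      using linear_cmul[OF has_derivative_linear[OF that]] by simp
    ultimately show ?thesis by (simp add: has_field_derivative_def mult.commute[of _ "g' w"])
  qed
  define d where "d = (\<lambda>s. fderiv f (z + s *\<^sub>R u + h *\<^sub>R v) u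
      - fderiv f (z + s *\<^sub>R u) u)"
  have "((\<lambda>s. f (z + s *\<^sub>R u + h *\<^sub>R v) - f (z + s *\<^sub>R u)) has_real_derivative d s) (at s)"
    if "0 \<le> s" "s \<le> h" for s
  proof -
    have "((\<lambda>s. f ((z + h *\<^sub>R v) + s *\<^sub>R u)) has_real_derivative
        fderiv f ((z + h *\<^sub>R v) + s *\<^sub>R u) u) (at s)"
      using df(1)[OF near(1)[of s h]] that assms(2) by (intro line) (simp add: ac_simps)
    moreover have "((\<lambda>s. f (z + s *\<^sub>R u)) has_real_derivative fderiv f (z + s *\<^sub>R u) u) (at s)"
      using df(1)[OF near(1)[of s 0]] that assms(2) by (intro line) simp
    ultimately show ?thesis unfolding d_def
      by (auto intro!: DERIV_diff simp: ac_simps)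
  qed
  from MVT2[OF assms(2), of _ d, OF this] obtain s where s: "0 < s" "s < h"
    "f (z + h *\<^sub>R u + h *\<^sub>R v) - f (z + h *\<^sub>R u) - (f (z + 0 *\<^sub>R u + h *\<^sub>R v) - f (z + 0 *\<^sub>R u)) = (h - 0) * d s"
    by blast
  have "((\<lambda>t. fderiv f (z + s *\<^sub>R u + t *\<^sub>R v) u) has_real_derivative
      fderiv (\<lambda>x. fderiv f x u) (z + s *\<^sub>R u + t *\<^sub>R v) v) (at t)"
    if "0 \<le> t" "t \<le> h" for t
    using df(2)[OF near(1)[of s t]] that s by (intro line[where g = "\<lambda>x. fderiv f x u"]) simp
  from MVT2[OF assms(2), of "\<lambda>t. fderiv f (z + s *\<^sub>R u + t *\<^sub>R v) u"
      "\<lambda>t. fderiv (\<lambda>x. fderiv f x u) (z + s *\<^sub>R u + t *\<^sub>R v) v", OF this]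
  obtain t where t: "0 < t" "t < h"
    "d s = h * fderiv (\<lambda>x. fderiv f x u) (z + s *\<^sub>R u + t *\<^sub>R v) v"
    by (auto simp: d_def)
  show ?thesis
    by (rule exI[of _ "z + s *\<^sub>R u + t *\<^sub>R v"]) (use s t near(2)[of s t] in \<open>simp add: power2_eq_square algebra_simps\<close>)
qed

text \<open>One and the same second difference equals h^2 times either mixed derivative, each at
  some point close to \<open>z\<close>; continuity of both at \<open>z\<close> rules out different
  values.\<close>

lemma symmetric_second_derivative_real:
  fixes f :: "'a::real_normed_vector \<Rightarrow> real"
  assumes "smooth_at f z"
  shows "fderiv (\<lambda>x. fderiv f x u) z v =
    fderiv (\<lambda>x. fderiv f x v) z u" (is "?A z = ?B z")
proof (rule ccontr)
  assume ne: "?A z \<noteq> ?B z"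
  \<comment> \<open>Half the gap, so that no number can be within \<open>e\<close> of both
    values.\<close>
  define e where "e = \<bar>?A z - ?B z\<bar> / 2"
  have e: "e > 0" using ne by (simp add: e_def)
  obtain U where U: "open U" "z \<in> U" "smooth_on U f" using assms by (auto simp: smooth_at_def)
  obtain r where r: "r > 0" "ball z r \<subseteq> U" using U open_contains_ball by blast
  have "isCont ?A z" "isCont ?B z"
    by (intro smooth_at_isCont smooth_at_fderiv assms)+
  then obtain d1 d2 where d: "d1 > 0" "\<And>p. dist p z < d1 \<Longrightarrow> dist (?A p) (?A z) < e"
    "d2 > 0" "\<And>p. dist p z < d2 \<Longrightarrow> dist (?B p) (?B z) < e"
    using e unfolding continuous_at_eps_delta by metis
  define m where "m = min r (min d1 d2)"
  \<comment> \<open>The summand 1 keeps the denominator positive when both directions are zero and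
    makes the bound on \<open>h * (norm u + norm v)\<close> strict.\<close>
  define h where "h = m / (norm u + norm v + 1)"
  have m: "m > 0" using r d by (simp add: m_def)
  have h: "h > 0" using m by (simp add: h_def add_nonneg_pos)
  have hm: "h * (norm u + norm v) < m"
  proof -
    have "0 < norm u + norm v + 1" by (simp add: add_nonneg_pos)
    then show ?thesis using m by (simp add: h_def pos_divide_less_eq algebra_simps)
  qed
  have sm: "smooth_on (ball z r) f" using U r smooth_on_subset by blast
  obtain p where p: "dist z p \<le> h * (norm u + norm v)"
    "f (z + h *\<^sub>R u + h *\<^sub>R v) - f (z + h *\<^sub>R u) - f (z + h *\<^sub>R v) + f z = h\<^sup>2 * ?A p"
    using second_difference[OF sm h, of u v] hm by (auto simp: m_def)
  obtain q where q: "dist z q \<le> h * (norm v + norm u)"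
    "f (z + h *\<^sub>R v + h *\<^sub>R u) - f (z + h *\<^sub>R v) - f (z + h *\<^sub>R u) + f z = h\<^sup>2 * ?B q"
    using second_difference[OF sm h, of v u] hm by (auto simp: m_def add.commute)
  have eq: "z + h *\<^sub>R v + h *\<^sub>R u = z + h *\<^sub>R u + h *\<^sub>R v" by simp
  have "h\<^sup>2 * ?A p = h\<^sup>2 * ?B q" using p(2) q(2) unfolding eq by linarith
  then have "?A p = ?B q" using h by simp
  moreover have "dist p z < d1" "dist q z < d2"
    using p(1) q(1) hm by (auto simp: m_def dist_commute add.commute)
  ultimately have "dist (?A p) (?A z) < e" "dist (?A p) (?B z) < e"
    using d(2)[of p] d(4)[of q] by simp_all
  moreover have "dist (?A z) (?B z) = 2 * e" by (simp add: e_def dist_real_def)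
  ultimately show False using dist_triangle3[of "?A z" "?B z" "?A p"] by linarith
qed

text \<open>The mean value theorem is a statement on real functions, so real and imaginary part are
  treated separately.\<close>

lemma symmetric_second_derivative:
  fixes f :: "'a::real_normed_vector \<Rightarrow> complex"
  assumes "smooth_at f z"
  shows "fderiv (\<lambda>x. fderiv f x u) z v =
    fderiv (\<lambda>x. fderiv f x v) z u"
proof -
  have *: "L (fderiv (\<lambda>x. fderiv f x u) z v) =
      fderiv (\<lambda>x. fderiv (\<lambda>x. L (f x)) x u) z v"
    if L: "bounded_linear L" for L :: "complex \<Rightarrow> real" and u v
  proof -
    obtain S where S: "open S" "z \<in> S" "\<And>x. x \<in> S \<Longrightarrow> smooth_at f x"
      using smooth_at_eventually[OF assms] by (auto simp: eventually_nhds)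
    have "fderiv (\<lambda>x. fderiv (\<lambda>x. L (f x)) x u) z =
       fderiv (\<lambda>x. L (fderiv f x u)) z"
      using frechet_derivative_linear_comp[OF L smooth_at_differentiable[OF S(3)]]
      by (intro frechet_derivative_cong_open[OF S(1,2)])
    then show ?thesis
      using frechet_derivative_linear_comp[OF L smooth_at_differentiable[OF smooth_at_fderiv[OF assms]]]
      by simp
  qed
  show ?thesis
    by (rule complex_eqI)
      (simp_all only: *[OF bounded_linear_Re] *[OF bounded_linear_Im]
        symmetric_second_derivative_real[OF smooth_at_Re[OF assms]]
        symmetric_second_derivative_real[OF smooth_at_Im[OF assms]])
qed

section \<open>Wirtinger derivatives and the compactly supported Poincare lemma\<close>

lemma wirt_has_derivative:
  assumes "f differentiable (at z)"
  shows "(f has_derivative (\<lambda>v. wirt_z f z * v + wirt_zbar f z * cnj v)) (at z)"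
proof -
  have d: "(f has_derivative fderiv f z) (at z)"
    using assms frechet_derivative_works by blast
  have lin: "linear (fderiv f z)" using has_derivative_linear[OF d] .
  have "fderiv f z v = wirt_z f z * v + wirt_zbar f z * cnj v" for v
  proof -
    have "v = Re v *\<^sub>R 1 + Im v *\<^sub>R \<i>" by (simp add: complex_eq_iff)
    then have "fderiv f z v =
        Re v *\<^sub>R fderiv f z 1 + Im v *\<^sub>R fderiv f z \<i>"
      using linear_add[OF lin] linear_cmul[OF lin] by metis
    then show ?thesis
      by (simp add: wirt_z_def wirt_zbar_def complex_eq_iff field_simps)
  qed
  then show ?thesis using d by (metis (no_types, lifting) ext)
qed

text \<open>A real linear map of the plane splits uniquely into a complex linear and an antilinear
  part. Bringing a derivative into this form therefore computes both Wirtinger derivatives at once,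
  which is how the rules below are obtained.\<close>

lemma wirt_unique:
  assumes "(f has_derivative (\<lambda>v. a * v + b * cnj v)) (at z)"
  shows "wirt_z f z = a" "wirt_zbar f z = b"
  unfolding wirt_z_def wirt_zbar_def frechet_derivative_at[OF assms, symmetric]
  by (simp_all add: complex_eq_iff)

lemma wirt_cong:
  assumes "eventually (\<lambda>x. f x = g x) (nhds z)"
  shows "wirt_z f z = wirt_z g z" (is ?A)
    and "wirt_zbar f z = wirt_zbar g z" (is ?B)
proof -
  obtain S where "open S" "z \<in> S" "\<And>x. x \<in> S \<Longrightarrow> f x = g x"
    using assms by (auto simp: eventually_nhds)
  then have "fderiv f z = fderiv g z"
    using frechet_derivative_cong_open by blast
  then show "wirt_z f z = wirt_z g z" "wirt_zbar f z = wirt_zbar g z"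
    by (simp_all add: wirt_z_def wirt_zbar_def)
qed

lemma wirt_const: "wirt_z (\<lambda>x. c) z = 0" "wirt_zbar (\<lambda>x. c) z = 0"
  by (rule wirt_unique[where a = 0 and b = 0], simp)+

lemma wirt_add:
  assumes "f differentiable (at z)" "g differentiable (at z)"
  shows "wirt_z (\<lambda>x. f x + g x) z = wirt_z f z + wirt_z g z" (is ?A)
    and "wirt_zbar (\<lambda>x. f x + g x) z = wirt_zbar f z + wirt_zbar g z" (is ?B)
proof -
  have "((\<lambda>x. f x + g x) has_derivative
      (\<lambda>v. (wirt_z f z + wirt_z g z) * v + (wirt_zbar f z + wirt_zbar g z) * cnj v)) (at z)"
    by (rule has_derivative_eq_rhs[OF has_derivative_add[OF wirt_has_derivative[OF assms(1)]
        wirt_has_derivative[OF assms(2)]]]) (simp add: algebra_simps)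
  from wirt_unique[OF this] show ?A ?B .
qed

lemma wirt_mult:
  assumes "f differentiable (at z)" "g differentiable (at z)"
  shows "wirt_z (\<lambda>x. f x * g x) z = wirt_z f z * g z + f z * wirt_z g z" (is ?A)
    and "wirt_zbar (\<lambda>x. f x * g x) z = wirt_zbar f z * g z + f z * wirt_zbar g z" (is ?B)
proof -
  have "((\<lambda>x. f x * g x) has_derivative
      (\<lambda>v. (wirt_z f z * g z + f z * wirt_z g z) * v + (wirt_zbar f z * g z + f z * wirt_zbar g z) * cnj v)) (at z)"
    by (rule has_derivative_eq_rhs[OF has_derivative_mult[OF wirt_has_derivative[OF assms(1)]
        wirt_has_derivative[OF assms(2)]]]) (simp add: algebra_simps)
  from wirt_unique[OF this] show ?A ?B .
qed

lemma wirt_cmult: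
  assumes "f differentiable (at z)"
  shows "wirt_z (\<lambda>x. c * f x) z = c * wirt_z f z" "wirt_zbar (\<lambda>x. c * f x) z = c * wirt_zbar f z"
  using wirt_mult[of "\<lambda>x. c" z f] assms by (simp_all add: wirt_const)

lemma wirt_minus:
  assumes "f differentiable (at z)"
  shows "wirt_z (\<lambda>x. - f x) z = - wirt_z f z" "wirt_zbar (\<lambda>x. - f x) z = - wirt_zbar f z"
  using wirt_cmult[OF assms, of "-1"] by simp_all

lemma wirt_cnj:
  assumes "f differentiable (at z)"
  shows "wirt_z (\<lambda>x. cnj (f x)) z = cnj (wirt_zbar f z)" (is ?A)
    and "wirt_zbar (\<lambda>x. cnj (f x)) z = cnj (wirt_z f z)" (is ?B)
proof -
  have "((\<lambda>x. cnj (f x)) has_derivative (\<lambda>v. cnj (wirt_zbar f z) * v + cnj (wirt_z f z) * cnj v)) (at z)"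
    by (rule has_derivative_eq_rhs[OF has_derivative_cnj[OF wirt_has_derivative[OF assms]]])
      (simp add: algebra_simps)
  from wirt_unique[OF this] show ?A ?B .
qed

lemma wirt_inverse:
  assumes "f differentiable (at z)" "f z \<noteq> 0"
  shows "wirt_z (\<lambda>x. inverse (f x)) z = - wirt_z f z / (f z)\<^sup>2" (is ?A)
    and "wirt_zbar (\<lambda>x. inverse (f x)) z = - wirt_zbar f z / (f z)\<^sup>2" (is ?B)
proof -
  have "((\<lambda>x. inverse (f x)) has_derivative
      (\<lambda>v. (- wirt_z f z / (f z)\<^sup>2) * v + (- wirt_zbar f z / (f z)\<^sup>2) * cnj v)) (at z)"
    by (rule has_derivative_eq_rhs[OF Deriv.has_derivative_inverse[OF assms(2) wirt_has_derivative[OF assms(1)]]])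
      (use assms(2) in \<open>simp add: fun_eq_iff field_simps power2_eq_square\<close>)
  from wirt_unique[OF this] show ?A ?B .
qed

lemma wirt_holomorphic:
  assumes "(f has_field_derivative D) (at z)"
  shows "wirt_z f z = D" "wirt_zbar f z = 0"
  using assms by (auto intro!: wirt_unique[where a = D and b = 0] simp: has_field_derivative_def)

text \<open>Precomposition with a complex linear map respects the splitting: \<open>v\<close>
  becomes \<open>D * v\<close> and \<open>cnj v\<close> becomes
  \<open>cnj D * cnj v\<close>.\<close>

lemma wirt_compose_holomorphic:
  assumes "(T has_field_derivative D) (at z)" "f differentiable (at (T z))"
  shows "wirt_z (\<lambda>x. f (T x)) z = wirt_z f (T z) * D" (is ?A)
    and "wirt_zbar (\<lambda>x. f (T x)) z = wirt_zbar f (T z) * cnj D" (is ?B)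
proof -
  have "((\<lambda>x. f (T x)) has_derivative
      (\<lambda>v. (wirt_z f (T z) * D) * v + (wirt_zbar f (T z) * cnj D) * cnj v)) (at z)"
    by (rule has_derivative_eq_rhs[OF has_derivative_compose[OF assms(1)[unfolded has_field_derivative_def]
        wirt_has_derivative[OF assms(2)]]]) (simp add: algebra_simps)
  from wirt_unique[OF this] show ?A ?B .
qed

lemma smooth_at_wirt:
  assumes "smooth_at f z"
  shows "smooth_at (wirt_z f) z" "smooth_at (wirt_zbar f) z"
  unfolding wirt_z_def wirt_zbar_def
  by (intro smooth_intros smooth_at_fderiv assms; simp)+

text \<open>Both sides are the same combination of second derivatives in the directions 1 and \<i>,
  once the two mixed ones agree.\<close>

lemma wirt_commute:
  assumes "smooth_at f z"
  shows "wirt_z (wirt_zbar f) z = wirt_zbar (wirt_z f) z"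
proof -
  let ?D = "\<lambda>g v x. fderiv g x v"
  have D: "smooth_at (?D f v) z" for v by (rule smooth_at_fderiv[OF assms])
  \<comment> \<open>The constant \<open>c\<close> stands for \<i> or its negative, so one
    computation serves both Wirtinger derivatives.\<close>
  have lin: "?D (\<lambda>x. (?D f 1 x + c * ?D f \<i> x) / 2) v z = (?D (?D f 1) v z + c * ?D (?D f \<i>) v z) / 2" for c v
  proof -
    have "((\<lambda>x. (?D f 1 x + c * ?D f \<i> x) / 2) has_derivative
        (\<lambda>v. (?D (?D f 1) v z + c * ?D (?D f \<i>) v z) / 2)) (at z)"
      using smooth_at_has_derivative[OF D] by (auto intro!: derivative_eq_intros)
    from fun_cong[OF frechet_derivative_at[OF this], of v] show ?thesis by (rule sym)
  qed
  let ?A = "\<lambda>u v. ?D (?D f u) v z"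
  have "wirt_zbar f = (\<lambda>x. (?D f 1 x + \<i> * ?D f \<i> x) / 2)" by (auto simp: wirt_zbar_def)
  then have 1: "?D (wirt_zbar f) v z = (?A 1 v + \<i> * ?A \<i> v) / 2" for v
    by (simp only: lin)
  have "wirt_z f = (\<lambda>x. (?D f 1 x + (- \<i>) * ?D f \<i> x) / 2)" by (auto simp: wirt_z_def)
  then have 2: "?D (wirt_z f) v z = (?A 1 v + (- \<i>) * ?A \<i> v) / 2" for v
    by (simp only: lin)
  have alg: "((a + \<i> * b) / 2 - \<i> * ((b + \<i> * c) / 2)) / 2 = ((a + - \<i> * b) / 2 + \<i> * ((b + - \<i> * c) / 2)) / 2"
    for a b c :: complex by (simp add: field_simps)
  have "wirt_z (wirt_zbar f) z = (?D (wirt_zbar f) 1 z - \<i> * ?D (wirt_zbar f) \<i> z) / 2"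
    by (rule wirt_z_def)
  also have "\<dots> = (?D (wirt_z f) 1 z + \<i> * ?D (wirt_z f) \<i> z) / 2"
    unfolding 1 2 symmetric_second_derivative[OF assms, of 1 \<i>] by (rule alg)
  also have "\<dots> = wirt_zbar (wirt_z f) z"
    by (rule wirt_zbar_def[symmetric])
  finally show ?thesis .
qed

section \<open>Primitives along horizontal lines\<close>

lemma fderiv_Pair_apply:
  assumes "F differentiable (at (x, t))"
  shows "((\<lambda>x. F (x, t)) has_derivative (\<lambda>v. fderiv F (x, t) (v, 0))) (at x)"
  by (rule has_derivative_compose[where f = "\<lambda>x. (x, t)" and g = F])
    (auto intro!: derivative_eq_intros assms[unfolded frechet_derivative_works])

text \<open>The derivative under the integral sign has the same form, with \<open>F\<close> replaced
  by one of its directional derivatives, which is again smooth. So the induction on \<open>k\<close>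
  only needs the first derivative, for arbitrary \<open>F\<close>.\<close>

lemma cont_diff_on_integral:
  fixes F :: "'a::euclidean_space \<times> real \<Rightarrow> real"
  assumes "smooth_on UNIV F"
  shows "cont_diff_on k UNIV (\<lambda>x. integral {0..1} (\<lambda>t. F (x, t)))"
    and "((\<lambda>x. integral {0..1} (\<lambda>t. F (x, t))) has_derivative
        (\<lambda>v. integral {0..1} (\<lambda>t. fderiv F (x, t) (v, 0)))) (at x)"
proof -
  have deriv: "((\<lambda>x. integral {0..1} (\<lambda>t. F (x, t))) has_derivative
        (\<lambda>v. integral {0..1} (\<lambda>t. fderiv F (x, t) (v, 0)))) (at x)"
    if F: "smooth_on UNIV F" for F :: "'a \<times> real \<Rightarrow> real" and x
  proof -
    have F': "smooth_at F p" for p using F unfolding smooth_UNIV_iff by blast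
    \<comment> \<open>The Leibniz rule asks for a derivative that is continuous as a bounded linear
      map; in finite dimension it suffices to check this on single vectors.\<close>
    define fx where "fx = (\<lambda>x t. Blinfun (\<lambda>v. fderiv F (x, t) (v, 0)))"
    have app: "blinfun_apply (fx x t) = (\<lambda>v. fderiv F (x, t) (v, 0))" for x t
      unfolding fx_def
      by (rule bounded_linear_Blinfun_apply)
        (rule has_derivative_bounded_linear[OF fderiv_Pair_apply[OF smooth_at_differentiable[OF F']]])
    have contF: "continuous_on UNIV F" using F smooth_on_imp_continuous_on by blast
    have contD: "continuous_on UNIV (\<lambda>p. fderiv F p w)" for w
      using smooth_on_imp_continuous_on smooth_UNIV_iff smooth_at_fderiv[OF F'] by blast
    have cont_fx: "continuous_on UNIV (\<lambda>(x, t). fx x t)"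
      by (rule continuous_on_blinfun_componentwise) (simp add: app split_beta contD)
    have int_fx: "fx x integrable_on {0..1}" for x
      by (rule integrable_continuous_interval)
        (rule continuous_on_compose2[OF cont_fx, of _ "\<lambda>t. (x, t)", simplified], auto intro!: continuous_intros)
    have "((\<lambda>x. integral (cbox 0 1) (\<lambda>t. F (x, t))) has_derivative integral (cbox 0 1) (fx x)) (at x within UNIV)"
    proof (rule leibniz_rule)
      show "((\<lambda>x. F (x, t)) has_derivative blinfun_apply (fx x t)) (at x within UNIV)" for x t
        unfolding app using fderiv_Pair_apply[OF smooth_at_differentiable[OF F']] by simp
      show "(\<lambda>t. F (x, t)) integrable_on cbox 0 1" for x
        by (rule integrable_continuous)
          (rule continuous_on_compose2[OF contF], auto intro!: continuous_intros)
      show "continuous_on (UNIV \<times> cbox 0 1) (\<lambda>(x, t). fx x t)"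
        using cont_fx continuous_on_subset by blast
    qed auto
    moreover have "blinfun_apply (integral (cbox 0 1) (fx x)) =
        (\<lambda>v. integral {0..1} (\<lambda>t. fderiv F (x, t) (v, 0)))"
    proof
      fix v
      have "integral {0..1} ((\<lambda>b. blinfun_apply b v) \<circ> fx x) = blinfun_apply (integral {0..1} (fx x)) v"
        by (rule integral_linear[OF int_fx blinfun.bounded_linear_left])
      then show "blinfun_apply (integral (cbox 0 1) (fx x)) v =
          integral {0..1} (\<lambda>t. fderiv F (x, t) (v, 0))"
        by (simp add: o_def app)
    qed
    ultimately show ?thesis by simp
  qed
  show "cont_diff_on k UNIV (\<lambda>x. integral {0..1} (\<lambda>t. F (x, t)))"
    using assms
  proof (induction k arbitrary: F)
    case 0
    have "continuous_on UNIV (\<lambda>x. integral {0..1} (\<lambda>t. F (x, t)))"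
      using deriv[OF 0] has_derivative_continuous by (blast intro: continuous_at_imp_continuous_on)
    then show ?case by simp
  next
    case (Suc k)
    have "smooth_on UNIV (\<lambda>p. fderiv F p w)" for w
      using Suc.prems smooth_at_fderiv smooth_UNIV_iff by metis
    then show ?case
      by (intro cont_diff_on_SucI[OF open_UNIV deriv[OF Suc.prems]] Suc.IH)
  qed
  show "((\<lambda>x. integral {0..1} (\<lambda>t. F (x, t))) has_derivative
        (\<lambda>v. integral {0..1} (\<lambda>t. fderiv F (x, t) (v, 0)))) (at x)"
    by (rule deriv[OF assms])
qed

text \<open>Integrating over the fixed interval \<open>[0, 1]\<close> makes the primitive a smooth function of the end point.\<close>

definition hprim :: "real \<Rightarrow> (complex \<Rightarrow> real) \<Rightarrow> complex \<Rightarrow> real" where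
  "hprim lo w z = integral {0..1} (\<lambda>t. (Re z - lo) * w (Complex (lo + t * (Re z - lo)) (Im z)))"

lemma smooth_at_Complex:
  "smooth_at f z \<Longrightarrow> smooth_at g z \<Longrightarrow> smooth_at (\<lambda>x. Complex (f x) (g x)) z"
  unfolding Complex_eq by (intro smooth_intros)

lemma hprim_integrand_smooth:
  assumes "smooth_on UNIV w"
  shows "smooth_on UNIV (\<lambda>(z, t). (Re z - lo) * w (Complex (lo + t * (Re z - lo)) (Im z)))"
  unfolding smooth_UNIV_iff split_beta
proof
  fix p :: "complex \<times> real"
  have "smooth_at w z" for z using assms by (simp add: smooth_UNIV_iff)
  then have "smooth_at (\<lambda>p. w (Complex (lo + snd p * (Re (fst p) - lo)) (Im (fst p)))) p"
    by (rule smooth_at_compose[where g = w and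
          f = "\<lambda>p. Complex (lo + snd p * (Re (fst p) - lo)) (Im (fst p))", rotated])
      (intro smooth_at_Complex smooth_intros)
  then show "smooth_at (\<lambda>p. (Re (fst p) - lo) * w (Complex (lo + snd p * (Re (fst p) - lo)) (Im (fst p)))) p"
    by (intro smooth_intros)
qed

lemma smooth_hprim: "smooth_on UNIV w \<Longrightarrow> smooth_on UNIV (hprim lo w)"
proof -
  assume "smooth_on UNIV w"
  from cont_diff_on_integral(1)[OF hprim_integrand_smooth[OF this], of _ lo]
  have "cont_diff_on k UNIV (hprim lo w)" for k
    unfolding hprim_def[abs_def] prod.case .
  then show ?thesis by (simp add: smooth_on_def)
qed

text \<open>Differentiating the integrand with respect to the end point x gives exactly the
  t-derivative of \<open>t * w (Complex (lo + t * (x - lo)) y)\<close>, so the integral over t is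
  evaluated by the fundamental theorem.\<close>

lemma hprim_has_derivative:
  assumes "smooth_on UNIV w"
  shows "((\<lambda>s. hprim lo w (Complex s y)) has_real_derivative w (Complex x y)) (at x)"
proof -
  define F where "F = (\<lambda>(z, t). (Re z - lo) * w (Complex (lo + t * (Re z - lo)) (Im z)))"
  have w: "(w has_derivative fderiv w p) (at p)" for p
    using assms smooth_at_has_derivative unfolding smooth_UNIV_iff by blast
  have F: "smooth_on UNIV F" unfolding F_def by (rule hprim_integrand_smooth[OF assms])
  let ?D = "\<lambda>t. fderiv w (Complex (lo + t * (x - lo)) y) 1"
  have wl: "((\<lambda>s. w (Complex (g s) y)) has_real_derivative
      g' * fderiv w (Complex (g s) y) 1) (at s)"
    if "(g has_real_derivative g') (at s)" for g g' s
  proof -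
    have "((\<lambda>s. Complex (g s) y) has_derivative (\<lambda>t. complex_of_real (t * g'))) (at s)"
      unfolding Complex_eq using that
      by (auto intro!: derivative_eq_intros simp: has_field_derivative_def mult.commute)
    from has_derivative_compose[OF this w]
    have "((\<lambda>s. w (Complex (g s) y)) has_derivative
        (\<lambda>t. fderiv w (Complex (g s) y) ((t * g') *\<^sub>R 1))) (at s)"
      by (simp add: of_real_def)
    then show ?thesis
      unfolding has_field_derivative_def
      by (rule has_derivative_eq_rhs)
        (simp add: linear_cmul[OF has_derivative_linear[OF w]] fun_eq_iff del: scaleR_scaleR)
  qed
  have FD: "fderiv F (Complex x y, t) (1, 0) =
      w (Complex (lo + t * (x - lo)) y) + t * ((x - lo) * ?D t)" for t
  proof -
    have "((\<lambda>s. F (Complex s y, t)) has_real_derivative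
        w (Complex (lo + t * (x - lo)) y) + (x - lo) * (t * ?D t)) (at x)"
      unfolding F_def by (auto intro!: derivative_eq_intros wl)
    moreover have "((\<lambda>s. F (Complex s y, t)) has_derivative
        (\<lambda>v. fderiv F (Complex x y, t) (complex_of_real v, 0))) (at x)"
      by (rule has_derivative_compose[where f = "\<lambda>s. (Complex s y, t)" and g = F])
        (use F in \<open>auto intro!: derivative_eq_intros smooth_at_has_derivative simp: smooth_UNIV_iff Complex_eq\<close>)
    ultimately have "(*) (w (Complex (lo + t * (x - lo)) y) + (x - lo) * (t * ?D t)) =
        (\<lambda>v. fderiv F (Complex x y, t) (complex_of_real v, 0))"
      unfolding has_field_derivative_def by (rule has_derivative_unique)
    from fun_cong[OF this, of 1] show ?thesis by (simp add: algebra_simps)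
  qed
  have "((\<lambda>t. t * w (Complex (lo + t * (x - lo)) y)) has_real_derivative
      w (Complex (lo + t * (x - lo)) y) + t * ((x - lo) * ?D t)) (at t)" for t
    by (auto intro!: derivative_eq_intros wl)
  then have "((\<lambda>t. w (Complex (lo + t * (x - lo)) y) + t * ((x - lo) * ?D t)) has_integral
      1 * w (Complex (lo + 1 * (x - lo)) y) - 0 * w (Complex (lo + 0 * (x - lo)) y)) {0..1}"
    by (intro fundamental_theorem_of_calculus)
      (auto simp: has_real_derivative_iff_has_vector_derivative[symmetric] intro: has_field_derivative_at_within)
  then have "integral {0..1} (\<lambda>t. fderiv F (Complex x y, t) (1, 0)) = w (Complex x y)"
    unfolding FD by (simp add: integral_unique)
  then have I: "integral {0..1} (\<lambda>t. fderiv F (Complex x y, t) (complex_of_real 1, 0)) = w (Complex x y)"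
    by simp
  have d: "((\<lambda>s. hprim lo w (Complex s y)) has_derivative
      (\<lambda>v. integral {0..1} (\<lambda>t. fderiv F (Complex x y, t) (complex_of_real v, 0)))) (at x)"
  proof -
    have "((\<lambda>s. Complex s y) has_derivative complex_of_real) (at x)"
      unfolding Complex_eq by (auto intro!: derivative_eq_intros)
    moreover have "hprim lo w = (\<lambda>z. integral {0..1} (\<lambda>t. F (z, t)))"
      by (simp only: F_def hprim_def[abs_def] prod.case)
    ultimately show ?thesis
      using has_derivative_compose[OF _ cont_diff_on_integral(2)[OF F]] by fastforce
  qed
  show ?thesis
    unfolding has_field_derivative_def
    by (rule has_derivative_eq_rhs[OF d])
      (use linear_cmul[OF has_derivative_linear[OF d], of _ 1] I in \<open>auto simp: mult.commute\<close>)
qed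

text \<open>The path of integration joins \<open>lo\<close> and \<open>Re z\<close> in whichever
  order they come, hence the maximum.\<close>

lemma hprim_eq_0:
  assumes "\<And>x. x \<le> max lo (Re z) \<Longrightarrow> w (Complex x (Im z)) = 0"
  shows "hprim lo w z = 0"
proof -
  have 0: "w (Complex (lo + t * (Re z - lo)) (Im z)) = 0" if "t \<in> {0..1}" for t
  proof (rule assms)
    have "t * (Re z - lo) \<le> max 0 (Re z - lo)"
      using that mult_left_le_one_le[of "Re z - lo" t] mult_nonneg_nonpos[of t "Re z - lo"]
      by (cases "Re z \<ge> lo") auto
    then show "lo + t * (Re z - lo) \<le> max lo (Re z)" by linarith
  qed
  have "hprim lo w z = integral {0..1} (\<lambda>t::real. 0)"
    unfolding hprim_def by (rule integral_cong) (simp add: 0)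
  then show ?thesis by simp
qed

text \<open>Beyond the support the primitive has zero derivative; it stays at the total integral
  along the line.\<close>

lemma hprim_eq_right:
  assumes "smooth_on UNIV w" "\<And>x. x > b \<Longrightarrow> w (Complex x y) = 0" "x > b" "x' > b"
  shows "hprim lo w (Complex x y) = hprim lo w (Complex x' y)"
proof -
  have "((\<lambda>s. hprim lo w (Complex s y)) has_real_derivative 0) (at s within {b<..})" if "s \<in> {b<..}" for s
    using hprim_has_derivative[OF assms(1), of lo y s] assms(2)[of s] that
    by (simp add: has_field_derivative_at_within)
  then obtain c where "\<And>s. s \<in> {b<..} \<Longrightarrow> hprim lo w (Complex s y) = c"
    using has_field_derivative_zero_constant[of "{b<..}"] by (metis convex_real_interval(3))
  then show ?thesis using assms by simp
qed

text \<open>A continuous nonnegative integrand with integral zero vanishes identically, so a single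
  positive value on the segment is enough.\<close>

lemma hprim_pos:
  assumes "smooth_on UNIV w" "lo < hi" "\<And>x. w (Complex x y) \<ge> 0"
  shows "hprim lo w (Complex hi y) \<ge> 0"
    and "lo \<le> x \<Longrightarrow> x \<le> hi \<Longrightarrow> w (Complex x y) > 0 \<Longrightarrow> hprim lo w (Complex hi y) > 0"
proof -
  let ?f = "\<lambda>t. (hi - lo) * w (Complex (lo + t * (hi - lo)) y)"
  have eq: "hprim lo w (Complex hi y) = integral {0..1} ?f" by (simp add: hprim_def)
  have nn: "?f t \<ge> 0" for t using assms by simp
  have cont: "continuous_on {0..1} ?f"
    by (intro continuous_intros continuous_on_compose2[OF smooth_on_imp_continuous_on[OF assms(1)]])
      (auto simp: Complex_eq intro!: continuous_intros)
  have int: "?f integrable_on {0..1}"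
    using integrable_continuous_interval[OF cont] .
  show ge: "hprim lo w (Complex hi y) \<ge> 0"
    unfolding eq using nn by (intro integral_nonneg int) auto
  assume x: "lo \<le> x" "x \<le> hi" "w (Complex x y) > 0"
  define t where "t = (x - lo) / (hi - lo)"
  have t: "t \<in> {0..1}" "lo + t * (hi - lo) = x"
    using x assms(2) by (auto simp: t_def)
  then have "?f t \<noteq> 0" using x assms(2) by simp
  then have "integral {0..1} ?f \<noteq> 0"
    using integral_eq_0_iff[OF cont _ nn] t(1) by auto
  then have "hprim lo w (Complex hi y) \<noteq> 0" unfolding eq .
  then show "hprim lo w (Complex hi y) > 0" using ge by linarith
qed

text \<open>Reflection in the diagonal, which exchanges real and imaginary part. It transfers
  everything known about horizontal primitives to vertical ones.\<close>

definition swap_cplx :: "complex \<Rightarrow> complex" where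
  "swap_cplx z = \<i> * cnj z"

lemma swap_cplx_Complex: "swap_cplx (Complex x y) = Complex y x"
  by (simp add: swap_cplx_def complex_eq_iff)

lemma swap_cplx_simps [simp]: "Re (swap_cplx z) = Im z" "Im (swap_cplx z) = Re z" "swap_cplx (swap_cplx z) = z"
  by (simp_all add: swap_cplx_def complex_eq_iff)

lemma bounded_linear_swap_cplx: "bounded_linear swap_cplx"
  unfolding swap_cplx_def[abs_def]
  by (intro bounded_linear_mult_right[THEN bounded_linear_compose] bounded_linear_cnj)

lemma smooth_swap: "smooth_on UNIV w \<Longrightarrow> smooth_on UNIV (\<lambda>z. w (swap_cplx z))"
  unfolding smooth_UNIV_iff
  by (auto intro: smooth_at_compose smooth_at_bounded_linear bounded_linear_swap_cplx)

lemma smooth_slice: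
  assumes "smooth_on UNIV w"
  shows "smooth_on UNIV (\<lambda>z. w (Complex c (Im z)))"
proof -
  have w: "smooth_at w z" for z using assms by (simp add: smooth_UNIV_iff)
  show ?thesis
    unfolding smooth_UNIV_iff
    by (intro allI smooth_at_compose[where g = w and f = "\<lambda>z. Complex c (Im z)", OF _ w]
        smooth_at_Complex smooth_intros)
qed

lemma frechet_1_eqI:
  assumes "smooth_at f z" "((\<lambda>s. f (Complex s (Im z))) has_real_derivative D) (at (Re z))"
  shows "fderiv f z 1 = (D :: real)"
proof -
  have "((\<lambda>s. Complex s (Im z)) has_derivative complex_of_real) (at (Re z))"
    unfolding Complex_eq by (auto intro!: derivative_eq_intros)
  from has_derivative_compose[OF this, of f "fderiv f z"]
  have "((\<lambda>s. f (Complex s (Im z))) has_derivative (\<lambda>v. fderiv f z (complex_of_real v))) (at (Re z))"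
    using smooth_at_has_derivative[OF assms(1)] by simp
  from has_derivative_unique[OF this assms(2)[unfolded has_field_derivative_def]]
  show ?thesis by (metis mult.right_neutral of_real_1)
qed

lemma frechet_ii_eq_swap:
  assumes "smooth_at f (swap_cplx z)"
  shows "fderiv (\<lambda>z. f (swap_cplx z)) z \<i> = fderiv f (swap_cplx z) 1"
proof -
  have "((\<lambda>z. f (swap_cplx z)) has_derivative (\<lambda>v. fderiv f (swap_cplx z) (swap_cplx v))) (at z)"
    by (rule has_derivative_compose[OF bounded_linear_imp_has_derivative[OF bounded_linear_swap_cplx]
        smooth_at_has_derivative[OF assms]])
  from fun_cong[OF frechet_derivative_at[OF this], of \<i>] show ?thesis
    by (simp add: swap_cplx_def)
qed


section \<open>The compactly supported Poincare lemma in a rectangle\<close>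

text \<open>The divergence of a vector field supported in the closed rectangle; in terms of forms, w
  dx \<and> dy = d (A dy - B dx).\<close>

definition box_exact :: "complex \<Rightarrow> complex \<Rightarrow> (complex \<Rightarrow> real) \<Rightarrow> bool" where
  "box_exact a b w \<longleftrightarrow> (\<exists>A B. smooth_on UNIV A \<and> smooth_on UNIV B \<and>
     (\<forall>z. z \<notin> cbox a b \<longrightarrow> A z = 0 \<and> B z = 0) \<and>
     (\<forall>z. w z = fderiv A z 1 + fderiv B z \<i>))"

text \<open>First \<open>u\<close> is moved to the product of its integral along horizontal lines and a fixed function
  of \<open>x\<close>, then the same is done in the vertical direction.\<close>

lemma compact_poincare_product:
  assumes box: "Re a < Re b" "Im a < Im b"
  shows "\<exists>P. \<forall>u. smooth_on UNIV u \<longrightarrow> (\<forall>z. z \<notin> cbox a b \<longrightarrow> u z = 0) \<longrightarrow>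
    (\<exists>\<rho>. box_exact a b (\<lambda>z. u z - \<rho> * P z) \<and> ((\<forall>z. u z \<ge> 0) \<longrightarrow> (\<exists>z. u z > 0) \<longrightarrow> \<rho> > 0))"
proof -
  \<comment> \<open>The margin 1 puts the start of each integration strictly before the rectangle
    and the point where total integrals are read off strictly beyond it.\<close>
  define xl where "xl = Re a - 1"
  define xh where "xh = Re b + 1"
  define yl where "yl = Im a - 1"
  define yh where "yh = Im b + 1"
  define T where "T = (\<lambda>w. hprim xl w)"
  define S where "S = (\<lambda>w z. hprim yl (\<lambda>z. w (swap_cplx z)) (swap_cplx z))"
  have T_smooth: "smooth_on UNIV (T w)" if "smooth_on UNIV w" for w
    unfolding T_def by (rule smooth_hprim[OF that])
  have S_smooth: "smooth_on UNIV (S w)" if "smooth_on UNIV w" for w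
    unfolding S_def by (rule smooth_swap[OF smooth_hprim[OF smooth_swap[OF that]]])
  have sm: "smooth_at w z" if "smooth_on UNIV w" for w :: "complex \<Rightarrow> real" and z
    using that by (simp add: smooth_UNIV_iff)
  have T_deriv: "fderiv (T w) z 1 = w z" if "smooth_on UNIV w" for w z
    unfolding T_def
    by (rule frechet_1_eqI[OF sm[OF smooth_hprim[OF that]]])
      (use hprim_has_derivative[OF that, of xl "Im z" "Re z"] in simp)
  have S_deriv: "fderiv (S w) z \<i> = w z" if "smooth_on UNIV w" for w z
  proof -
    have "fderiv (hprim yl (\<lambda>z. w (swap_cplx z))) (swap_cplx z) 1 = w (swap_cplx (swap_cplx z))"
      by (rule frechet_1_eqI[OF sm[OF smooth_hprim[OF smooth_swap[OF that]]]])
        (use hprim_has_derivative[OF smooth_swap[OF that], of yl "Im (swap_cplx z)" "Re (swap_cplx z)"] in \<open>simp add: swap_cplx_Complex\<close>)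
    then show ?thesis
      unfolding S_def using frechet_ii_eq_swap[OF sm[OF smooth_hprim[OF smooth_swap[OF that]]]] by simp
  qed
  \<comment> \<open>One bump in x only and one in y only; the product of the signed distances to the
    two ends is positive exactly inside the interval.\<close>
  define \<beta>0 where "\<beta>0 = (\<lambda>z. flat_exp 1 0 ((Re z - Re a) * (Re b - Re z)))"
  define \<gamma>0 where "\<gamma>0 = (\<lambda>z. flat_exp 1 0 ((Im z - Im a) * (Im b - Im z)))"
  have \<beta>\<gamma>0: "smooth_on UNIV \<beta>0" "smooth_on UNIV \<gamma>0"
    unfolding smooth_UNIV_iff \<beta>0_def \<gamma>0_def by (intro allI smooth_intros zero_less_one)+
  have nn: "\<beta>0 z \<ge> 0" "\<gamma>0 z \<ge> 0" for z by (auto simp: \<beta>0_def \<gamma>0_def flat_exp_def)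
  define n\<beta> where "n\<beta> = T \<beta>0 (Complex xh 0)"
  define n\<gamma> where "n\<gamma> = S \<gamma>0 (Complex 0 yh)"
  have mid: "((x + y) / 2 - x) * (y - (x + y) / 2) > 0" if "x < y" for x y :: real
    using that by (intro mult_pos_pos) (simp_all add: field_simps)
  have "n\<beta> > 0" unfolding n\<beta>_def T_def
    by (rule hprim_pos(2)[OF \<beta>\<gamma>0(1), where x = "(Re a + Re b) / 2"])
      (use box nn mid[OF box(1)] in \<open>auto simp: xl_def xh_def \<beta>0_def flat_exp_def\<close>)
  have "n\<gamma> > 0" unfolding n\<gamma>_def S_def swap_cplx_Complex
    by (rule hprim_pos(2)[OF smooth_swap[OF \<beta>\<gamma>0(2)], where x = "(Im a + Im b) / 2"])
      (use box nn mid[OF box(2)] in \<open>auto simp: yl_def yh_def \<gamma>0_def flat_exp_def swap_cplx_Complex\<close>)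
  have ycong: "hprim l \<beta>0 z = hprim l \<beta>0 (Complex (Re z) 0)" for l z
    by (simp add: hprim_def \<beta>0_def)
  have xcong: "hprim l (\<lambda>z. \<gamma>0 (swap_cplx z)) z = hprim l (\<lambda>z. \<gamma>0 (swap_cplx z)) (Complex (Re z) 0)" for l z
    by (simp add: hprim_def \<gamma>0_def)
  have \<beta>_out: "\<beta>0 z = 0" if "Re z \<le> Re a \<or> Re b \<le> Re z" for z
    using that box by (auto simp: \<beta>0_def flat_exp_def zero_less_mult_iff)
  have \<gamma>_out: "\<gamma>0 z = 0" if "Im z \<le> Im a \<or> Im b \<le> Im z" for z
    using that box by (auto simp: \<gamma>0_def flat_exp_def zero_less_mult_iff)
  have T_left: "T w z = 0" if "Re z < Re a" "\<And>z. Re z < Re a \<Longrightarrow> w z = 0" for w z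
    unfolding T_def by (rule hprim_eq_0) (use that in \<open>auto simp: xl_def max_def split: if_splits\<close>)
  have S_left: "S w z = 0" if "Im z < Im a" "\<And>z. Im z < Im a \<Longrightarrow> w z = 0" for w z
    unfolding S_def by (rule hprim_eq_0) (use that in \<open>auto simp: swap_cplx_Complex yl_def max_def split: if_splits\<close>)
  have T_right: "T w z = T w (Complex xh (Im z))"
    if "smooth_on UNIV w" "Re z > Re b" "\<And>z. Re z > Re b \<Longrightarrow> w z = 0" for w z
    unfolding T_def using hprim_eq_right[OF that(1), of "Re b" "Im z" "Re z" xh xl] that by (simp add: xh_def)
  have S_right: "S w z = S w (Complex (Re z) yh)"
    if "smooth_on UNIV w" "Im z > Im b" "\<And>z. Im z > Im b \<Longrightarrow> w z = 0" for w z
  proof -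
    have "hprim yl (\<lambda>z. w (swap_cplx z)) (Complex (Im z) (Re z)) = hprim yl (\<lambda>z. w (swap_cplx z)) (Complex yh (Re z))"
      by (rule hprim_eq_right[OF smooth_swap[OF that(1)], of "Im b"]) (use that in \<open>auto simp: yh_def swap_cplx_Complex\<close>)
    then show ?thesis unfolding S_def by (metis complex.exhaust_sel swap_cplx_Complex)
  qed
  have T\<beta>_right: "T \<beta>0 z = n\<beta>" if "Re z > Re b" for z
    using T_right[OF \<beta>\<gamma>0(1) that] \<beta>_out ycong unfolding n\<beta>_def T_def by (metis complex.sel(1) less_imp_le)
  have S\<gamma>_right: "S \<gamma>0 z = n\<gamma>" if "Im z > Im b" for z
    using S_right[OF \<beta>\<gamma>0(2) that] \<gamma>_out xcong[of yl "swap_cplx (Complex (Re z) yh)"]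
    unfolding n\<gamma>_def S_def by (simp add: swap_cplx_Complex less_imp_le)
  show ?thesis
  proof (intro exI[of _ "\<lambda>z. \<beta>0 z * \<gamma>0 z"] allI impI)
    fix u :: "complex \<Rightarrow> real"
    assume u: "smooth_on UNIV u" and "\<forall>z. z \<notin> cbox a b \<longrightarrow> u z = 0"
    then have u0: "\<And>z. z \<notin> cbox a b \<Longrightarrow> u z = 0" by blast
    \<comment> \<open>Normalised by the integral of \<beta>0, so that \<open>u\<close> and
      \<open>U * \<beta>0\<close> have equal integrals along every horizontal line.\<close>
    define U where "U = (\<lambda>z. T u (Complex xh (Im z)) / n\<beta>)"
    have U_smooth: "smooth_on UNIV U"
      using smooth_slice[OF T_smooth[OF u], of xh] \<open>n\<beta> > 0\<close> unfolding U_def smooth_UNIV_iff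
      by (auto intro: smooth_at_divide smooth_at_const)
    have u_out: "u z = 0" if "Re z < Re a \<or> Re b < Re z \<or> Im z < Im a \<or> Im b < Im z" for z
      using u0[of z] that by (auto simp: in_cbox_complex_iff)
    have U_out: "U z = 0" if "Im z < Im a \<or> Im b < Im z" for z
    proof -
      have "hprim xl u (Complex xh (Im z)) = 0"
        by (rule hprim_eq_0) (use that in \<open>auto intro!: u_out\<close>)
      then show ?thesis by (simp add: U_def T_def)
    qed
    \<comment> \<open>Because these integrals agree, the difference of the two primitives returns to
      zero to the right of the rectangle.\<close>
    define A where "A = (\<lambda>z. T u z - U z * T \<beta>0 z)"
    have A_smooth: "smooth_on UNIV A"
      unfolding A_def smooth_UNIV_iff by (intro allI smooth_intros sm T_smooth u U_smooth \<beta>\<gamma>0)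
    have A_out: "A z = 0" if "z \<notin> cbox a b" for z
    proof -
      consider "Re z < Re a" | "Re z > Re b" | "Im z < Im a \<or> Im b < Im z"
        using \<open>z \<notin> cbox a b\<close> by (fastforce simp: in_cbox_complex_iff)
      then show ?thesis
      proof cases
        case 1
        then show ?thesis unfolding A_def using T_left u_out \<beta>_out by simp
      next
        case 2
        then show ?thesis
          using T_right[OF u 2] u_out T\<beta>_right[OF 2] \<open>n\<beta> > 0\<close> by (simp add: A_def U_def)
      next
        case 3
        have "T u z = 0" unfolding T_def
          by (rule hprim_eq_0) (use 3 in \<open>auto intro!: u_out\<close>)
        then show ?thesis using U_out[OF 3] by (simp add: A_def)
      qed
    qed
    have A_deriv: "fderiv A z 1 = u z - U z * \<beta>0 z" for z
    proof (rule frechet_1_eqI[OF sm[OF A_smooth]])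
      have "U (Complex s (Im z)) = U z" for s by (simp add: U_def)
      then show "((\<lambda>s. A (Complex s (Im z))) has_real_derivative u z - U z * \<beta>0 z) (at (Re z))"
        unfolding A_def T_def
        using hprim_has_derivative[OF u, of xl "Im z" "Re z"] hprim_has_derivative[OF \<beta>\<gamma>0(1), of xl "Im z" "Re z"]
        by (auto intro!: derivative_eq_intros)
    qed
    \<comment> \<open>The double integral of \<open>u\<close> over that of
      \<open>\<beta>0 * \<gamma>0\<close>. It is the only constant for which the vertical primitive
      of \<open>U - \<rho> * \<gamma>0\<close> also returns to zero above the rectangle.\<close>
    define \<rho> where "\<rho> = S U (Complex 0 yh) / n\<gamma>"
    have SU: "S U z = S U (Complex x (Im z))" for z x
      by (simp add: S_def hprim_def U_def)
    \<comment> \<open>\<beta>0 is constant in the vertical direction, so it passes through the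
      vertical derivative, and it provides the cut-off in the horizontal direction.\<close>
    define B where "B = (\<lambda>z. \<beta>0 z * (S U z - \<rho> * S \<gamma>0 z))"
    have B_smooth: "smooth_on UNIV B"
      unfolding B_def smooth_UNIV_iff by (intro allI smooth_intros sm S_smooth U_smooth \<beta>\<gamma>0)
    have B_out: "B z = 0" if "z \<notin> cbox a b" for z
    proof -
      consider "Re z < Re a \<or> Re b < Re z" | "Im z < Im a" | "Im b < Im z"
        using \<open>z \<notin> cbox a b\<close> by (fastforce simp: in_cbox_complex_iff)
      then show ?thesis
      proof cases
        case 1
        then show ?thesis unfolding B_def using \<beta>_out by auto
      next
        case 2
        then show ?thesis unfolding B_def using S_left U_out \<gamma>_out by simp
      next
        case 3
        have "S U z = S U (Complex 0 yh)"
          using S_right[OF U_smooth 3] U_out SU[of "Complex (Re z) yh" 0] by simp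
        then show ?thesis using S\<gamma>_right[OF 3] \<open>n\<gamma> > 0\<close> by (simp add: B_def \<rho>_def)
      qed
    qed
    have B_deriv: "fderiv B z \<i> = \<beta>0 z * (U z - \<rho> * \<gamma>0 z)" for z
    proof -
      let ?C = "\<lambda>z. S U z - \<rho> * S \<gamma>0 z"
      have d: "(f has_derivative fderiv f z) (at z)" if "smooth_on UNIV f" for f :: "complex \<Rightarrow> real"
        by (rule smooth_at_has_derivative[OF sm[OF that]])
      have B_has: "(B has_derivative (\<lambda>v. \<beta>0 z * (fderiv (S U) z v - \<rho> * fderiv (S \<gamma>0) z v)
          + fderiv \<beta>0 z v * ?C z)) (at z)"
        unfolding B_def using d[OF \<beta>\<gamma>0(1)] d[OF S_smooth[OF U_smooth]] d[OF S_smooth[OF \<beta>\<gamma>0(2)]]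
        by (intro has_derivative_mult has_derivative_diff has_derivative_mult_right)
      \<comment> \<open>The reflection turns this into a derivative in direction 1, where
        \<open>frechet_1_eqI\<close> applies.\<close>
      have "fderiv \<beta>0 z \<i> = 0"
      proof -
        have "fderiv (\<lambda>z. \<beta>0 (swap_cplx z)) (swap_cplx z) 1 = 0"
          by (rule frechet_1_eqI[OF sm[OF smooth_swap[OF \<beta>\<gamma>0(1)]]]) (simp add: \<beta>0_def swap_cplx_Complex)
        moreover have "fderiv (\<lambda>z. (\<lambda>z. \<beta>0 (swap_cplx z)) (swap_cplx z)) z \<i> =
            fderiv (\<lambda>z. \<beta>0 (swap_cplx z)) (swap_cplx z) 1"
          by (rule frechet_ii_eq_swap[OF sm[OF smooth_swap[OF \<beta>\<gamma>0(1)]]])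
        ultimately show ?thesis by simp
      qed
      then show ?thesis
        by (simp add: fun_cong[OF frechet_derivative_at[OF B_has], symmetric] S_deriv[OF U_smooth] S_deriv[OF \<beta>\<gamma>0(2)])
    qed
    \<comment> \<open>A positive value of \<open>u\<close> makes the integral along its horizontal
      line positive; this is a positive value of \<open>U\<close>, and the same argument applies
      vertically.\<close>
    have "\<rho> > 0" if nonneg: "\<forall>z. u z \<ge> 0" and pos: "u z1 > 0" for z1
    proof -
      have z1: "z1 \<in> cbox a b" using u0[of z1] pos by force
      have "T u (Complex xh y) \<ge> 0" for y
        unfolding T_def by (rule hprim_pos(1)[OF u]) (use nonneg box in \<open>auto simp: xl_def xh_def\<close>)
      then have Unn: "U z \<ge> 0" for z using \<open>n\<beta> > 0\<close> by (simp add: U_def)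
      have "T u (Complex xh (Im z1)) > 0"
        unfolding T_def by (rule hprim_pos(2)[OF u, where x = "Re z1"])
          (use nonneg pos z1 box in \<open>auto simp: xl_def xh_def in_cbox_complex_iff\<close>)
      then have "U (Complex 0 (Im z1)) > 0" using \<open>n\<beta> > 0\<close> by (simp add: U_def)
      then have "S U (Complex 0 yh) > 0"
        unfolding S_def swap_cplx_Complex
        by (intro hprim_pos(2)[OF smooth_swap[OF U_smooth], where x = "Im z1"])
          (use Unn z1 box in \<open>auto simp: yl_def yh_def in_cbox_complex_iff swap_cplx_Complex\<close>)
      then show ?thesis using \<open>n\<gamma> > 0\<close> by (simp add: \<rho>_def)
    qed
    moreover have "box_exact a b (\<lambda>z. u z - \<rho> * (\<beta>0 z * \<gamma>0 z))"
      unfolding box_exact_def using A_smooth B_smooth A_out B_out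
      by (intro exI[of _ A] exI[of _ B]) (auto simp: A_deriv B_deriv algebra_simps)
    ultimately show "\<exists>\<rho>. box_exact a b (\<lambda>z. u z - \<rho> * (\<beta>0 z * \<gamma>0 z)) \<and>
        ((\<forall>z. u z \<ge> 0) \<longrightarrow> (\<exists>z. u z > 0) \<longrightarrow> \<rho> > 0)"
      by blast
  qed
qed

lemma box_exact_diff_scale:
  assumes "box_exact a b f" "box_exact a b g"
  shows "box_exact a b (\<lambda>z. f z - c * g z)"
proof -
  obtain A B where 1: "smooth_on UNIV A" "smooth_on UNIV B" "\<And>z. z \<notin> cbox a b \<Longrightarrow> A z = 0 \<and> B z = 0"
    "\<And>z. f z = fderiv A z 1 + fderiv B z \<i>"
    using assms(1) unfolding box_exact_def by blast
  obtain A' B' where 2: "smooth_on UNIV A'" "smooth_on UNIV B'" "\<And>z. z \<notin> cbox a b \<Longrightarrow> A' z = 0 \<and> B' z = 0"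
    "\<And>z. g z = fderiv A' z 1 + fderiv B' z \<i>"
    using assms(2) unfolding box_exact_def by blast
  have lin: "smooth_on UNIV (\<lambda>z. f z - c * g z)"
    "fderiv (\<lambda>z. f z - c * g z) z w = fderiv f z w - c * fderiv g z w"
    if "smooth_on UNIV f" "smooth_on UNIV g" for f g :: "complex \<Rightarrow> real" and z w
  proof -
    have fg: "smooth_at f z" "smooth_at g z" for z using that by (simp_all add: smooth_UNIV_iff)
    show "smooth_on UNIV (\<lambda>z. f z - c * g z)"
      unfolding smooth_UNIV_iff by (intro allI smooth_intros fg)
    have "((\<lambda>z. f z - c * g z) has_derivative (\<lambda>w. fderiv f z w - c * fderiv g z w)) (at z)"
      by (intro has_derivative_diff has_derivative_mult_right smooth_at_has_derivative fg)
    from fun_cong[OF frechet_derivative_at[OF this], of w]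
    show "fderiv (\<lambda>z. f z - c * g z) z w = fderiv f z w - c * fderiv g z w"
      by (rule sym)
  qed
  show ?thesis
    unfolding box_exact_def
    using lin(1)[OF 1(1) 2(1)] lin(1)[OF 1(2) 2(2)] 1(3) 2(3)
    by (intro exI[of _ "\<lambda>z. A z - c * A' z"] exI[of _ "\<lambda>z. B z - c * B' z"])
      (auto simp: lin(2)[OF 1(1) 2(1)] lin(2)[OF 1(2) 2(2)] 1(4) 2(4) algebra_simps)
qed

text \<open>The auxiliary product is eliminated between \<open>u\<close> and \<open>v\<close>: both
  are multiples of it up to divergences. The sign condition on \<open>v\<close> ensures that its
  multiple can be divided by.\<close>

lemma compact_poincare:
  assumes box: "Re a < Re b" "Im a < Im b"
    and u: "smooth_on UNIV u" "\<And>z. z \<notin> cbox a b \<Longrightarrow> u z = 0"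
    and v: "smooth_on UNIV v" "\<And>z. z \<notin> cbox a b \<Longrightarrow> v z = 0" "\<And>z. v z \<ge> 0" "v z1 > 0"
  shows "\<exists>\<rho>. box_exact a b (\<lambda>z. u z - \<rho> * v z)"
proof -
  obtain P where P: "\<And>u. smooth_on UNIV u \<Longrightarrow> (\<And>z. z \<notin> cbox a b \<Longrightarrow> u z = 0) \<Longrightarrow>
    \<exists>\<rho>. box_exact a b (\<lambda>z. u z - \<rho> * P z) \<and> ((\<forall>z. u z \<ge> 0) \<longrightarrow> (\<exists>z. u z > 0) \<longrightarrow> \<rho> > 0)"
    using compact_poincare_product[OF box] by metis
  obtain \<rho> where 1: "box_exact a b (\<lambda>z. u z - \<rho> * P z)" using P[OF u] by blast
  obtain \<sigma> where 2: "box_exact a b (\<lambda>z. v z - \<sigma> * P z)" "\<sigma> > 0" using P[OF v(1,2)] v(3,4) by blast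
  have "(\<lambda>z. u z - \<rho> * P z - \<rho> / \<sigma> * (v z - \<sigma> * P z)) = (\<lambda>z. u z - \<rho> / \<sigma> * v z)"
    using 2(2) by (auto simp: fun_eq_iff algebra_simps)
  then show ?thesis using box_exact_diff_scale[OF 1 2(1), of "\<rho> / \<sigma>"] by (intro exI[of _ "\<rho> / \<sigma>"]) simp
qed

section \<open>Analysis on a Riemann surface\<close>

locale riemann =
  fixes M :: "'a surface"
  assumes riemann_surface: "riemann_surface M"
begin

abbreviation "X \<equiv> topol M"

section \<open>Charts and their inverses\<close>

lemma chart: "c \<in> atlas M \<Longrightarrow> is_chart X c"
  and atlas_cover: "(\<Union>c\<in>atlas M. fst c) = points M"
  and hausdorff: "Hausdorff_space X"
  using riemann_surface by (auto simp: riemann_surface_def)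

lemma openin_chart: "c \<in> atlas M \<Longrightarrow> openin X (fst c)"
  and open_chart: "c \<in> atlas M \<Longrightarrow> open (snd c ` fst c)"
  and homeo_chart: "c \<in> atlas M \<Longrightarrow>
    homeomorphic_map (subtopology X (fst c)) (top_of_set (snd c ` fst c)) (snd c)"
  using chart by (auto simp: is_chart_def)

lemma chart_subset: "c \<in> atlas M \<Longrightarrow> fst c \<subseteq> points M"
  using openin_chart openin_subset by blast

lemma chart_exists: "p \<in> points M \<Longrightarrow> \<exists>c\<in>atlas M. p \<in> fst c"
  using atlas_cover by blast

lemma inj_chart: "c \<in> atlas M \<Longrightarrow> inj_on (snd c) (fst c)"
  using homeomorphic_imp_injective_map[OF homeo_chart] chart_subset
  by (metis inf.absorb_iff2 topspace_subtopology)

lemma chart_inv_chart: "c \<in> atlas M \<Longrightarrow> p \<in> fst c \<Longrightarrow> chart_inv c (snd c p) = p"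
  unfolding chart_inv_def by (rule inv_into_f_f[OF inj_chart])

lemma chart_chart_inv: "z \<in> snd c ` fst c \<Longrightarrow> snd c (chart_inv c z) = z"
  and chart_inv_in: "z \<in> snd c ` fst c \<Longrightarrow> chart_inv c z \<in> fst c"
  unfolding chart_inv_def by (auto intro: f_inv_into_f inv_into_into)

lemma chart_inv_image: "K \<subseteq> snd c ` fst c \<Longrightarrow> chart_inv c ` K \<subseteq> fst c"
  by (auto intro!: chart_inv_in)

lemma open_chart_image:
  assumes "c \<in> atlas M" "openin X U"
  shows "open (snd c ` (fst c \<inter> U))"
proof -
  have "openin (subtopology X (fst c)) (fst c \<inter> U)"
    using assms(2) by (auto simp: openin_subtopology)
  then have "openin (top_of_set (snd c ` fst c)) (snd c ` (fst c \<inter> U))"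
    using homeomorphic_imp_open_map[OF homeo_chart[OF assms(1)]] by (auto simp: open_map_def)
  then show ?thesis
    using open_chart[OF assms(1)] openin_open_trans by blast
qed

lemma openin_chart_preimage:
  assumes "c \<in> atlas M" "open T"
  shows "openin X {p \<in> fst c. snd c p \<in> T}"
proof -
  have cont: "continuous_map (subtopology X (fst c)) (top_of_set (snd c ` fst c)) (snd c)"
    using homeomorphic_imp_continuous_map[OF homeo_chart[OF assms(1)]] .
  have "openin (top_of_set (snd c ` fst c)) (snd c ` fst c \<inter> T)"
    using assms(2) by (auto simp: openin_open)
  from openin_continuous_map_preimage[OF cont this]
  have "openin (subtopology X (fst c))
      {p \<in> topspace (subtopology X (fst c)). snd c p \<in> snd c ` fst c \<inter> T}" .
  moreover have "{p \<in> topspace (subtopology X (fst c)). snd c p \<in> snd c ` fst c \<inter> T} =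
      {p \<in> fst c. snd c p \<in> T}"
    using chart_subset[OF assms(1)] by auto
  ultimately have "openin (subtopology X (fst c)) {p \<in> fst c. snd c p \<in> T}" by simp
  then show ?thesis by (rule openin_trans_full[OF _ openin_chart[OF assms(1)]])
qed

text \<open>A compact set of coordinates is compact on the surface, and there the Hausdorff property
  makes it closed. The open complement is what later permits extension by zero from a chart.\<close>

lemma closedin_chart_inv_image:
  assumes "c \<in> atlas M" "compact K" "K \<subseteq> snd c ` fst c"
  shows "closedin X (chart_inv c ` K)"
proof -
  obtain g where g: "homeomorphic_maps (subtopology X (fst c)) (top_of_set (snd c ` fst c)) (snd c) g"
    using homeo_chart[OF assms(1)] homeomorphic_map_maps by blast
  then have cont: "continuous_map (top_of_set (snd c ` fst c)) (subtopology X (fst c)) g"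
    by (simp add: homeomorphic_maps_def)
  \<comment> \<open>The continuous inverse supplied by the homeomorphism and the chosen inverse of
    the chart agree on the image of the chart.\<close>
  have "g z = chart_inv c z" if z: "z \<in> snd c ` fst c" for z
  proof -
    obtain p where p: "p \<in> fst c" "z = snd c p" using z by blast
    then have "g (snd c p) = p"
      using g chart_subset[OF assms(1)] by (auto simp: homeomorphic_maps_def)
    then show ?thesis using p chart_inv_chart[OF assms(1)] by simp
  qed
  then have eq: "g ` K = chart_inv c ` K" using assms(3) by (auto simp: image_iff subset_iff)
  have "compactin (top_of_set (snd c ` fst c)) K"
    using assms by (simp add: compactin_subtopology)
  then have "compactin (subtopology X (fst c)) (g ` K)"
    using image_compactin cont by blast
  then have "compactin X (chart_inv c ` K)"
    unfolding eq compactin_subtopology by blast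
  then show ?thesis using compactin_imp_closedin[OF hausdorff] by blast
qed

lemma eventually_chart:
  assumes "c \<in> atlas M" "openin X U" "p \<in> fst c" "p \<in> U"
  shows "eventually (\<lambda>z. z \<in> snd c ` fst c \<and> chart_inv c z \<in> fst c \<inter> U) (nhds (snd c p))"
  using eventually_nhds_in_open[OF open_chart_image[OF assms(1,2)], of "snd c p"] assms(3,4)
  by (auto elim!: eventually_mono simp: chart_inv_chart[OF assms(1)])

section \<open>Smooth functions on the surface and changes of coordinates\<close>

definition msmooth :: "('a \<Rightarrow> 'b::real_normed_vector) \<Rightarrow> 'a \<Rightarrow> bool" where
  "msmooth f p \<longleftrightarrow> (\<forall>c\<in>atlas M. p \<in> fst c \<longrightarrow> smooth_at (f \<circ> chart_inv c) (snd c p))"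

lemma msmoothD: "msmooth f p \<Longrightarrow> c \<in> atlas M \<Longrightarrow> p \<in> fst c \<Longrightarrow> smooth_at (f \<circ> chart_inv c) (snd c p)"
  by (simp add: msmooth_def)

lemma smooth_fun_iff:
  assumes "openin X U"
  shows "smooth_fun M U f \<longleftrightarrow> (\<forall>p\<in>U. msmooth f p)"
  using openin_subset[OF assms]
  by (auto simp: smooth_fun_def msmooth_def smooth_on_iff_smooth_at open_chart_image[OF _ assms])

lemma transition_holomorphic:
  assumes "c \<in> atlas M" "d \<in> atlas M"
  shows "open (snd c ` (fst c \<inter> fst d))" "(snd d \<circ> chart_inv c) holomorphic_on (snd c ` (fst c \<inter> fst d))"
  using riemann_surface open_chart_image[OF assms(1) openin_chart[OF assms(2)]] assms
  by (auto simp: riemann_surface_def)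

lemma transition_deriv:
  assumes "c \<in> atlas M" "d \<in> atlas M" "p \<in> fst c \<inter> fst d"
  shows "(snd d \<circ> chart_inv c has_field_derivative dz_ratio c d p) (at (snd c p))"
  unfolding dz_ratio_def using assms(3)
  by (intro holomorphic_derivI[OF transition_holomorphic(2,1)[OF assms(1,2)]]) blast

lemma dz_ratio_eventually:
  assumes "c \<in> atlas M" "p \<in> fst c"
  shows "\<forall>\<^sub>F z in nhds (snd c p). deriv (snd d \<circ> chart_inv c) z = (dz_ratio c d \<circ> chart_inv c) z"
  using eventually_nhds_in_open[OF open_chart[OF assms(1)], of "snd c p"] assms(2)
  by (auto elim!: eventually_mono simp: dz_ratio_def chart_inv_chart[OF assms(1)])

lemma transition_smooth:
  assumes "c \<in> atlas M" "d \<in> atlas M" "p \<in> fst c \<inter> fst d"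
  shows "smooth_at (snd d \<circ> chart_inv c) (snd c p)" "smooth_at (dz_ratio c d \<circ> chart_inv c) (snd c p)"
proof -
  note hol = transition_holomorphic[OF assms(1,2)]
  have p: "snd c p \<in> snd c ` (fst c \<inter> fst d)" "p \<in> fst c" using assms(3) by blast+
  show "smooth_at (snd d \<circ> chart_inv c) (snd c p)"
    by (rule smooth_at_holomorphic[OF hol p(1)])
  show "smooth_at (dz_ratio c d \<circ> chart_inv c) (snd c p)"
    by (rule smooth_at_cong[OF dz_ratio_eventually[OF assms(1) p(2)]
          smooth_at_holomorphic[OF hol(1) holomorphic_deriv[OF hol(2,1)] p(1)]])
qed

text \<open>The derivative of a holomorphic transition is holomorphic. Hence transformation factors
  of (1,0)-forms behave as constants under the dbar operator.\<close>

lemma dz_ratio_wirt: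
  assumes "c \<in> atlas M" "d \<in> atlas M" "p \<in> fst c \<inter> fst d"
  shows "wirt_zbar (dz_ratio c d \<circ> chart_inv c) (snd c p) = 0"
proof -
  note hol = transition_holomorphic[OF assms(1,2)]
  have p: "snd c p \<in> snd c ` (fst c \<inter> fst d)" "p \<in> fst c" using assms(3) by blast+
  show ?thesis
    unfolding wirt_cong(2)[OF dz_ratio_eventually[OF assms(1) p(2)], symmetric]
    by (rule wirt_holomorphic[OF holomorphic_derivI[OF holomorphic_deriv[OF hol(2,1)] hol(1) p(1)]])
qed

lemma eventually_transition:
  assumes "c \<in> atlas M" "d \<in> atlas M" "p \<in> fst c \<inter> fst d"
  shows "eventually (\<lambda>z. (f \<circ> chart_inv d) ((snd d \<circ> chart_inv c) z) = (f \<circ> chart_inv c) z) (nhds (snd c p))"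
  using eventually_chart[OF assms(1) openin_chart[OF assms(2)], of p] assms(3)
  by (auto elim!: eventually_mono simp: chart_inv_chart[OF assms(2)])

text \<open>Transitions are holomorphic, hence smooth, so one chart decides for all.\<close>

lemma msmooth_chart_iff:
  assumes "c \<in> atlas M" "p \<in> fst c"
  shows "msmooth f p \<longleftrightarrow> smooth_at (f \<circ> chart_inv c) (snd c p)"
proof
  assume s: "smooth_at (f \<circ> chart_inv c) (snd c p)"
  have "smooth_at (f \<circ> chart_inv d) (snd d p)" if d: "d \<in> atlas M" "p \<in> fst d" for d
  proof (rule smooth_at_cong[OF eventually_transition[OF d(1) assms(1)]])
    show "p \<in> fst d \<inter> fst c" using assms d by blast
    have "(snd c \<circ> chart_inv d) (snd d p) = snd c p" using d by (simp add: chart_inv_chart)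
    then show "smooth_at (\<lambda>z. (f \<circ> chart_inv c) ((snd c \<circ> chart_inv d) z)) (snd d p)"
      using s assms d
      by (intro smooth_at_compose[where f = "snd c \<circ> chart_inv d" and g = "f \<circ> chart_inv c"] transition_smooth(1)) auto
  qed
  then show "msmooth f p" by (simp add: msmooth_def)
qed (use assms msmooth_def in blast)

lemma msmooth_cong:
  assumes "openin X U" "p \<in> U" "\<And>q. q \<in> U \<Longrightarrow> f q = g q" "msmooth f p"
  shows "msmooth g p"
  unfolding msmooth_def
proof (intro ballI impI)
  fix c assume c: "c \<in> atlas M" "p \<in> fst c"
  show "smooth_at (g \<circ> chart_inv c) (snd c p)"
    by (rule smooth_at_cong[OF _ msmoothD[OF assms(4) c]])
      (use eventually_chart[OF c(1) assms(1) c(2) assms(2)] assms(3) in \<open>auto elim!: eventually_mono\<close>)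
qed

lemma msmooth_const: "msmooth (\<lambda>q. k) p"
  and msmooth_linear: "bounded_linear l \<Longrightarrow> msmooth f p \<Longrightarrow> msmooth (\<lambda>q. l (f q)) p"
  by (auto simp: msmooth_def o_def intro: smooth_intros smooth_at_linear)

lemma msmooth_mult: "msmooth f p \<Longrightarrow> msmooth g p \<Longrightarrow> msmooth (\<lambda>q. f q * g q) p"
  for f g :: "'a \<Rightarrow> 'b::real_normed_algebra"
  by (auto simp: msmooth_def o_def intro: smooth_intros)

lemma msmooth_power: "msmooth f p \<Longrightarrow> msmooth (\<lambda>q. f q ^ n) p"
  for f g :: "'a \<Rightarrow> 'b::real_normed_algebra_1"
  by (auto simp: msmooth_def o_def intro: smooth_intros)

lemma msmooth_divide:
  fixes f g :: "'a \<Rightarrow> 'b::real_normed_field"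
  assumes "msmooth f p" "msmooth g p" "g p \<noteq> 0"
  shows "msmooth (\<lambda>q. f q / g q) p"
  unfolding msmooth_def o_def
proof (intro ballI impI smooth_at_divide)
  fix c assume c: "c \<in> atlas M" "p \<in> fst c"
  show "smooth_at (\<lambda>z. f (chart_inv c z)) (snd c p)" "smooth_at (\<lambda>z. g (chart_inv c z)) (snd c p)"
    using msmoothD[OF assms(1) c] msmoothD[OF assms(2) c] by (simp_all add: o_def)
  show "g (chart_inv c (snd c p)) \<noteq> 0" using c assms(3) by (simp add: chart_inv_chart)
qed

lemma msmooth_sqrt: "msmooth f p \<Longrightarrow> f p > 0 \<Longrightarrow> msmooth (\<lambda>q. sqrt (f q)) p"
  using msmoothD[of f p]
  by (simp add: msmooth_def o_def chart_inv_chart smooth_at_sqrt)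

lemma msmooth_sum: "(\<And>i. i \<in> I \<Longrightarrow> msmooth (f i) p) \<Longrightarrow> msmooth (\<lambda>q. \<Sum>i\<in>I. f i q) p"
  by (auto simp: msmooth_def o_def intro!: smooth_intros)

lemmas msmooth_of_real = msmooth_linear[OF bounded_linear_of_real]
  and msmooth_cnj = msmooth_linear[OF bounded_linear_cnj]

lemma wirt_chart_change:
  assumes "c \<in> atlas M" "d \<in> atlas M" "p \<in> fst c \<inter> fst d" "smooth_at (f \<circ> chart_inv d) (snd d p)"
  shows "wirt_z (f \<circ> chart_inv c) (snd c p) = wirt_z (f \<circ> chart_inv d) (snd d p) * dz_ratio c d p"
    "wirt_zbar (f \<circ> chart_inv c) (snd c p) = wirt_zbar (f \<circ> chart_inv d) (snd d p) * cnj (dz_ratio c d p)"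
proof -
  have T: "(snd d \<circ> chart_inv c) (snd c p) = snd d p" using assms by (simp add: chart_inv_chart)
  note ev = eventually_transition[OF assms(1,2,3), of f]
  note ch = wirt_compose_holomorphic[OF transition_deriv[OF assms(1,2,3)], of "f \<circ> chart_inv d",
      unfolded T, OF smooth_at_differentiable[OF assms(4)]]
  show "wirt_z (f \<circ> chart_inv c) (snd c p) = wirt_z (f \<circ> chart_inv d) (snd d p) * dz_ratio c d p"
    "wirt_zbar (f \<circ> chart_inv c) (snd c p) = wirt_zbar (f \<circ> chart_inv d) (snd d p) * cnj (dz_ratio c d p)"
    using wirt_cong[OF ev] ch by metis+
qed

text \<open>The chain rule, read as the change of charts for the function \<open>snd e\<close>, the
  coordinate of the third chart.\<close>

lemma dz_ratio_cocycle:
  assumes "c \<in> atlas M" "d \<in> atlas M" "e \<in> atlas M" "p \<in> fst c \<inter> fst d \<inter> fst e"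
  shows "dz_ratio c e p = dz_ratio d e p * dz_ratio c d p"
proof -
  have cd: "p \<in> fst c \<inter> fst d" and de: "p \<in> fst d \<inter> fst e" and ce: "p \<in> fst c \<inter> fst e"
    using assms(4) by auto
  have "wirt_z (snd e \<circ> chart_inv d) (snd d p) = dz_ratio d e p"
    "wirt_z (snd e \<circ> chart_inv c) (snd c p) = dz_ratio c e p"
    by (rule wirt_holomorphic transition_deriv assms de ce)+
  then show ?thesis
    using wirt_chart_change(1)[OF assms(1,2) cd transition_smooth(1)[OF assms(2,3) de]] by simp
qed

lemma dz_ratio_self:
  assumes "c \<in> atlas M" "p \<in> fst c"
  shows "dz_ratio c c p = 1"
proof -
  have "((\<lambda>z. z) has_field_derivative 1) (at (snd c p))" by (rule DERIV_ident)
  moreover have "eventually (\<lambda>z. z = (snd c \<circ> chart_inv c) z) (nhds (snd c p))"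
    using eventually_nhds_in_open[OF open_chart[OF assms(1)], of "snd c p"] assms
    by (auto elim!: eventually_mono simp: chart_chart_inv)
  ultimately have "(snd c \<circ> chart_inv c has_field_derivative 1) (at (snd c p))"
    by (rule DERIV_cong_ev[OF refl _ refl, THEN iffD1, rotated])
  then show ?thesis unfolding dz_ratio_def by (rule DERIV_imp_deriv)
qed

subsection \<open>Bump functions\<close>

definition chart_ext :: "'a chart \<Rightarrow> (complex \<Rightarrow> 'b::real_normed_vector) \<Rightarrow> 'a \<Rightarrow> 'b" where
  "chart_ext c f q = (if q \<in> fst c then f (snd c q) else 0)"

lemma chart_ext_outside:
  assumes "c \<in> atlas M" "\<And>z. z \<in> snd c ` fst c \<Longrightarrow> z \<notin> K \<Longrightarrow> f z = 0" "q \<notin> chart_inv c ` K"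
  shows "chart_ext c f q = 0"
  using assms chart_inv_chart[OF assms(1), of q] by (force simp: chart_ext_def)

lemma chart_ext_cong_nhds:
  assumes "c \<in> atlas M" "q \<in> fst c"
  shows "eventually (\<lambda>z. f z = (chart_ext c f \<circ> chart_inv c) z) (nhds (snd c q))"
  using eventually_nhds_in_open[OF open_chart[OF assms(1)], of "snd c q"] assms
  by (auto elim!: eventually_mono simp: chart_ext_def chart_inv_chart)

text \<open>Two open sets cover the surface: the chart domain, where the function is
  \<open>f\<close> in coordinates, and the complement of the closed image of \<open>K\<close>, where
  it is zero.\<close>

lemma msmooth_chart_ext:
  assumes c: "c \<in> atlas M" and K: "compact K" "K \<subseteq> snd c ` fst c"
    and f: "\<And>z. z \<in> snd c ` fst c \<Longrightarrow> z \<notin> K \<Longrightarrow> f z = 0" "\<And>z. z \<in> snd c ` fst c \<Longrightarrow> smooth_at f z"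
    and q: "q \<in> points M"
  shows "msmooth (chart_ext c f) q"
proof (cases "q \<in> fst c")
  case True
  have "smooth_at (chart_ext c f \<circ> chart_inv c) (snd c q)"
    by (rule smooth_at_cong[OF chart_ext_cong_nhds[OF c True]]) (use f True in blast)
  then show ?thesis using msmooth_chart_iff[OF c True] by blast
next
  case False
  show ?thesis
  proof (rule msmooth_cong[where f = "\<lambda>q. 0" and U = "points M - chart_inv c ` K"])
    show "openin X (points M - chart_inv c ` K)"
      using closedin_chart_inv_image[OF c K] by (simp add: openin_diff)
    show "q \<in> points M - chart_inv c ` K"
      using q False chart_inv_image[OF K(2)] by blast
    show "0 = chart_ext c f r" if "r \<in> points M - chart_inv c ` K" for r
      using chart_ext_outside[OF c, of K f r] f(1) that by simp
  qed (rule msmooth_const)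
qed

lemma smooth_at_norm_sq: "smooth_at (\<lambda>z. (cmod (z - z0))\<^sup>2) w"
  unfolding cmod_power2 by (intro smooth_intros)

lemma cball_in_chart:
  assumes "c \<in> atlas M" "openin X U" "p \<in> fst c" "p \<in> U"
  obtains r where "r > 0" "cball (snd c p) r \<subseteq> snd c ` (fst c \<inter> U)"
  using open_chart_image[OF assms(1,2)] assms(3,4) open_contains_cball by blast

lemma outside_cball: "r > 0 \<Longrightarrow> z \<notin> cball w r \<Longrightarrow> r\<^sup>2 - (cmod (z - w))\<^sup>2 \<le> 0"
  using power_mono[of r "cmod (z - w)" 2] by (auto simp: dist_norm norm_minus_commute)

lemma bump_exists:
  assumes "openin X U" "p \<in> U"
  shows "\<exists>b K N. closedin X K \<and> K \<subseteq> U \<and> openin X N \<and> p \<in> N \<and>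
    (\<forall>q\<in>points M. msmooth b q \<and> b q \<ge> 0) \<and> (\<forall>q\<in>N. b q > (0::real)) \<and> (\<forall>q\<in>points M - K. b q = 0)"
proof -
  obtain c where c: "c \<in> atlas M" "p \<in> fst c"
    using assms chart_exists openin_subset by blast
  obtain r where r: "r > 0" "cball (snd c p) r \<subseteq> snd c ` (fst c \<inter> U)"
    using cball_in_chart[OF c(1) assms(1) c(2) assms(2)] .
  \<comment> \<open>The squared distance is smooth at the centre as well, and
    \<open>flat_exp\<close> vanishes to infinite order at the rim of the disc.\<close>
  define f where "f = (\<lambda>z. flat_exp 1 0 (r\<^sup>2 - (cmod (z - snd c p))\<^sup>2))"
  have f0: "f z = 0" if "z \<notin> cball (snd c p) r" for z
    using outside_cball[OF r(1) that] by (simp add: f_def flat_exp_def)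
  have sub: "cball (snd c p) r \<subseteq> snd c ` fst c" using r(2) by blast
  have sm: "smooth_at f z" for z
    unfolding f_def by (intro smooth_intros smooth_at_norm_sq) simp
  have N: "openin X {q \<in> fst c. snd c q \<in> ball (snd c p) r}"
    by (rule openin_chart_preimage[OF c(1)]) simp
  have pos: "f z > 0" if "z \<in> ball (snd c p) r" for z
    using that power_strict_mono[of "cmod (z - snd c p)" r 2]
    by (auto simp: f_def flat_exp_def dist_norm norm_minus_commute)
  show ?thesis
  proof (intro exI conjI ballI)
    show "closedin X (chart_inv c ` cball (snd c p) r)"
      by (rule closedin_chart_inv_image[OF c(1) _ sub]) simp
    show "chart_inv c ` cball (snd c p) r \<subseteq> U"
      using r(2) chart_inv_chart[OF c(1)] by (auto 0 3 simp: subset_iff image_iff)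
    show "p \<in> {q \<in> fst c. snd c q \<in> ball (snd c p) r}" using c r by simp
    show "msmooth (chart_ext c f) q" if "q \<in> points M" for q
      by (rule msmooth_chart_ext[OF c(1) compact_cball sub f0 sm that])
    show "chart_ext c f q \<ge> 0" for q by (simp add: chart_ext_def f_def flat_exp_def)
    show "chart_ext c f q > 0" if "q \<in> {q \<in> fst c. snd c q \<in> ball (snd c p) r}" for q
      using that pos by (simp add: chart_ext_def)
    show "chart_ext c f q = 0" if "q \<in> points M - chart_inv c ` cball (snd c p) r" for q
      using chart_ext_outside[OF c(1), of "cball (snd c p) r" f q] f0 that by blast
  qed (rule N)
qed

text \<open>\<open>P\<close> says which sets count as small. A closed \<open>K\<close> inside
  \<open>U\<close> is recorded because vanishing outside \<open>U\<close> alone would not give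
  vanishing near a point outside \<open>U\<close>.\<close>

definition unity_partition :: "('a set \<Rightarrow> bool) \<Rightarrow> 'a set \<Rightarrow> ('a \<Rightarrow> 'a \<Rightarrow> real) \<Rightarrow> bool" where
  "unity_partition P I \<theta> \<longleftrightarrow> finite I \<and> (\<forall>q\<in>points M. (\<Sum>i\<in>I. \<theta> i q) = 1) \<and>
    (\<forall>i\<in>I. (\<forall>q\<in>points M. msmooth (\<theta> i) q) \<and>
      (\<exists>U K. P U \<and> closedin X K \<and> K \<subseteq> U \<and> (\<forall>q\<in>points M - K. \<theta> i q = 0)))"

text \<open>By compactness finitely many of the sets where the bumps are positive cover the surface;
  the sum of these bumps is then positive everywhere and each is divided by it.\<close>

lemma partition_of_unity:
  assumes "compact_space X" "\<And>p. p \<in> points M \<Longrightarrow> \<exists>U. openin X U \<and> p \<in> U \<and> P U"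
  shows "\<exists>I \<theta>. unity_partition P I \<theta>"
proof -
  have "\<exists>U b K N. openin X U \<and> P U \<and> closedin X K \<and> K \<subseteq> U \<and> openin X N \<and> p \<in> N \<and>
    (\<forall>q\<in>points M. msmooth b q \<and> b q \<ge> 0) \<and> (\<forall>q\<in>N. b q > (0::real)) \<and> (\<forall>q\<in>points M - K. b q = 0)"
    if p: "p \<in> points M" for p
  proof -
    obtain U where U: "openin X U" "p \<in> U" "P U" using assms(2)[OF p] by blast
    show ?thesis using bump_exists[OF U(1,2)] U by blast
  qed
  then obtain U b K N where *: "\<And>p. p \<in> points M \<Longrightarrow> openin X (U p) \<and> P (U p) \<and>
    closedin X (K p) \<and> K p \<subseteq> U p \<and> openin X (N p) \<and> p \<in> N p \<and>
    (\<forall>q\<in>points M. msmooth (b p) q \<and> b p q \<ge> 0) \<and> (\<forall>q\<in>N p. b p q > (0::real)) \<and>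
    (\<forall>q\<in>points M - K p. b p q = 0)"
    by metis
  have "compactin X (points M)" using assms(1) by (simp add: compact_space_def)
  then have "\<exists>\<F>. finite \<F> \<and> \<F> \<subseteq> N ` points M \<and> points M \<subseteq> \<Union>\<F>"
    using * unfolding compactin_def by (elim conjE allE[of _ "N ` points M"]) auto
  then obtain I where I: "finite I" "I \<subseteq> points M" "points M \<subseteq> (\<Union>i\<in>I. N i)"
    by (metis finite_subset_image)
  define s where "s = (\<lambda>q. \<Sum>i\<in>I. b i q)"
  have s: "s q > 0" if q: "q \<in> points M" for q
  proof -
    obtain i where i: "i \<in> I" "q \<in> N i" using I(3) q by blast
    show ?thesis unfolding s_def
      by (rule sum_pos2[OF I(1) i(1)]) (use i I(2) q * in blast)+
  qed
  have s_smooth: "msmooth s q" if "q \<in> points M" for q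
    unfolding s_def using I(2) * that by (intro msmooth_sum) blast
  show ?thesis
    unfolding unity_partition_def
  proof (intro exI conjI ballI)
    show "finite I" by fact
    show "(\<Sum>i\<in>I. b i q / s q) = 1" if "q \<in> points M" for q
      using s[OF that] by (simp add: sum_divide_distrib[symmetric] s_def)
    fix i assume i: "i \<in> I"
    then have ip: "i \<in> points M" using I(2) by blast
    show "P (U i)" "closedin X (K i)" "K i \<subseteq> U i" using *[OF ip] by blast+
    show "b i q / s q = 0" if "q \<in> points M - K i" for q using *[OF ip] that by simp
    show "msmooth (\<lambda>q. b i q / s q) q" if "q \<in> points M" for q
      using *[OF ip] s_smooth[OF that] s[OF that] that by (intro msmooth_divide) auto
  qed
qed

subsection \<open>One-forms\<close>

lemma one_formsD:
  assumes "\<alpha> \<in> one_forms M W" "openin X W" "c \<in> atlas M" "p \<in> fst c \<inter> W"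
  shows "smooth_at (\<alpha> c \<circ> chart_inv c) (snd c p)"
    "d \<in> atlas M \<Longrightarrow> p \<in> fst d \<Longrightarrow> fst (\<alpha> c p) = fst (\<alpha> d p) * dz_ratio c d p"
    "d \<in> atlas M \<Longrightarrow> p \<in> fst d \<Longrightarrow> snd (\<alpha> c p) = snd (\<alpha> d p) * cnj (dz_ratio c d p)"
proof -
  have "smooth_on (snd c ` (fst c \<inter> W)) (\<alpha> c \<circ> chart_inv c)"
    using assms(1,3) unfolding one_forms_def by blast
  then show "smooth_at (\<alpha> c \<circ> chart_inv c) (snd c p)"
    using assms(4) unfolding smooth_on_iff_smooth_at[OF open_chart_image[OF assms(3,2)]] by blast
  have "\<forall>c\<in>atlas M. \<forall>d\<in>atlas M. \<forall>p\<in>fst c \<inter> fst d \<inter> W.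
        fst (\<alpha> c p) = fst (\<alpha> d p) * dz_ratio c d p \<and> snd (\<alpha> c p) = snd (\<alpha> d p) * cnj (dz_ratio c d p)"
    using assms(1) unfolding one_forms_def by blast
  then show "d \<in> atlas M \<Longrightarrow> p \<in> fst d \<Longrightarrow> fst (\<alpha> c p) = fst (\<alpha> d p) * dz_ratio c d p"
    "d \<in> atlas M \<Longrightarrow> p \<in> fst d \<Longrightarrow> snd (\<alpha> c p) = snd (\<alpha> d p) * cnj (dz_ratio c d p)"
    using assms(3,4) by blast+
qed

lemma one_forms_zero: "\<alpha> \<in> one_forms M W \<Longrightarrow> \<not> (c \<in> atlas M \<and> p \<in> fst c \<inter> W) \<Longrightarrow> \<alpha> c p = 0"
  unfolding one_forms_def zero_prod_def by blast

lemma one_formsI: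
  assumes "openin X W"
    and "\<And>c p. c \<in> atlas M \<Longrightarrow> p \<in> fst c \<inter> W \<Longrightarrow> smooth_at (\<alpha> c \<circ> chart_inv c) (snd c p)"
    and "\<And>c d p. c \<in> atlas M \<Longrightarrow> d \<in> atlas M \<Longrightarrow> p \<in> fst c \<inter> fst d \<inter> W \<Longrightarrow>
      fst (\<alpha> c p) = fst (\<alpha> d p) * dz_ratio c d p \<and> snd (\<alpha> c p) = snd (\<alpha> d p) * cnj (dz_ratio c d p)"
    and "\<And>c p. \<not> (c \<in> atlas M \<and> p \<in> fst c \<inter> W) \<Longrightarrow> \<alpha> c p = (0, 0)"
  shows "\<alpha> \<in> one_forms M W"
  unfolding one_forms_def mem_Collect_eq
proof (intro conjI ballI allI impI)
  show "smooth_on (snd c ` (fst c \<inter> W)) (\<alpha> c \<circ> chart_inv c)" if "c \<in> atlas M" for c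
    using assms(2)[OF that] unfolding smooth_on_iff_smooth_at[OF open_chart_image[OF that assms(1)]] by blast
qed (use assms(3,4) in blast)+

lemma form_smooth_cong:
  assumes "openin X U" "c \<in> atlas M" "p \<in> fst c" "p \<in> U"
    "\<And>q. q \<in> fst c \<inter> U \<Longrightarrow> \<alpha> q = \<beta> q" "smooth_at (\<alpha> \<circ> chart_inv c) (snd c p)"
  shows "smooth_at (\<beta> \<circ> chart_inv c) (snd c p)"
  by (rule smooth_at_cong[OF _ assms(6)])
    (use eventually_chart[OF assms(2,1,3,4)] assms(5) in \<open>auto elim!: eventually_mono\<close>)

lemma form_differentiable:
  assumes "smooth_at (\<alpha> \<circ> f) z"
  shows "(fst \<circ> \<alpha> \<circ> f) differentiable (at z)" "(snd \<circ> \<alpha> \<circ> f) differentiable (at z)"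
  using smooth_at_fst[OF assms] smooth_at_snd[OF assms]
  by (auto simp: o_def intro: smooth_at_differentiable)

text \<open>In the new chart the coefficients acquire the factor R or \<open>cnj R\<close> with R
  holomorphic. The derivative taken here kills that factor, and the chain rule contributes its
  conjugate; so these derivatives transform as coefficients of 2-forms.\<close>

lemma form_wirt_change:
  assumes "\<alpha> \<in> one_forms M W" "openin X W" "c \<in> atlas M" "d \<in> atlas M" "p \<in> fst c \<inter> fst d \<inter> W"
  shows "wirt_zbar (fst \<circ> \<alpha> c \<circ> chart_inv c) (snd c p) =
      wirt_zbar (fst \<circ> \<alpha> d \<circ> chart_inv d) (snd d p) * (dz_ratio c d p * cnj (dz_ratio c d p))" (is ?A)
    and "wirt_z (snd \<circ> \<alpha> c \<circ> chart_inv c) (snd c p) =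
      wirt_z (snd \<circ> \<alpha> d \<circ> chart_inv d) (snd d p) * (dz_ratio c d p * cnj (dz_ratio c d p))" (is ?B)
proof -
  define R where "R = dz_ratio c d \<circ> chart_inv c"
  define a where "a = (\<lambda>q. fst (\<alpha> d q))"
  define b where "b = (\<lambda>q. snd (\<alpha> d q))"
  have cd: "p \<in> fst c \<inter> fst d" "p \<in> fst c" "p \<in> fst d" "p \<in> fst d \<inter> W" using assms(5) by auto
  have Rp: "R (snd c p) = dz_ratio c d p" using assms(3) cd by (simp add: R_def chart_inv_chart)
  have Rs: "smooth_at R (snd c p)" unfolding R_def by (rule transition_smooth(2)[OF assms(3,4) cd(1)])
  have Rz: "wirt_zbar R (snd c p) = 0" unfolding R_def by (rule dz_ratio_wirt[OF assms(3,4) cd(1)])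
  have s: "smooth_at (\<alpha> d \<circ> chart_inv d) (snd d p)" by (rule one_formsD(1)[OF assms(1,2,4) cd(4)])
  have abd: "smooth_at (a \<circ> chart_inv d) (snd d p)" "smooth_at (b \<circ> chart_inv d) (snd d p)"
    using smooth_at_fst[OF s] smooth_at_snd[OF s] by (simp_all add: a_def b_def o_def)
  then have abc: "smooth_at (a \<circ> chart_inv c) (snd c p)" "smooth_at (b \<circ> chart_inv c) (snd c p)"
    using msmooth_chart_iff[OF assms(4) cd(3)] msmooth_chart_iff[OF assms(3) cd(2)] by blast+
  have ev: "\<forall>\<^sub>F z in nhds (snd c p). chart_inv c z \<in> fst c \<inter> (fst d \<inter> W)"
    using eventually_chart[OF assms(3) openin_Int[OF openin_chart[OF assms(4)] assms(2)] cd(2)] assms(5)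
    by (auto elim!: eventually_mono)
  have ea: "\<forall>\<^sub>F z in nhds (snd c p). (fst \<circ> \<alpha> c \<circ> chart_inv c) z = (a \<circ> chart_inv c) z * R z"
    using ev by eventually_elim (use one_formsD(2)[OF assms(1-3)] assms(4) in \<open>auto simp: a_def R_def\<close>)
  have eb: "\<forall>\<^sub>F z in nhds (snd c p). (snd \<circ> \<alpha> c \<circ> chart_inv c) z = (b \<circ> chart_inv c) z * cnj (R z)"
    using ev by eventually_elim (use one_formsD(3)[OF assms(1-3)] assms(4) in \<open>auto simp: b_def R_def\<close>)
  have ab: "fst \<circ> \<alpha> d \<circ> chart_inv d = a \<circ> chart_inv d" "snd \<circ> \<alpha> d \<circ> chart_inv d = b \<circ> chart_inv d"
    by (auto simp: a_def b_def)
  show ?A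
    unfolding wirt_cong(2)[OF ea] ab
      wirt_mult(2)[OF smooth_at_differentiable[OF abc(1)] smooth_at_differentiable[OF Rs]]
      wirt_chart_change(2)[OF assms(3,4) cd(1) abd(1)]
    by (simp add: Rz Rp)
  show ?B
    unfolding wirt_cong(1)[OF eb] ab
      wirt_mult(1)[OF smooth_at_differentiable[OF abc(2)] smooth_at_differentiable[OF smooth_at_cnj[OF Rs]]]
      wirt_cnj(1)[OF smooth_at_differentiable[OF Rs]]
      wirt_chart_change(1)[OF assms(3,4) cd(1) abd(2)]
    by (simp add: Rz Rp)
qed

lemma ext_d_change:
  assumes "\<alpha> \<in> one_forms M W" "openin X W" "c \<in> atlas M" "d \<in> atlas M" "p \<in> fst c \<inter> fst d \<inter> W"
  shows "ext_d M W \<alpha> c p = ext_d M W \<alpha> d p * complex_of_real ((cmod (dz_ratio c d p))\<^sup>2)"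
  unfolding ext_d_def using form_wirt_change[OF assms] assms(3-5)
  by (simp add: complex_norm_square algebra_simps flip: of_real_power)

lemma dbar_change:
  assumes "\<alpha> \<in> one_forms M (points M)" "c \<in> atlas M" "d \<in> atlas M" "p \<in> fst c \<inter> fst d"
  shows "dbar M \<alpha> c p = dbar M \<alpha> d p * complex_of_real ((cmod (dz_ratio c d p))\<^sup>2)"
  unfolding dbar_def using form_wirt_change(1)[OF assms(1) openin_topspace assms(2,3)] assms(2-4)
    chart_subset[OF assms(2)]
  by (auto simp: complex_norm_square algebra_simps simp flip: of_real_power)

text \<open>Two domains are allowed so that a form on all of the surface can be combined with a
  connection form, which lives on a trivialising set only.\<close>

lemma ext_d_lincomb:
  assumes "\<alpha> \<in> one_forms M W" "\<beta> \<in> one_forms M V" "openin X W" "openin X V" "W \<subseteq> V"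
    and "c \<in> atlas M" "p \<in> fst c \<inter> W"
  shows "ext_d M W (\<lambda>c p. if p \<in> W then \<alpha> c p + r *\<^sub>R \<beta> c p else (0, 0)) c p =
    ext_d M W \<alpha> c p + of_real r * ext_d M V \<beta> c p"
proof -
  let ?\<gamma> = "\<lambda>c p. if p \<in> W then \<alpha> c p + r *\<^sub>R \<beta> c p else (0, 0)"
  have s: "smooth_at (\<alpha> c \<circ> chart_inv c) (snd c p)" "smooth_at (\<beta> c \<circ> chart_inv c) (snd c p)"
    using one_formsD(1)[OF assms(1,3,6,7)] one_formsD(1)[OF assms(2,4,6), of p] assms(5,7) by auto
  note d = form_differentiable[OF s(1)] form_differentiable[OF s(2)]
  have ev: "\<forall>\<^sub>F z in nhds (snd c p). chart_inv c z \<in> W"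
    using eventually_chart[OF assms(6,3), of p] assms(7) by (auto elim!: eventually_mono)
  have 1: "\<forall>\<^sub>F z in nhds (snd c p). (fst \<circ> ?\<gamma> c \<circ> chart_inv c) z =
      (fst \<circ> \<alpha> c \<circ> chart_inv c) z + of_real r * (fst \<circ> \<beta> c \<circ> chart_inv c) z"
    using ev by eventually_elim (simp add: scaleR_conv_of_real)
  have 2: "\<forall>\<^sub>F z in nhds (snd c p). (snd \<circ> ?\<gamma> c \<circ> chart_inv c) z =
      (snd \<circ> \<alpha> c \<circ> chart_inv c) z + of_real r * (snd \<circ> \<beta> c \<circ> chart_inv c) z"
    using ev by eventually_elim (simp add: scaleR_conv_of_real)
  have dr: "(\<lambda>z. of_real r * f z) differentiable (at (snd c p))"
    if "f differentiable (at (snd c p))" for f :: "complex \<Rightarrow> complex"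
    using that by (intro differentiable_mult differentiable_const)
  have "p \<in> V" using assms(5,7) by blast
  then show ?thesis
    unfolding ext_d_def wirt_cong(1)[OF 2] wirt_cong(2)[OF 1] wirt_add[OF d(1) dr[OF d(3)]]
        wirt_add[OF d(2) dr[OF d(4)]] wirt_cmult[OF d(3)] wirt_cmult[OF d(4)]
    using assms(6,7) by (simp add: algebra_simps)
qed

lemma one_forms_lincomb:
  assumes "\<alpha> \<in> one_forms M W" "\<beta> \<in> one_forms M V" "openin X W" "openin X V" "W \<subseteq> V"
  shows "(\<lambda>c p. if p \<in> W then \<alpha> c p + r *\<^sub>R \<beta> c p else (0, 0)) \<in> one_forms M W"
proof (rule one_formsI[OF assms(3)])
  fix c p assume c: "c \<in> atlas M" "p \<in> fst c \<inter> W"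
  have "smooth_at (\<lambda>z. (\<alpha> c \<circ> chart_inv c) z + r *\<^sub>R (\<beta> c \<circ> chart_inv c) z) (snd c p)"
    by (intro smooth_intros one_formsD(1)[OF assms(1,3) c] one_formsD(1)[OF assms(2,4) c(1)])
      (use c assms(5) in auto)
  then have "smooth_at ((\<lambda>q. \<alpha> c q + r *\<^sub>R \<beta> c q) \<circ> chart_inv c) (snd c p)"
    by (simp add: o_def)
  then show "smooth_at ((\<lambda>p. if p \<in> W then \<alpha> c p + r *\<^sub>R \<beta> c p else (0, 0)) \<circ> chart_inv c) (snd c p)"
    by (rule form_smooth_cong[OF assms(3) c(1), rotated -1]) (use c in auto)
next
  fix c d p assume cd: "c \<in> atlas M" "d \<in> atlas M" "p \<in> fst c \<inter> fst d \<inter> W"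
  then have "p \<in> fst c \<inter> W" "p \<in> fst c \<inter> V" "p \<in> fst d" using assms(5) by auto
  then show "fst (if p \<in> W then \<alpha> c p + r *\<^sub>R \<beta> c p else (0, 0)) =
      fst (if p \<in> W then \<alpha> d p + r *\<^sub>R \<beta> d p else (0, 0)) * dz_ratio c d p \<and>
      snd (if p \<in> W then \<alpha> c p + r *\<^sub>R \<beta> c p else (0, 0)) =
      snd (if p \<in> W then \<alpha> d p + r *\<^sub>R \<beta> d p else (0, 0)) * cnj (dz_ratio c d p)"
    using one_formsD(2,3)[OF assms(1,3) cd(1), of p d] one_formsD(2,3)[OF assms(2,4) cd(1), of p d] cd(2)
    by (simp add: scaleR_conv_of_real algebra_simps)
next
  fix c p assume "\<not> (c \<in> atlas M \<and> p \<in> fst c \<inter> W)"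
  then show "(if p \<in> W then \<alpha> c p + r *\<^sub>R \<beta> c p else (0, 0)) = (0, 0)"
    using one_forms_zero[OF assms(1), of c p] one_forms_zero[OF assms(2), of c p] assms(5)
    by (auto simp: zero_prod_def)
qed

text \<open>\<open>f dz - cnj f cnj(dz)\<close> in the coordinate \<open>z\<close> of the chart \<open>d\<close>.\<close>

definition chart_form :: "'a chart \<Rightarrow> (complex \<Rightarrow> complex) \<Rightarrow> 'a form1" where
  "chart_form d f = (\<lambda>c p. if c \<in> atlas M \<and> p \<in> fst c \<inter> fst d
     then (f (snd d p) * dz_ratio c d p, - cnj (f (snd d p) * dz_ratio c d p)) else (0, 0))"

lemma chart_form_outside:
  assumes "d \<in> atlas M" "\<And>z. z \<in> snd d ` fst d \<Longrightarrow> z \<notin> K \<Longrightarrow> f z = 0" "q \<notin> chart_inv d ` K"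
  shows "chart_form d f c q = (0, 0)"
  using assms chart_inv_chart[OF assms(1), of q] by (force simp: chart_form_def)

text \<open>Near a point of the chart the coefficient is an extended function times
  \<open>dz_ratio\<close>; near any other point the form is zero, the image of \<open>K\<close>
  being closed. Compatibility between charts is the cocycle identity.\<close>

lemma chart_form_imaginary:
  assumes d: "d \<in> atlas M" and K: "compact K" "K \<subseteq> snd d ` fst d"
    and f: "\<And>z. z \<in> snd d ` fst d \<Longrightarrow> z \<notin> K \<Longrightarrow> f z = 0" "\<And>z. z \<in> snd d ` fst d \<Longrightarrow> smooth_at f z"
  shows "chart_form d f \<in> imaginary_forms M"
proof -
  have "chart_form d f \<in> one_forms M (points M)"
  proof (rule one_formsI[OF openin_topspace])
    fix c p assume c: "c \<in> atlas M" "p \<in> fst c \<inter> points M"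
    show "smooth_at (chart_form d f c \<circ> chart_inv c) (snd c p)"
    proof (cases "p \<in> fst d")
      case True
      then have p: "p \<in> fst c \<inter> fst d" using c by blast
      have "smooth_at (chart_ext d f \<circ> chart_inv c) (snd c p)"
        using msmoothD[OF msmooth_chart_ext[OF d K f] c(1)] c by auto
      then have "smooth_at (\<lambda>z. (chart_ext d f \<circ> chart_inv c) z * (dz_ratio c d \<circ> chart_inv c) z) (snd c p)"
        by (intro smooth_intros transition_smooth(2)[OF c(1) d p])
      then have "smooth_at ((\<lambda>q. (chart_ext d f q * dz_ratio c d q, - cnj (chart_ext d f q * dz_ratio c d q))) \<circ> chart_inv c) (snd c p)"
        unfolding o_def by (intro smooth_at_Pair smooth_at_minus smooth_at_cnj)
      then show ?thesis
        by (rule form_smooth_cong[OF openin_chart[OF d] c(1), rotated -1])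
          (use p c in \<open>auto simp: chart_form_def chart_ext_def\<close>)
    next
      case False
      have "smooth_at ((\<lambda>q. (0, 0)) \<circ> chart_inv c) (snd c p)" unfolding o_def by (rule smooth_at_const)
      then show ?thesis
      proof (rule form_smooth_cong[where U = "points M - chart_inv d ` K", rotated -1])
        show "openin X (points M - chart_inv d ` K)"
          using closedin_chart_inv_image[OF d K] by (simp add: openin_diff)
        show "p \<in> points M - chart_inv d ` K" using c False chart_inv_image[OF K(2)] by blast
        show "(0, 0) = chart_form d f c q" if "q \<in> fst c \<inter> (points M - chart_inv d ` K)" for q
          using chart_form_outside[OF d, of K f q c] f(1) that by simp
      qed (use c in auto)
    qed
  next
    fix c e p assume *: "c \<in> atlas M" "e \<in> atlas M" "p \<in> fst c \<inter> fst e \<inter> points M"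
    then show "fst (chart_form d f c p) = fst (chart_form d f e p) * dz_ratio c e p \<and>
       snd (chart_form d f c p) = snd (chart_form d f e p) * cnj (dz_ratio c e p)"
      using dz_ratio_cocycle[OF *(1,2) d, of p] by (auto simp: chart_form_def)
  next
    fix c p assume "\<not> (c \<in> atlas M \<and> p \<in> fst c \<inter> points M)"
    then show "chart_form d f c p = (0, 0)" using chart_subset[of c] by (auto simp: chart_form_def)
  qed
  then show ?thesis by (auto simp: imaginary_forms_def chart_form_def)
qed

lemma imaginary_one_form: "\<alpha> \<in> imaginary_forms M \<Longrightarrow> \<alpha> \<in> one_forms M (points M)"
  by (simp add: imaginary_forms_def)

text \<open>In the chart \<open>d\<close> the ratio is 1 and the two parts of the form contribute
  conjugate terms to the exterior derivative, hence the real part. Other charts follow from the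
  transformation rule, and off \<open>d\<close> the form vanishes in a neighbourhood.\<close>

lemma chart_form_derivs:
  assumes d: "d \<in> atlas M" and K: "compact K" "K \<subseteq> snd d ` fst d"
    and f: "\<And>z. z \<in> snd d ` fst d \<Longrightarrow> z \<notin> K \<Longrightarrow> f z = 0" "\<And>z. z \<in> snd d ` fst d \<Longrightarrow> smooth_at f z"
    and c: "c \<in> atlas M" "p \<in> fst c"
  shows "ext_d M (points M) (chart_form d f) c p =
      (if p \<in> fst d then of_real (- 2 * Re (wirt_zbar f (snd d p)) * (cmod (dz_ratio c d p))\<^sup>2) else 0)" (is ?A)
    and "dbar M (chart_form d f) c p =
      (if p \<in> fst d then - wirt_zbar f (snd d p) * of_real ((cmod (dz_ratio c d p))\<^sup>2) else 0)" (is ?B)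
proof -
  note img = chart_form_imaginary[OF d K f]
  note one = imaginary_one_form[OF img]
  have "?A \<and> ?B"
  proof (cases "p \<in> fst d")
    case True
    have pM: "p \<in> points M" using c chart_subset by blast
    have ev: "\<forall>\<^sub>F z in nhds (snd d p). z \<in> snd d ` fst d"
      using eventually_nhds_in_open[OF open_chart[OF d]] True by blast
    have 1: "\<forall>\<^sub>F z in nhds (snd d p). (fst \<circ> chart_form d f d \<circ> chart_inv d) z = f z"
      using ev by eventually_elim (use d in \<open>auto simp: chart_form_def dz_ratio_self chart_inv_chart\<close>)
    have 2: "\<forall>\<^sub>F z in nhds (snd d p). (snd \<circ> chart_form d f d \<circ> chart_inv d) z = - cnj (f z)"
      using ev by eventually_elim (use d in \<open>auto simp: chart_form_def dz_ratio_self chart_inv_chart\<close>)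
    have fd: "f differentiable (at (snd d p))" "(\<lambda>z. cnj (f z)) differentiable (at (snd d p))"
      using smooth_at_differentiable smooth_at_cnj f(2) True by blast+
    have "ext_d M (points M) (chart_form d f) d p = of_real (- 2 * Re (wirt_zbar f (snd d p)))"
      using d True pM
      by (simp add: ext_d_def wirt_cong(1)[OF 2] wirt_cong(2)[OF 1] wirt_minus[OF fd(2)] wirt_cnj[OF fd(1)] complex_eq_iff)
    moreover have "dbar M (chart_form d f) d p = - wirt_zbar f (snd d p)"
      using d True by (simp add: dbar_def wirt_cong(2)[OF 1])
    ultimately show ?thesis
      using ext_d_change[OF one openin_topspace c(1) d, of p] dbar_change[OF one c(1) d, of p] True c pM by simp
  next
    case False
    let ?U = "points M - chart_inv d ` K"
    have U: "openin X ?U"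
      using closedin_chart_inv_image[OF d K] by (simp add: openin_diff)
    have "p \<in> ?U" using c chart_subset[OF c(1)] False chart_inv_image[OF K(2)] by blast
    then have ev: "\<forall>\<^sub>F z in nhds (snd c p). chart_inv c z \<in> ?U"
      using eventually_chart[OF c(1) U c(2)] by (auto elim!: eventually_mono)
    have 1: "\<forall>\<^sub>F z in nhds (snd c p). (fst \<circ> chart_form d f c \<circ> chart_inv c) z = 0"
      using ev by eventually_elim (use chart_form_outside[OF d, of K f] f(1) in auto)
    have 2: "\<forall>\<^sub>F z in nhds (snd c p). (snd \<circ> chart_form d f c \<circ> chart_inv c) z = 0"
      using ev by eventually_elim (use chart_form_outside[OF d, of K f] f(1) in auto)
    show ?thesis
      using False by (simp add: ext_d_def dbar_def wirt_cong(1)[OF 2] wirt_cong(2)[OF 1] wirt_const)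
  qed
  then show ?A ?B by blast+
qed

end

locale riemann_metric = riemann +
  fixes h :: "'a chart \<Rightarrow> 'a \<Rightarrow> real"
  assumes conformal: "conformal_metric M h"
begin

lemma h_pos: "c \<in> atlas M \<Longrightarrow> p \<in> fst c \<Longrightarrow> h c p > 0"
  and h_change: "c \<in> atlas M \<Longrightarrow> d \<in> atlas M \<Longrightarrow> p \<in> fst c \<inter> fst d \<Longrightarrow> h c p = h d p * cmod (dz_ratio c d p)"
  using conformal unfolding conformal_metric_def by blast+

lemma h_smooth: "c \<in> atlas M \<Longrightarrow> p \<in> fst c \<Longrightarrow> msmooth (h c) p"
proof -
  assume c: "c \<in> atlas M" "p \<in> fst c"
  have "smooth_on (snd c ` fst c) (h c \<circ> chart_inv c)"
    using conformal c(1) unfolding conformal_metric_def by blast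
  then show ?thesis
    unfolding msmooth_chart_iff[OF c] smooth_on_iff_smooth_at[OF open_chart[OF c(1)]] using c(2) by blast
qed

subsection \<open>Exact area forms\<close>

text \<open>A real \<kappa> encodes the 2-form with coefficient \<kappa> h^2. Since dz \<and>
  cnj(dz) is itself imaginary, real densities match the imaginary 2-forms, among which curvatures
  lie.\<close>

definition area_exact :: "('a \<Rightarrow> real) \<Rightarrow> bool" where
  "area_exact \<kappa> \<longleftrightarrow> (\<exists>\<alpha>\<in>imaginary_forms M. \<forall>c\<in>atlas M. \<forall>p\<in>fst c.
     ext_d M (points M) \<alpha> c p = complex_of_real (\<kappa> p * (h c p)\<^sup>2))"

lemma area_exact_lincomb:
  assumes "area_exact \<kappa>" "area_exact \<tau>"
  shows "area_exact (\<lambda>p. \<kappa> p + r * \<tau> p)"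
proof -
  obtain \<alpha> where \<alpha>: "\<alpha> \<in> imaginary_forms M"
    "\<And>c p. c \<in> atlas M \<Longrightarrow> p \<in> fst c \<Longrightarrow> ext_d M (points M) \<alpha> c p = complex_of_real (\<kappa> p * (h c p)\<^sup>2)"
    using assms(1) by (auto simp: area_exact_def)
  obtain \<beta> where \<beta>: "\<beta> \<in> imaginary_forms M"
    "\<And>c p. c \<in> atlas M \<Longrightarrow> p \<in> fst c \<Longrightarrow> ext_d M (points M) \<beta> c p = complex_of_real (\<tau> p * (h c p)\<^sup>2)"
    using assms(2) by (auto simp: area_exact_def)
  let ?\<gamma> = "\<lambda>c p. if p \<in> points M then \<alpha> c p + r *\<^sub>R \<beta> c p else (0, 0)"
  have "?\<gamma> \<in> imaginary_forms M"
    using one_forms_lincomb[OF imaginary_one_form[OF \<alpha>(1)] imaginary_one_form[OF \<beta>(1)] openin_topspace openin_topspace subset_refl, of r]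
      \<alpha>(1) \<beta>(1) by (auto simp: imaginary_forms_def)
  moreover have "ext_d M (points M) ?\<gamma> c p = complex_of_real ((\<kappa> p + r * \<tau> p) * (h c p)\<^sup>2)"
    if "c \<in> atlas M" "p \<in> fst c" for c p
    using ext_d_lincomb[OF imaginary_one_form[OF \<alpha>(1)] imaginary_one_form[OF \<beta>(1)] openin_topspace openin_topspace subset_refl that(1), of p r]
      \<alpha>(2)[OF that] \<beta>(2)[OF that] that chart_subset[OF that(1)] by (auto simp: algebra_simps)
  ultimately show ?thesis unfolding area_exact_def by blast
qed

text \<open>The Poincare lemma of the rectangle, carried to the surface through a chart. The
  difference of the densities becomes a divergence, and the vector field is rewritten as an
  imaginary 1-form.\<close>

lemma area_exact_chart:
  assumes c: "c \<in> atlas M" and box: "Re a < Re b" "Im a < Im b" "cbox a b \<subseteq> snd c ` fst c"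
    and \<kappa>: "\<And>p. p \<in> points M \<Longrightarrow> msmooth \<kappa> p" "\<And>p. p \<in> points M \<Longrightarrow> p \<notin> chart_inv c ` cbox a b \<Longrightarrow> \<kappa> p = 0"
    and \<tau>: "\<And>p. p \<in> points M \<Longrightarrow> msmooth \<tau> p" "\<And>p. p \<in> points M \<Longrightarrow> p \<notin> chart_inv c ` cbox a b \<Longrightarrow> \<tau> p = 0"
      "\<And>p. p \<in> points M \<Longrightarrow> \<tau> p \<ge> 0" "q \<in> points M" "\<tau> q > 0"
  shows "\<exists>\<rho>. area_exact (\<lambda>p. \<kappa> p - \<rho> * \<tau> p)"
proof -
  \<comment> \<open>The factor h^2 converts a density into the coefficient of the 2-form, the
    quantity to which the planar statement applies.\<close>
  define loc where "loc = (\<lambda>k z. if z \<in> snd c ` fst c then k (chart_inv c z) * (h c (chart_inv c z))\<^sup>2 else (0::real))"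
  have inV: "chart_inv c z \<in> fst c" "chart_inv c z \<in> points M" if "z \<in> snd c ` fst c" for z
    using chart_inv_in[OF that] chart_subset[OF c] by blast+
  have out: "loc k z = 0" if "\<And>p. p \<in> points M \<Longrightarrow> p \<notin> chart_inv c ` cbox a b \<Longrightarrow> k p = 0" "z \<notin> cbox a b" for k z
  proof (cases "z \<in> snd c ` fst c")
    case True
    have "chart_inv c z \<notin> chart_inv c ` cbox a b"
    proof
      assume "chart_inv c z \<in> chart_inv c ` cbox a b"
      then obtain w where w: "w \<in> cbox a b" "chart_inv c z = chart_inv c w" by blast
      then have "z = w" using chart_chart_inv[OF True] chart_chart_inv[of w c] box(3) by auto
      then show False using w that(2) by blast
    qed
    then show ?thesis using that(1) inV[OF True] by (simp add: loc_def)
  qed (simp add: loc_def)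
  have smooth: "smooth_on UNIV (loc k)"
    if "\<And>p. p \<in> points M \<Longrightarrow> msmooth k p" "\<And>p. p \<in> points M \<Longrightarrow> p \<notin> chart_inv c ` cbox a b \<Longrightarrow> k p = 0" for k
    unfolding smooth_UNIV_iff
  proof
    fix z
    show "smooth_at (loc k) z"
    proof (cases "z \<in> snd c ` fst c")
      case True
      have "msmooth (\<lambda>p. k p * (h c p)\<^sup>2) (chart_inv c z)"
        using that(1) inV[OF True] h_smooth[OF c] by (intro msmooth_mult msmooth_power)
      then have "smooth_at ((\<lambda>p. k p * (h c p)\<^sup>2) \<circ> chart_inv c) z"
        using msmoothD[OF _ c inV(1)[OF True]] chart_chart_inv[OF True] by metis
      then show ?thesis
        by (rule smooth_at_cong[rotated])
          (use eventually_nhds_in_open[OF open_chart[OF c] True] in \<open>auto elim!: eventually_mono simp: loc_def\<close>)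
    next
      case False
      have "z \<in> - cbox a b" using False box(3) by blast
      then have "\<forall>\<^sub>F z in nhds z. 0 = loc k z"
        using eventually_nhds_in_open[OF open_Compl[OF closed_cbox[of a b]], of z] out[of k] that(2)
        by (auto elim!: eventually_mono)
      then show ?thesis by (rule smooth_at_cong[OF _ smooth_at_const])
    qed
  qed
  have nonneg: "loc \<tau> z \<ge> 0" for z using \<tau>(3) inV by (simp add: loc_def)
  have q: "q \<in> chart_inv c ` cbox a b" using \<tau>(2,4,5) by force
  then have qc: "q \<in> fst c" using chart_inv_image[OF box(3)] by blast
  have "loc \<tau> (snd c q) > 0"
    using qc \<tau>(5) h_pos[OF c qc] by (simp add: loc_def chart_inv_chart[OF c])
  from compact_poincare[OF box(1,2) smooth[OF \<kappa>] out[OF \<kappa>(2)] smooth[OF \<tau>(1,2)] out[OF \<tau>(2)] nonneg this]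
  obtain \<rho> where "box_exact a b (\<lambda>z. loc \<kappa> z - \<rho> * loc \<tau> z)" by blast
  then obtain A B where AB: "smooth_on UNIV A" "smooth_on UNIV B" "\<And>z. z \<notin> cbox a b \<Longrightarrow> A z = 0 \<and> B z = 0"
    "\<And>z. loc \<kappa> z - \<rho> * loc \<tau> z = fderiv A z 1 + fderiv B z \<i>"
    unfolding box_exact_def by blast
  \<comment> \<open>The signs are chosen so that -2 times the real part of the derivative of
    \<open>f\<close> with respect to \<open>cnj z\<close> is the divergence of the field (A,
    B).\<close>
  define f where "f = (\<lambda>z. Complex (- A z) (B z))"
  have ABs: "smooth_at A z" "smooth_at B z" for z using AB(1,2) by (simp_all add: smooth_UNIV_iff)
  have fs: "smooth_at f z" for z
    unfolding f_def by (intro smooth_at_Complex smooth_at_minus ABs)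
  have f0: "f z = 0" if "z \<notin> cbox a b" for z using AB(3)[OF that] by (simp add: f_def complex_eq_iff)
  have fd: "fderiv f z v = Complex (- fderiv A z v) (fderiv B z v)" for z v
  proof -
    have "(f has_derivative (\<lambda>v. Complex (- fderiv A z v) (fderiv B z v))) (at z)"
      unfolding f_def Complex_eq using smooth_at_has_derivative[OF ABs(1)] smooth_at_has_derivative[OF ABs(2)]
      by (auto intro!: derivative_eq_intros)
    from fun_cong[OF frechet_derivative_at[OF this], of v] show ?thesis by (rule sym)
  qed
  have key: "- 2 * Re (wirt_zbar f z) = loc \<kappa> z - \<rho> * loc \<tau> z" for z
    unfolding AB(4) wirt_zbar_def fd by simp
  have der: "ext_d M (points M) (chart_form c f) d p = (if p \<in> fst c then
      of_real ((loc \<kappa> (snd c p) - \<rho> * loc \<tau> (snd c p)) * (cmod (dz_ratio d c p))\<^sup>2) else 0)"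
    if d: "d \<in> atlas M" "p \<in> fst d" for d p
    unfolding key[symmetric] by (rule chart_form_derivs(1)[OF c compact_cbox box(3)]) (use f0 fs d in auto)
  \<comment> \<open>In another chart both sides scale by the same squared modulus, on the left as a
    2-form and on the right through h^2.\<close>
  have "ext_d M (points M) (chart_form c f) d p = complex_of_real ((\<kappa> p - \<rho> * \<tau> p) * (h d p)\<^sup>2)"
    if d: "d \<in> atlas M" "p \<in> fst d" for d p
  proof (cases "p \<in> fst c")
    case True
    have "h d p = h c p * cmod (dz_ratio d c p)" using h_change[OF d(1) c] d True by blast
    then show ?thesis
      unfolding der[OF d]
      using True by (simp add: loc_def chart_inv_chart[OF c] power_mult_distrib algebra_simps)
  next
    case False
    have "p \<in> points M" "p \<notin> chart_inv c ` cbox a b"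
      using d chart_subset False box(3) chart_inv_image by blast+
    then show ?thesis
      unfolding der[OF d] using False \<kappa>(2) \<tau>(2) by simp
  qed
  moreover have "chart_form c f \<in> imaginary_forms M"
    by (rule chart_form_imaginary[OF c compact_cbox box(3)]) (use f0 fs in auto)
  ultimately show ?thesis unfolding area_exact_def by blast
qed

lemma box_nbhd:
  assumes "p \<in> points M"
  obtains c a b U where "c \<in> atlas M" "Re a < Re b" "Im a < Im b" "cbox a b \<subseteq> snd c ` fst c"
    "openin X U" "p \<in> U" "U \<subseteq> chart_inv c ` cbox a b"
proof -
  obtain c where c: "c \<in> atlas M" "p \<in> fst c" using chart_exists[OF assms] by blast
  obtain a b where ab: "snd c p \<in> box a b" "cbox a b \<subseteq> snd c ` fst c"
    using c(2) by (meson imageI open_chart[OF c(1)] open_contains_cbox)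
  have "Re a < Re b" "Im a < Im b" using ab(1) by (auto simp: in_box_complex_iff)
  moreover have "openin X {q \<in> fst c. snd c q \<in> box a b}"
    by (rule openin_chart_preimage[OF c(1) open_box])
  moreover have "{q \<in> fst c. snd c q \<in> box a b} \<subseteq> chart_inv c ` cbox a b"
  proof
    fix q assume "q \<in> {q \<in> fst c. snd c q \<in> box a b}"
    then have "q = chart_inv c (snd c q)" "snd c q \<in> cbox a b"
      using chart_inv_chart[OF c(1)] box_subset_cbox[of a b] by auto
    then show "q \<in> chart_inv c ` cbox a b" by (rule image_eqI)
  qed
  ultimately show ?thesis using that[OF c(1) _ _ ab(2)] ab(1) c by blast
qed

lemma area_exact_cong: "area_exact \<kappa> \<Longrightarrow> (\<And>p. p \<in> points M \<Longrightarrow> \<kappa> p = \<tau> p) \<Longrightarrow> area_exact \<tau>"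
  unfolding area_exact_def using chart_subset by (metis subsetD)

text \<open>The set of points near which every compactly supported area form is a multiple of \<open>\<tau>\<close> up to
  an exact form is open and closed.\<close>

lemma area_exact_modulo:
  assumes compact: "compact_space X"
    and c: "c \<in> atlas M" and box: "Re a < Re b" "Im a < Im b" "cbox a b \<subseteq> snd c ` fst c"
    and \<tau>: "\<And>p. p \<in> points M \<Longrightarrow> msmooth \<tau> p" "\<And>p. p \<in> points M \<Longrightarrow> p \<notin> chart_inv c ` cbox a b \<Longrightarrow> \<tau> p = 0"
      "\<And>p. p \<in> points M \<Longrightarrow> \<tau> p \<ge> 0" "q \<in> fst c" "snd c q \<in> box a b" "\<tau> q > 0"
    and \<kappa>: "\<And>p. p \<in> points M \<Longrightarrow> msmooth \<kappa> p"
  shows "\<exists>\<rho>. area_exact (\<lambda>p. \<kappa> p - \<rho> * \<tau> p)"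
proof -
  \<comment> \<open>\<open>R k\<close>: the density \<open>k\<close> is reducible to a multiple of
    \<tau>. \<open>G U\<close>: every smooth density vanishing off \<open>U\<close> is reducible.
    \<open>S\<close>: the points with such a neighbourhood.\<close>
  define R where "R = (\<lambda>k :: 'a \<Rightarrow> real. \<exists>\<rho>. area_exact (\<lambda>p. k p - \<rho> * \<tau> p))"
  define G where "G = (\<lambda>U. \<forall>k :: 'a \<Rightarrow> real. (\<forall>p\<in>points M. msmooth k p) \<longrightarrow> (\<forall>p\<in>points M - U. k p = 0) \<longrightarrow> R k)"
  define S where "S = {p. \<exists>U. openin X U \<and> p \<in> U \<and> G U}"
  have R_add: "R (\<lambda>p. k p + r * l p)" if kl: "R k" "R l" for k l r
  proof -
    obtain \<rho> \<sigma> where "area_exact (\<lambda>p. k p - \<rho> * \<tau> p)" "area_exact (\<lambda>p. l p - \<sigma> * \<tau> p)"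
      using kl unfolding R_def by blast
    from area_exact_lincomb[OF this, of r]
    have "area_exact (\<lambda>p. (k p + r * l p) - (\<rho> + r * \<sigma>) * \<tau> p)" by (simp add: algebra_simps)
    then show ?thesis unfolding R_def by blast
  qed
  have q: "q \<in> points M" using chart_subset[OF c] \<tau>(4) by blast
  have q_in: "q \<in> S"
  proof -
    let ?U = "{p \<in> fst c. snd c p \<in> box a b}"
    have "R k" if k: "\<forall>p\<in>points M. msmooth k p" "\<forall>p\<in>points M - ?U. k p = 0" for k
    proof -
      have "k p = 0" if "p \<in> points M" "p \<notin> chart_inv c ` cbox a b" for p
      proof -
        have "p \<notin> ?U" using that(2) chart_inv_chart[OF c, of p] box_subset_cbox[of a b] by force
        then show ?thesis using k(2) that(1) by blast
      qed
      then show ?thesis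
        unfolding R_def using k(1) area_exact_chart[OF c box _ _ \<tau>(1-3) q \<tau>(6), of k] by blast
    qed
    moreover have "openin X ?U" by (rule openin_chart_preimage[OF c open_box])
    ultimately show ?thesis unfolding S_def G_def using \<tau>(4,5) by blast
  qed
  \<comment> \<open>The closedness argument: if a coordinate rectangle contains one point of
    \<open>S\<close>, a bump near that point is reducible, and by the Poincare lemma in the
    rectangle every density supported in \<open>U\<close> is a multiple of this bump up to an exact
    one.\<close>
  have absorb: "G U" if *: "d \<in> atlas M" "Re a' < Re b'" "Im a' < Im b'" "cbox a' b' \<subseteq> snd d ` fst d"
    "openin X U" "U \<subseteq> chart_inv d ` cbox a' b'" "s \<in> U" "s \<in> S" for d a' b' U s
  proof -
    obtain W where W: "openin X W" "s \<in> W" "G W" using *(8) by (auto simp: S_def)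
    have "openin X (U \<inter> W)" using *(5) W(1) by (rule openin_Int)
    from bump_exists[OF this, of s] *(7) W(2)
    obtain f K N where f: "K \<subseteq> U \<inter> W" "s \<in> N" "\<And>q. q \<in> points M \<Longrightarrow> msmooth f q \<and> f q \<ge> 0"
      "\<And>q. q \<in> N \<Longrightarrow> f q > (0::real)" "\<And>q. q \<in> points M - K \<Longrightarrow> f q = 0" by blast
    have s: "s \<in> points M" using *(5,7) openin_subset by blast
    have "R f" using W(3) f(1,3,5) unfolding G_def by blast
    show ?thesis unfolding G_def
    proof (intro allI impI)
      fix k :: "'a \<Rightarrow> real" assume k: "\<forall>p\<in>points M. msmooth k p" "\<forall>p\<in>points M - U. k p = 0"
      have "\<exists>\<rho>. area_exact (\<lambda>p. k p - \<rho> * f p)"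
        by (rule area_exact_chart[OF *(1-4), where q = s]) (use k f s *(6) in blast)+
      then obtain \<rho> where "area_exact (\<lambda>p. k p - \<rho> * f p)" by blast
      \<comment> \<open>An exact density is reducible with the multiple 0.\<close>
      then have "R (\<lambda>p. k p - \<rho> * f p)" unfolding R_def by (intro exI[of _ 0]) simp
      from R_add[OF this \<open>R f\<close>, of \<rho>] show "R k" by simp
    qed
  qed
  have "openin X S"
    by (subst openin_subopen) (auto simp: S_def)
  moreover have "openin X (points M - S)"
  proof (subst openin_subopen, intro ballI)
    fix p assume p: "p \<in> points M - S"
    then obtain d a' b' U where U: "d \<in> atlas M" "Re a' < Re b'" "Im a' < Im b'" "cbox a' b' \<subseteq> snd d ` fst d"
      "openin X U" "p \<in> U" "U \<subseteq> chart_inv d ` cbox a' b'"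
      using box_nbhd[of p] by blast
    have "U \<inter> S = {}"
    proof (rule ccontr)
      \<comment> \<open>Absorption would make \<open>U\<close> a good neighbourhood of
        \<open>p\<close> as well.\<close>
      assume "U \<inter> S \<noteq> {}"
      then have "G U" using absorb[OF U(1-5,7)] by blast
      then show False using U(5,6) p by (auto simp: S_def)
    qed
    then show "\<exists>T. openin X T \<and> p \<in> T \<and> T \<subseteq> points M - S"
      using U(5,6) openin_subset by blast
  qed
  moreover have "S \<subseteq> points M" using openin_subset by (auto simp: S_def)
  ultimately have "S = points M"
    using riemann_surface q_in connected_space_clopen_in[of "topol M"]
    by (auto simp: riemann_surface_def closedin_def)
  then have "\<exists>U. openin X U \<and> p \<in> U \<and> G U" if "p \<in> points M" for p
    using that by (auto simp: S_def)
  then obtain I \<theta> where pu: "unity_partition G I \<theta>"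
    using partition_of_unity[OF compact] by blast
  \<comment> \<open>The start of the sum over the partition: the zero density vanishes off the good
    neighbourhood of \<open>q\<close>.\<close>
  have R0: "R (\<lambda>p. 0)"
    using q_in by (auto simp: S_def G_def msmooth_const)
  have Ri: "R (\<lambda>p. \<theta> i p * \<kappa> p)" if i: "i \<in> I" for i
  proof -
    obtain U K where K: "G U" "K \<subseteq> U" "\<forall>q\<in>points M - K. \<theta> i q = 0"
      using pu i unfolding unity_partition_def by blast
    have "\<forall>p\<in>points M. msmooth (\<lambda>p. \<theta> i p * \<kappa> p) p"
      using pu i \<kappa> unfolding unity_partition_def by (blast intro: msmooth_mult)
    moreover have "\<forall>p\<in>points M - U. \<theta> i p * \<kappa> p = 0" using K by auto
    ultimately show ?thesis using K(1) unfolding G_def by blast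
  qed
  have "J \<subseteq> I \<Longrightarrow> R (\<lambda>p. \<Sum>i\<in>J. \<theta> i p * \<kappa> p)" for J
  proof (induction J rule: infinite_finite_induct)
    case (insert i J)
    then show ?case using R_add[of "\<lambda>p. \<Sum>i\<in>J. \<theta> i p * \<kappa> p" _ 1] Ri[of i] by (simp add: add.commute)
  qed (use R0 in simp_all)
  then obtain \<rho> where "area_exact (\<lambda>p. (\<Sum>i\<in>I. \<theta> i p * \<kappa> p) - \<rho> * \<tau> p)" by (auto simp: R_def)
  then have "area_exact (\<lambda>p. \<kappa> p - \<rho> * \<tau> p)"
    by (rule area_exact_cong) (use pu in \<open>simp add: unity_partition_def flip: sum_distrib_right\<close>)
  then show ?thesis by blast
qed

end

section \<open>Hermitian line bundles\<close>

context riemann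
begin

subsection \<open>Logarithmic differentials\<close>

lemma dlog_cong:
  assumes "c \<in> atlas M" "p \<in> fst c" "openin X U" "p \<in> U" "\<And>q. q \<in> U \<Longrightarrow> f q = g q"
  shows "dlog f c p = dlog g c p"
proof -
  have "\<forall>\<^sub>F z in nhds (snd c p). (f \<circ> chart_inv c) z = (g \<circ> chart_inv c) z"
    using eventually_chart[OF assms(1,3,2,4)] assms(5) by (auto elim!: eventually_mono)
  then show ?thesis using assms(4,5) by (simp add: dlog_def wirt_cong[of "f \<circ> chart_inv c" "g \<circ> chart_inv c"])
qed

lemma dlog_mult:
  assumes "c \<in> atlas M" "p \<in> fst c" "msmooth f p" "msmooth g p" "f p \<noteq> 0" "g p \<noteq> 0"
  shows "dlog (\<lambda>q. f q * g q) c p = dlog f c p + dlog g c p"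
proof -
  have d: "(f \<circ> chart_inv c) differentiable (at (snd c p))" "(g \<circ> chart_inv c) differentiable (at (snd c p))"
    using msmoothD[OF _ assms(1,2)] assms(3,4) smooth_at_differentiable by blast+
  have "(\<lambda>q. f q * g q) \<circ> chart_inv c = (\<lambda>z. (f \<circ> chart_inv c) z * (g \<circ> chart_inv c) z)" by auto
  then show ?thesis
    unfolding dlog_def using wirt_mult[OF d] assms(5,6)
    by (simp only: o_apply chart_inv_chart[OF assms(1,2)]) (simp add: field_simps)
qed

lemma dlog_cnj:
  assumes "c \<in> atlas M" "p \<in> fst c" "msmooth f p"
  shows "dlog (\<lambda>q. cnj (f q)) c p = (cnj (snd (dlog f c p)), cnj (fst (dlog f c p)))"
proof -
  have d: "(f \<circ> chart_inv c) differentiable (at (snd c p))"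
    using msmoothD[OF assms(3,1,2)] smooth_at_differentiable by blast
  have "(\<lambda>q. cnj (f q)) \<circ> chart_inv c = (\<lambda>z. cnj ((f \<circ> chart_inv c) z))" by auto
  then show ?thesis unfolding dlog_def using wirt_cnj[OF d] by simp
qed

lemma dlog_of_real:
  assumes "c \<in> atlas M" "p \<in> fst c" "msmooth f p"
  shows "snd (dlog (\<lambda>q. complex_of_real (f q)) c p) = cnj (fst (dlog (\<lambda>q. complex_of_real (f q)) c p))"
proof -
  let ?d = "dlog (\<lambda>q. complex_of_real (f q)) c p"
  have "?d = (cnj (snd ?d), cnj (fst ?d))"
    using dlog_cnj[OF assms(1,2) msmooth_of_real[OF assms(3)]] unfolding complex_cnj_complex_of_real .
  from arg_cong[OF this, of snd] show ?thesis by (simp only: snd_conv)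
qed

lemma dlog_change:
  assumes "c \<in> atlas M" "d \<in> atlas M" "p \<in> fst c \<inter> fst d" "msmooth f p"
  shows "fst (dlog f c p) = fst (dlog f d p) * dz_ratio c d p \<and>
    snd (dlog f c p) = snd (dlog f d p) * cnj (dz_ratio c d p)"
  using wirt_chart_change[OF assms(1-3), of f] msmoothD[OF assms(4,2)] assms(3)
  by (simp add: dlog_def)

lemma dlog_eventually:
  assumes "c \<in> atlas M" "p \<in> fst c"
  shows "\<forall>\<^sub>F z in nhds (snd c p). (wirt_z (f \<circ> chart_inv c) z / (f \<circ> chart_inv c) z,
      wirt_zbar (f \<circ> chart_inv c) z / (f \<circ> chart_inv c) z) = (dlog f c \<circ> chart_inv c) z"
  using eventually_nhds_in_open[OF open_chart[OF assms(1)], of "snd c p"] assms(2)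
  by (auto elim!: eventually_mono simp: dlog_def chart_inv_chart[OF assms(1)])

lemma dlog_smooth:
  assumes "c \<in> atlas M" "p \<in> fst c" "msmooth f p" "f p \<noteq> 0"
  shows "smooth_at (dlog f c \<circ> chart_inv c) (snd c p)"
proof -
  have f: "smooth_at (f \<circ> chart_inv c) (snd c p)" "(f \<circ> chart_inv c) (snd c p) \<noteq> 0"
    using msmoothD[OF assms(3,1,2)] assms(4) by (simp_all add: chart_inv_chart[OF assms(1,2)])
  have "smooth_at (\<lambda>z. (wirt_z (f \<circ> chart_inv c) z / (f \<circ> chart_inv c) z,
      wirt_zbar (f \<circ> chart_inv c) z / (f \<circ> chart_inv c) z)) (snd c p)"
    by (intro smooth_at_Pair smooth_at_divide smooth_at_wirt f)
  then show ?thesis by (rule smooth_at_cong[OF dlog_eventually[OF assms(1,2)]])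
qed

text \<open>By the quotient rule both sides are a mixed second derivative over F minus the product
  of the two first derivatives over F^2; the mixed derivatives commute. This closedness makes
  curvature independent of the frame and imaginary.\<close>

lemma dlog_closed:
  assumes "c \<in> atlas M" "p \<in> fst c" "msmooth f p" "f p \<noteq> 0"
  shows "wirt_z (snd \<circ> dlog f c \<circ> chart_inv c) (snd c p) = wirt_zbar (fst \<circ> dlog f c \<circ> chart_inv c) (snd c p)"
proof -
  define F where "F = f \<circ> chart_inv c"
  have f: "smooth_at F (snd c p)" "F (snd c p) \<noteq> 0"
    using msmoothD[OF assms(3,1,2)] assms(4) by (simp_all add: F_def chart_inv_chart[OF assms(1,2)])
  note ev = dlog_eventually[OF assms(1,2), of f, folded F_def]
  have 1: "\<forall>\<^sub>F z in nhds (snd c p). (fst \<circ> dlog f c \<circ> chart_inv c) z = wirt_z F z * inverse (F z)"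
    using ev by eventually_elim (metis comp_apply divide_inverse fst_conv)
  have 2: "\<forall>\<^sub>F z in nhds (snd c p). (snd \<circ> dlog f c \<circ> chart_inv c) z = wirt_zbar F z * inverse (F z)"
    using ev by eventually_elim (metis comp_apply divide_inverse snd_conv)
  have d: "F differentiable (at (snd c p))" "wirt_z F differentiable (at (snd c p))"
    "wirt_zbar F differentiable (at (snd c p))" "(\<lambda>z. inverse (F z)) differentiable (at (snd c p))"
    by (intro smooth_at_differentiable smooth_at_wirt smooth_at_inverse f)+
  show ?thesis
    unfolding wirt_cong(2)[OF 1] wirt_cong(1)[OF 2] wirt_mult(1)[OF d(3,4)] wirt_mult(2)[OF d(2,4)]
      wirt_inverse[OF d(1) f(2)] wirt_commute[OF f(1)] by simp
qed

end

locale hermitian_bundle = riemann_metric +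
  fixes L :: "('i, 'a) line_bundle_data" and H :: "'i \<Rightarrow> 'a \<Rightarrow> real"
  assumes line_bundle: "line_bundle M L" and hermitian: "hermitian_metric M L H"
begin

abbreviation "N \<equiv> nbhd L"
abbreviation "g \<equiv> transition L"
abbreviation "Hc i \<equiv> \<lambda>q. complex_of_real (H i q)"

lemma openin_nbhd: "i \<in> idx L \<Longrightarrow> openin X (N i)"
  and nbhd_cover: "(\<Union>i\<in>idx L. N i) = points M"
  using line_bundle unfolding line_bundle_def by blast+

lemma nbhd_subset: "i \<in> idx L \<Longrightarrow> N i \<subseteq> points M"
  using nbhd_cover by blast

lemma g_smooth: "i \<in> idx L \<Longrightarrow> j \<in> idx L \<Longrightarrow> p \<in> N i \<inter> N j \<Longrightarrow> msmooth (g i j) p"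
proof -
  assume ij: "i \<in> idx L" "j \<in> idx L" and p: "p \<in> N i \<inter> N j"
  have "smooth_fun M (N i \<inter> N j) (g i j)"
    using line_bundle ij unfolding line_bundle_def by blast
  then show ?thesis
    using p smooth_fun_iff[OF openin_Int[OF openin_nbhd openin_nbhd]] ij by blast
qed

lemma g_nonzero: "i \<in> idx L \<Longrightarrow> j \<in> idx L \<Longrightarrow> p \<in> N i \<inter> N j \<Longrightarrow> g i j p \<noteq> 0"
  and g_self: "i \<in> idx L \<Longrightarrow> p \<in> N i \<Longrightarrow> g i i p = 1"
  and g_cocycle: "i \<in> idx L \<Longrightarrow> j \<in> idx L \<Longrightarrow> k \<in> idx L \<Longrightarrow> p \<in> N i \<inter> N j \<inter> N k \<Longrightarrow> g i j p * g j k p = g i k p"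
  using line_bundle unfolding line_bundle_def by blast+

lemma H_pos: "i \<in> idx L \<Longrightarrow> p \<in> N i \<Longrightarrow> H i p > 0"
  and H_change: "i \<in> idx L \<Longrightarrow> j \<in> idx L \<Longrightarrow> p \<in> N i \<inter> N j \<Longrightarrow> H j p = (cmod (g i j p))\<^sup>2 * H i p"
  using hermitian unfolding hermitian_metric_def by blast+

lemma H_smooth: "i \<in> idx L \<Longrightarrow> p \<in> N i \<Longrightarrow> msmooth (H i) p"
  using hermitian smooth_fun_iff[OF openin_nbhd] unfolding hermitian_metric_def by blast

lemma triv_at: "p \<in> points M \<Longrightarrow> triv_at L p \<in> idx L \<and> p \<in> N (triv_at L p)"
  unfolding triv_at_def by (rule someI_ex) (use nbhd_cover in blast)

subsection \<open>Existence of a unitary connection\<close>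

text \<open>In the frame \<open>i\<close>, the flat unitary connection that the orthonormalised frame \<open>k\<close> defines.\<close>

definition frame_conn :: "'i \<Rightarrow> 'i \<Rightarrow> 'a form1" where
  "frame_conn k i c p = (1/2) *\<^sub>R dlog (Hc k) c p + dlog (g k i) c p"

lemma frame_conn_smooth:
  assumes "k \<in> idx L" "i \<in> idx L" "c \<in> atlas M" "p \<in> fst c \<inter> (N k \<inter> N i)"
  shows "smooth_at (frame_conn k i c \<circ> chart_inv c) (snd c p)"
proof -
  have "smooth_at (dlog (Hc k) c \<circ> chart_inv c) (snd c p)"
    using assms H_pos[OF assms(1), of p] by (intro dlog_smooth msmooth_of_real H_smooth) auto
  moreover have "smooth_at (dlog (g k i) c \<circ> chart_inv c) (snd c p)"
    using assms g_nonzero[OF assms(1,2), of p] by (intro dlog_smooth g_smooth) auto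
  ultimately have "smooth_at (\<lambda>z. (1/2) *\<^sub>R (dlog (Hc k) c \<circ> chart_inv c) z +
      (dlog (g k i) c \<circ> chart_inv c) z) (snd c p)"
    by (intro smooth_intros)
  then show ?thesis by (simp add: frame_conn_def o_def)
qed

lemma frame_conn_chart_change:
  assumes "k \<in> idx L" "i \<in> idx L" "c \<in> atlas M" "d \<in> atlas M" "p \<in> fst c \<inter> fst d" "p \<in> N k \<inter> N i"
  shows "fst (frame_conn k i c p) = fst (frame_conn k i d p) * dz_ratio c d p \<and>
    snd (frame_conn k i c p) = snd (frame_conn k i d p) * cnj (dz_ratio c d p)"
  using dlog_change[OF assms(3,4,5) msmooth_of_real[OF H_smooth[OF assms(1)]]]
    dlog_change[OF assms(3,4,5) g_smooth[OF assms(1,2,6)]] assms(6)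
  by (simp add: frame_conn_def scaleR_conv_of_real algebra_simps)

text \<open>The term from the metric does not involve the second frame, so only the cocycle g_kj =
  g_ki g_ij is differentiated logarithmically.\<close>

lemma frame_conn_frame_change:
  assumes "k \<in> idx L" "i \<in> idx L" "j \<in> idx L" "c \<in> atlas M" "p \<in> fst c" "p \<in> N k \<inter> N i \<inter> N j"
  shows "frame_conn k j c p = frame_conn k i c p + dlog (g i j) c p"
proof -
  have "openin X (N k \<inter> N i \<inter> N j)" using assms openin_nbhd by (intro openin_Int)
  then have "dlog (g k j) c p = dlog (\<lambda>q. g k i q * g i j q) c p"
    by (rule dlog_cong[OF assms(4,5) _ assms(6)]) (use g_cocycle[OF assms(1-3)] in auto)
  also have "\<dots> = dlog (g k i) c p + dlog (g i j) c p"
    using assms g_nonzero[OF assms(1,2), of p] g_nonzero[OF assms(2,3), of p]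
    by (intro dlog_mult g_smooth) auto
  finally show ?thesis by (simp add: frame_conn_def)
qed

text \<open>The logarithmic differential of H_i = |g_ki|^2 H_k. Adding the conjugate doubles the
  real term, which is the reason for the factor 1/2 in \<open>frame_conn\<close>.\<close>

lemma frame_conn_unitary:
  assumes "k \<in> idx L" "i \<in> idx L" "c \<in> atlas M" "p \<in> fst c" "p \<in> N k \<inter> N i"
  shows "frame_conn k i c p + cnj_form (frame_conn k i) c p = dlog (Hc i) c p"
proof -
  let ?Hk = "\<lambda>q. complex_of_real (H k q)"
  have o: "openin X (N k \<inter> N i)" using assms openin_nbhd by (intro openin_Int)
  have s: "msmooth (g k i) p" "g k i p \<noteq> 0" "msmooth (H k) p" "H k p \<noteq> 0"
    using assms g_smooth g_nonzero H_smooth H_pos[of k p] by auto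
  have "dlog (Hc i) c p = dlog (\<lambda>q. (g k i q * cnj (g k i q)) * ?Hk q) c p"
    by (rule dlog_cong[OF assms(3,4) o assms(5)])
      (simp add: H_change[OF assms(1,2)] complex_norm_square flip: of_real_power)
  also have "\<dots> = dlog (g k i) c p + dlog (\<lambda>q. cnj (g k i q)) c p + dlog ?Hk c p"
    using assms(3,4) s by (simp add: dlog_mult msmooth_mult msmooth_cnj msmooth_of_real)
  finally show ?thesis
    using dlog_of_real[OF assms(3,4) s(3)] dlog_cnj[OF assms(3,4) s(1)]
    by (simp add: frame_conn_def cnj_form_def prod_eq_iff scaleR_conv_of_real)
qed

text \<open>The transition law and unitarity are affine conditions, so they survive averaging of
  local flat connections with weights that sum to 1.\<close>

lemma unitary_connection_exists:
  assumes "compact_space X"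
  shows "unitary_connections M L H \<noteq> {}"
proof -
  have cover: "\<exists>U. openin X U \<and> p \<in> U \<and> (\<exists>k\<in>idx L. U \<subseteq> N k)" if "p \<in> points M" for p
    using that triv_at openin_nbhd by blast
  have "\<exists>I \<theta>. unity_partition (\<lambda>U. \<exists>k\<in>idx L. U \<subseteq> N k) I \<theta>"
    by (rule partition_of_unity[OF assms cover])
  then obtain I \<theta> where pu0: "unity_partition (\<lambda>U. \<exists>k\<in>idx L. U \<subseteq> N k) I \<theta>"
    by blast
  then have sum1: "(\<Sum>i\<in>I. \<theta> i q) = 1" if "q \<in> points M" for q
    using that unfolding unity_partition_def by blast
  have "\<exists>k K. k \<in> idx L \<and> (\<forall>q\<in>points M. msmooth (\<theta> m) q) \<and> closedin X K \<and> K \<subseteq> N k \<and>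
      (\<forall>q\<in>points M - K. \<theta> m q = 0)" if "m \<in> I" for m
  proof -
    obtain U K where "\<exists>k\<in>idx L. U \<subseteq> N k" "closedin X K" "K \<subseteq> U" "\<forall>q\<in>points M - K. \<theta> m q = 0"
      using pu0 \<open>m \<in> I\<close> unfolding unity_partition_def by blast
    moreover have "\<forall>q\<in>points M. msmooth (\<theta> m) q"
      using pu0 \<open>m \<in> I\<close> unfolding unity_partition_def by blast
    ultimately show ?thesis by blast
  qed
  then obtain \<iota> K where pu: "\<And>m. m \<in> I \<Longrightarrow> \<iota> m \<in> idx L \<and> (\<forall>q\<in>points M. msmooth (\<theta> m) q) \<and>
      closedin X (K m) \<and> K m \<subseteq> N (\<iota> m) \<and> (\<forall>q\<in>points M - K m. \<theta> m q = 0)"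
    by metis
  define A where "A = (\<lambda>i c p. if i \<in> idx L \<and> c \<in> atlas M \<and> p \<in> fst c \<inter> N i
     then (\<Sum>m\<in>I. \<theta> m p *\<^sub>R frame_conn (\<iota> m) i c p) else (0, 0))"
  \<comment> \<open>A summand means something only over the frame that it comes from; elsewhere its
    weight is zero, and every pointwise check below splits accordingly.\<close>
  have inN: "p \<in> N (\<iota> m)" if "m \<in> I" "p \<in> points M" "\<theta> m p \<noteq> 0" for m p
    using pu[OF that(1)] that(2,3) by blast
  have one: "A i \<in> one_forms M (N i)" if i: "i \<in> idx L" for i
  proof (rule one_formsI[OF openin_nbhd[OF i]])
    fix c p assume c: "c \<in> atlas M" "p \<in> fst c \<inter> N i"
    have pM: "p \<in> points M" using c chart_subset[OF c(1)] by blast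
    have "smooth_at ((\<lambda>q. \<theta> m q *\<^sub>R frame_conn (\<iota> m) i c q) \<circ> chart_inv c) (snd c p)" if m: "m \<in> I" for m
    proof (cases "p \<in> N (\<iota> m)")
      case True
      have "smooth_at (\<theta> m \<circ> chart_inv c) (snd c p)"
        using pu[OF m] pM c by (intro msmoothD) auto
      moreover have "smooth_at (frame_conn (\<iota> m) i c \<circ> chart_inv c) (snd c p)"
        using pu[OF m] i c True by (intro frame_conn_smooth) auto
      ultimately show ?thesis unfolding o_def by (rule smooth_at_scaleR)
    next
      case False
      have "smooth_at ((\<lambda>q. 0) \<circ> chart_inv c) (snd c p)" unfolding o_def by (rule smooth_at_const)
      then show ?thesis
        by (rule form_smooth_cong[where U = "points M - K m", rotated -1])
          (use pu[OF m] c pM False in \<open>auto simp: openin_diff\<close>)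
    qed
    then have "smooth_at (\<lambda>z. \<Sum>m\<in>I. ((\<lambda>q. \<theta> m q *\<^sub>R frame_conn (\<iota> m) i c q) \<circ> chart_inv c) z) (snd c p)"
      by (rule smooth_at_sum)
    then have "smooth_at ((\<lambda>q. \<Sum>m\<in>I. \<theta> m q *\<^sub>R frame_conn (\<iota> m) i c q) \<circ> chart_inv c) (snd c p)"
      by (simp add: o_def)
    then show "smooth_at (A i c \<circ> chart_inv c) (snd c p)"
      by (rule form_smooth_cong[OF openin_nbhd[OF i] c(1), rotated -1]) (use c i in \<open>auto simp: A_def\<close>)
  next
    fix c d p assume cd: "c \<in> atlas M" "d \<in> atlas M" "p \<in> fst c \<inter> fst d \<inter> N i"
    then have pM: "p \<in> points M" using chart_subset[OF cd(1)] by blast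
    have "fst (\<theta> m p *\<^sub>R frame_conn (\<iota> m) i c p) = fst (\<theta> m p *\<^sub>R frame_conn (\<iota> m) i d p) * dz_ratio c d p \<and>
      snd (\<theta> m p *\<^sub>R frame_conn (\<iota> m) i c p) = snd (\<theta> m p *\<^sub>R frame_conn (\<iota> m) i d p) * cnj (dz_ratio c d p)"
      if m: "m \<in> I" for m
    proof (cases "\<theta> m p = 0")
      case False
      then show ?thesis
        using frame_conn_chart_change[of "\<iota> m" i c d p] inN[OF m pM False] pu[OF m] i cd by simp
    qed simp
    then show "fst (A i c p) = fst (A i d p) * dz_ratio c d p \<and> snd (A i c p) = snd (A i d p) * cnj (dz_ratio c d p)"
      using cd i by (auto simp: A_def fst_sum snd_sum sum_distrib_right intro!: sum.cong)
  qed (auto simp: A_def)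
  have "A \<in> connections M L"
    unfolding connections_def mem_Collect_eq
  proof (intro conjI ballI allI impI)
    fix i j c p assume ij: "i \<in> idx L" "j \<in> idx L" and c: "c \<in> atlas M" and p: "p \<in> N i \<inter> N j \<inter> fst c"
    have pM: "p \<in> points M" using p chart_subset[OF c] by blast
    have "\<theta> m p *\<^sub>R frame_conn (\<iota> m) j c p = \<theta> m p *\<^sub>R frame_conn (\<iota> m) i c p + \<theta> m p *\<^sub>R dlog (g i j) c p"
      if m: "m \<in> I" for m
    proof (cases "\<theta> m p = 0")
      case False
      then show ?thesis
        using frame_conn_frame_change[of "\<iota> m" i j c p] inN[OF m pM False] pu[OF m] ij c p
        by (simp add: scaleR_add_right)
    qed simp
    then have "(\<Sum>m\<in>I. \<theta> m p *\<^sub>R frame_conn (\<iota> m) j c p) =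
        (\<Sum>m\<in>I. \<theta> m p *\<^sub>R frame_conn (\<iota> m) i c p) + (\<Sum>m\<in>I. \<theta> m p) *\<^sub>R dlog (g i j) c p"
      by (simp add: sum.distrib scaleR_sum_left)
    then show "A j c p = A i c p + dlog (g i j) c p"
      using ij c p sum1[OF pM] by (simp add: A_def)
  qed (use one in \<open>auto simp: A_def zero_form_def\<close>)
  moreover have "A i c p + cnj_form (A i) c p = dlog (Hc i) c p"
    if i: "i \<in> idx L" and c: "c \<in> atlas M" and p: "p \<in> N i \<inter> fst c" for i c p
  proof -
    have pM: "p \<in> points M" using p chart_subset[OF c] by blast
    have "\<theta> m p *\<^sub>R frame_conn (\<iota> m) i c p + \<theta> m p *\<^sub>R cnj_form (frame_conn (\<iota> m) i) c p =
        \<theta> m p *\<^sub>R dlog (Hc i) c p"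
      if m: "m \<in> I" for m
    proof (cases "\<theta> m p = 0")
      case False
      then show ?thesis
        using frame_conn_unitary[of "\<iota> m" i c p] inN[OF m pM False] pu[OF m] i c p
        by (simp flip: scaleR_add_right)
    qed simp
    then have "(\<Sum>m\<in>I. \<theta> m p *\<^sub>R frame_conn (\<iota> m) i c p) + (\<Sum>m\<in>I. \<theta> m p *\<^sub>R cnj_form (frame_conn (\<iota> m) i) c p) =
        (\<Sum>m\<in>I. \<theta> m p) *\<^sub>R dlog (Hc i) c p"
      by (simp add: scaleR_sum_left flip: sum.distrib)
    moreover have "cnj_form (A i) c p = (\<Sum>m\<in>I. \<theta> m p *\<^sub>R cnj_form (frame_conn (\<iota> m) i) c p)"
      using i c p by (simp add: cnj_form_def A_def prod_eq_iff fst_sum snd_sum)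
    ultimately show ?thesis using i c p sum1[OF pM] by (simp add: A_def)
  qed
  ultimately have "A \<in> unitary_connections M L H" by (simp add: unitary_connections_def)
  then show ?thesis by blast
qed

section \<open>Curvature of a unitary connection\<close>

lemma connection_one_form: "A \<in> unitary_connections M L H \<Longrightarrow> i \<in> idx L \<Longrightarrow> A i \<in> one_forms M (N i)"
  unfolding unitary_connections_def connections_def by blast

lemma connection_frame_change:
  "A \<in> unitary_connections M L H \<Longrightarrow> i \<in> idx L \<Longrightarrow> j \<in> idx L \<Longrightarrow> c \<in> atlas M \<Longrightarrow> p \<in> N i \<inter> N j \<inter> fst c \<Longrightarrow>
    A j c p = A i c p + dlog (g i j) c p"
  unfolding unitary_connections_def connections_def by blast

lemma connection_unitary:
  "A \<in> unitary_connections M L H \<Longrightarrow> i \<in> idx L \<Longrightarrow> c \<in> atlas M \<Longrightarrow> p \<in> N i \<inter> fst c \<Longrightarrow>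
    A i c p + cnj_form (A i) c p = dlog (Hc i) c p"
  unfolding unitary_connections_def by blast

text \<open>The two connection forms differ by the logarithmic differential of the transition
  function, which is closed. This makes the choice of \<open>triv_at\<close> in
  \<open>curvature\<close> harmless.\<close>

lemma curvature_frame:
  assumes A: "A \<in> unitary_connections M L H" and ij: "i \<in> idx L" "j \<in> idx L"
    and c: "c \<in> atlas M" "p \<in> fst c" "p \<in> N i" "p \<in> N j"
  shows "ext_d M (N i) (A i) c p = ext_d M (N j) (A j) c p"
proof -
  let ?D = "dlog (g i j)"
  have o: "openin X (N i \<inter> N j)" using ij openin_nbhd by (intro openin_Int)
  have ev: "\<forall>\<^sub>F z in nhds (snd c p). chart_inv c z \<in> fst c \<inter> (N i \<inter> N j)"
    using eventually_chart[OF c(1) o c(2)] c by (auto elim!: eventually_mono)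
  have s: "smooth_at (A i c \<circ> chart_inv c) (snd c p)" "smooth_at (?D c \<circ> chart_inv c) (snd c p)"
    using c ij g_nonzero[OF ij, of p]
    by (auto intro!: one_formsD(1)[OF connection_one_form[OF A ij(1)] openin_nbhd[OF ij(1)]] dlog_smooth g_smooth)
  note d = form_differentiable[OF s(1)] form_differentiable[OF s(2)]
  have Aj: "A j c q = A i c q + ?D c q" if "q \<in> fst c \<inter> (N i \<inter> N j)" for q
    using connection_frame_change[OF A ij c(1)] that by blast
  have 1: "\<forall>\<^sub>F z in nhds (snd c p). (fst \<circ> A j c \<circ> chart_inv c) z =
      (fst \<circ> A i c \<circ> chart_inv c) z + (fst \<circ> ?D c \<circ> chart_inv c) z"
    using ev by eventually_elim (simp add: Aj)
  have 2: "\<forall>\<^sub>F z in nhds (snd c p). (snd \<circ> A j c \<circ> chart_inv c) z =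
      (snd \<circ> A i c \<circ> chart_inv c) z + (snd \<circ> ?D c \<circ> chart_inv c) z"
    using ev by eventually_elim (simp add: Aj)
  have "wirt_z (snd \<circ> ?D c \<circ> chart_inv c) (snd c p) = wirt_zbar (fst \<circ> ?D c \<circ> chart_inv c) (snd c p)"
    using c ij by (intro dlog_closed g_smooth g_nonzero) auto
  then show ?thesis
    unfolding ext_d_def wirt_cong(2)[OF 1] wirt_cong(1)[OF 2] wirt_add(1)[OF d(2,4)] wirt_add(2)[OF d(1,3)]
    using c by simp
qed

text \<open>Unitarity makes the sum of the connection form and its conjugate a logarithmic
  differential, hence closed. The curvature is thus imaginary, and an imaginary 2-form has a real
  coefficient with respect to dz \<and> cnj(dz).\<close>

lemma curvature_real:
  assumes A: "A \<in> unitary_connections M L H" and i: "i \<in> idx L"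
    and c: "c \<in> atlas M" "p \<in> fst c" "p \<in> N i"
  shows "cnj (ext_d M (N i) (A i) c p) = ext_d M (N i) (A i) c p"
proof -
  let ?D = "dlog (Hc i)"
  have ev: "\<forall>\<^sub>F z in nhds (snd c p). chart_inv c z \<in> fst c \<inter> N i"
    using eventually_chart[OF c(1) openin_nbhd[OF i] c(2)] c by (auto elim!: eventually_mono)
  have Hs: "msmooth (Hc i) p" "complex_of_real (H i p) \<noteq> 0"
    using H_smooth[OF i c(3)] H_pos[OF i c(3)] by (auto intro: msmooth_of_real)
  have s: "smooth_at (A i c \<circ> chart_inv c) (snd c p)" "smooth_at (?D c \<circ> chart_inv c) (snd c p)"
    using c one_formsD(1)[OF connection_one_form[OF A i] openin_nbhd[OF i]] dlog_smooth[OF c(1,2) Hs]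
    by auto
  define a where "a = fst \<circ> A i c \<circ> chart_inv c"
  define b where "b = snd \<circ> A i c \<circ> chart_inv c"
  have d: "a differentiable (at (snd c p))" "b differentiable (at (snd c p))"
    "(\<lambda>z. cnj (a z)) differentiable (at (snd c p))" "(\<lambda>z. cnj (b z)) differentiable (at (snd c p))"
    using smooth_at_fst[OF s(1)] smooth_at_snd[OF s(1)]
    by (auto simp: a_def b_def o_def intro!: smooth_at_differentiable smooth_at_cnj)
  have D: "?D c q = A i c q + cnj_form (A i) c q" if "q \<in> fst c \<inter> N i" for q
    using connection_unitary[OF A i c(1)] that by simp
  have 1: "\<forall>\<^sub>F z in nhds (snd c p). (fst \<circ> ?D c \<circ> chart_inv c) z = a z + cnj (b z)"
    using ev by eventually_elim (simp add: D cnj_form_def a_def b_def)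
  have 2: "\<forall>\<^sub>F z in nhds (snd c p). (snd \<circ> ?D c \<circ> chart_inv c) z = b z + cnj (a z)"
    using ev by eventually_elim (simp add: D cnj_form_def a_def b_def)
  have "wirt_z b (snd c p) + cnj (wirt_zbar a (snd c p)) = wirt_zbar a (snd c p) + cnj (wirt_z b (snd c p))"
    using dlog_closed[OF c(1,2) Hs]
    unfolding wirt_cong(2)[OF 1] wirt_cong(1)[OF 2] wirt_add(1)[OF d(2,3)] wirt_add(2)[OF d(1,4)]
      wirt_cnj[OF d(1)] wirt_cnj[OF d(2)] .
  moreover have "ext_d M (N i) (A i) c p = wirt_z b (snd c p) - wirt_zbar a (snd c p)"
    using c by (simp add: ext_d_def a_def b_def)
  ultimately show ?thesis by (simp add: diff_eq_eq) (simp add: algebra_simps)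
qed

text \<open>The coefficient of the curvature and h^2 scale by the same squared modulus under a
  change of chart, so their quotient is a function on the surface.\<close>

lemma curvature_density:
  assumes A: "A \<in> unitary_connections M L H"
  shows "\<exists>\<kappa>. (\<forall>p\<in>points M. msmooth \<kappa> p) \<and>
    (\<forall>i\<in>idx L. \<forall>c\<in>atlas M. \<forall>p\<in>fst c \<inter> N i. ext_d M (N i) (A i) c p = complex_of_real (\<kappa> p * (h c p)\<^sup>2))"
proof -
  \<comment> \<open>The selected chart and frame may jump from point to point. \<open>eq\<close>
    shows that the value is independent of them, and smoothness is then checked with both frozen
    near the point.\<close>
  define ch where "ch = (\<lambda>p. SOME c. c \<in> atlas M \<and> p \<in> fst c)"
  have ch: "ch p \<in> atlas M \<and> p \<in> fst (ch p)" if "p \<in> points M" for p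
    unfolding ch_def by (rule someI_ex) (use chart_exists[OF that] in blast)
  define E where "E = (\<lambda>i c p. ext_d M (N i) (A i) c p)"
  define \<kappa> where "\<kappa> = (\<lambda>p. Re (E (triv_at L p) (ch p) p) / (h (ch p) p)\<^sup>2)"
  have eq: "E i c p = complex_of_real (\<kappa> p * (h c p)\<^sup>2)"
    if i: "i \<in> idx L" and c: "c \<in> atlas M" and p: "p \<in> fst c \<inter> N i" for i c p
  proof -
    have pM: "p \<in> points M" using p chart_subset[OF c] by blast
    note t = triv_at[OF pM] and d = ch[OF pM]
    have "E i c p = E (triv_at L p) c p"
      unfolding E_def using t p i c by (intro curvature_frame[OF A]) auto
    also have "\<dots> = E (triv_at L p) (ch p) p * complex_of_real ((cmod (dz_ratio c (ch p) p))\<^sup>2)"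
      unfolding E_def using t d p c
      by (intro ext_d_change[OF connection_one_form[OF A] openin_nbhd]) auto
    also have "E (triv_at L p) (ch p) p = complex_of_real (Re (E (triv_at L p) (ch p) p))"
      using curvature_real[OF A, of "triv_at L p" "ch p" p] t d
      by (simp add: E_def complex_eq_iff)
    also have "\<dots> * complex_of_real ((cmod (dz_ratio c (ch p) p))\<^sup>2) = complex_of_real (\<kappa> p * (h c p)\<^sup>2)"
      using h_change[OF c, of "ch p" p] h_pos[of "ch p" p] d p
      by (simp add: \<kappa>_def power_mult_distrib)
    finally show ?thesis .
  qed
  have "msmooth \<kappa> p" if pM: "p \<in> points M" for p
  proof -
    note t = triv_at[OF pM] and d = ch[OF pM]
    define i where "i = triv_at L p"
    define c where "c = ch p"
    have ic: "i \<in> idx L" "p \<in> N i" "c \<in> atlas M" "p \<in> fst c" using t d by (simp_all add: i_def c_def)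
    have o: "openin X (fst c \<inter> N i)" using ic openin_chart openin_nbhd by (intro openin_Int)
    have s: "smooth_at (A i c \<circ> chart_inv c) (snd c p)"
      using ic by (intro one_formsD(1)[OF connection_one_form[OF A] openin_nbhd]) auto
    have "smooth_at (\<lambda>z. wirt_z (snd \<circ> A i c \<circ> chart_inv c) z - wirt_zbar (fst \<circ> A i c \<circ> chart_inv c) z) (snd c p)"
      using smooth_at_fst[OF s] smooth_at_snd[OF s]
      by (intro smooth_intros smooth_at_wirt) (simp_all add: o_def)
    moreover have "\<forall>\<^sub>F z in nhds (snd c p). wirt_z (snd \<circ> A i c \<circ> chart_inv c) z -
        wirt_zbar (fst \<circ> A i c \<circ> chart_inv c) z = (E i c \<circ> chart_inv c) z"
      using eventually_nhds_in_open[OF open_chart_image[OF ic(3) openin_nbhd[OF ic(1)]], of "snd c p"] ic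
      by (auto elim!: eventually_mono simp: E_def ext_d_def chart_inv_chart[OF ic(3)])
    ultimately have "smooth_at (E i c \<circ> chart_inv c) (snd c p)" by (rule smooth_at_cong[rotated])
    then have "msmooth (E i c) p" using msmooth_chart_iff[OF ic(3,4)] by blast
    then have "msmooth (\<lambda>q. Re (E i c q) / (h c q)\<^sup>2) p"
      using h_smooth[OF ic(3,4)] h_pos[OF ic(3,4)]
      by (intro msmooth_divide msmooth_power msmooth_linear[OF bounded_linear_Re]) auto
    then show ?thesis
    proof (rule msmooth_cong[OF o, rotated -1])
      show "Re (E i c q) / (h c q)\<^sup>2 = \<kappa> q" if q: "q \<in> fst c \<inter> N i" for q
        using eq[OF ic(1,3) q] h_pos[OF ic(3), of q] q by simp
    qed (use ic in blast)
  qed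
  then show ?thesis using eq unfolding E_def by blast
qed

subsection \<open>Sections supported in a coordinate disc\<close>

definition frame_section :: "'i \<Rightarrow> ('a \<Rightarrow> complex) \<Rightarrow> ('i, 'a) bsection" where
  "frame_section k u i p = (if i \<in> idx L \<and> p \<in> N i \<inter> N k then g i k p * u p else 0)"

text \<open>Over any frame, the overlap with \<open>N k\<close> and the complement of the closed
  \<open>K\<close> are open and together cover; the section is g_ik u on the former and zero on the
  latter.\<close>

lemma frame_section_in:
  assumes k: "k \<in> idx L" and K: "closedin X K" "K \<subseteq> N k"
    and u: "\<And>p. p \<in> N k \<Longrightarrow> msmooth u p" "\<And>p. p \<in> points M - K \<Longrightarrow> u p = 0"
  shows "frame_section k u \<in> sections M L"
  unfolding sections_def mem_Collect_eq
proof (intro conjI ballI allI impI)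
  fix i assume i: "i \<in> idx L"
  have "msmooth (frame_section k u i) p" if p: "p \<in> N i" for p
  proof (cases "p \<in> N k")
    case True
    have "msmooth (\<lambda>q. g i k q * u q) p" using i k p True u by (intro msmooth_mult g_smooth) auto
    then show ?thesis
      by (rule msmooth_cong[where U = "N i \<inter> N k", rotated -1])
        (use i k p True openin_nbhd in \<open>auto simp: frame_section_def\<close>)
  next
    case False
    have "msmooth (\<lambda>q. 0 :: complex) p" by (rule msmooth_const)
    then show ?thesis
      by (rule msmooth_cong[where U = "points M - K", rotated -1])
        (use i p False K u(2) nbhd_subset[OF i] in \<open>auto simp: frame_section_def openin_diff\<close>)
  qed
  then show "smooth_fun M (N i) (frame_section k u i)" using smooth_fun_iff[OF openin_nbhd[OF i]] by blast
next
  fix i j p assume ij: "i \<in> idx L" "j \<in> idx L" "p \<in> N i \<inter> N j"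
  then show "frame_section k u i p = g i j p * frame_section k u j p"
    using g_cocycle[of i j k p] k by (auto simp: frame_section_def)
qed (auto simp: frame_section_def)

lemma herm_frame_section:
  assumes k: "k \<in> idx L" and p: "p \<in> points M"
  shows "herm L H (frame_section k u) (frame_section k v) p =
    (if p \<in> N k then complex_of_real (H k p) * u p * cnj (v p) else 0)"
  using triv_at[OF p] H_change[of "triv_at L p" k p] k
  by (simp add: herm_def Let_def frame_section_def complex_norm_square flip: of_real_power)

text \<open>Unitary connections form an affine space over the imaginary 1-forms: a global form
  leaves the transition law unchanged, and it cancels against its conjugate in the condition of
  unitarity.\<close>

lemma unitary_connection_diff:
  assumes A: "A \<in> unitary_connections M L H" and \<alpha>: "\<alpha> \<in> imaginary_forms M"
  shows "(\<lambda>i c p. if i \<in> idx L \<and> p \<in> N i then A i c p - \<alpha> c p else (0, 0)) \<in> unitary_connections M L H"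
    (is "?B \<in> _")
proof -
  have one: "?B i \<in> one_forms M (N i)" if i: "i \<in> idx L" for i
    using one_forms_lincomb[OF connection_one_form[OF A i] imaginary_one_form[OF \<alpha>] openin_nbhd[OF i]
        openin_topspace nbhd_subset[OF i], of "-1"] i by (simp cong: if_cong)
  have im: "\<alpha> c p + cnj_form \<alpha> c p = 0" for c p
  proof -
    have "snd (\<alpha> c p) = - cnj (fst (\<alpha> c p))" using \<alpha> unfolding imaginary_forms_def by blast
    then show ?thesis by (simp add: cnj_form_def prod_eq_iff)
  qed
  have "?B \<in> connections M L"
    unfolding connections_def mem_Collect_eq
  proof (intro conjI ballI allI impI)
    show "?B i = zero_form" if "i \<notin> idx L" for i using that by (simp add: zero_form_def)
    show "?B j c p = ?B i c p + dlog (g i j) c p"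
      if "i \<in> idx L" "j \<in> idx L" "c \<in> atlas M" "p \<in> N i \<inter> N j \<inter> fst c" for i j c p
      using connection_frame_change[OF A that] that by simp
  qed (rule one)
  moreover have "?B i c p + cnj_form (?B i) c p = dlog (Hc i) c p"
    if "i \<in> idx L" "c \<in> atlas M" "p \<in> N i \<inter> fst c" for i c p
    using connection_unitary[OF A that] im[of c p] that
    by (simp add: cnj_form_def prod_eq_iff algebra_simps)
  ultimately show ?thesis by (simp add: unitary_connections_def)
qed

lemma hnorm_power2: "p \<in> points M \<Longrightarrow> (hnorm L H s p)\<^sup>2 = Re (herm L H s s p)"
proof -
  assume p: "p \<in> points M"
  let ?i = "triv_at L p"
  have "herm L H s s p = complex_of_real (H ?i p * (cmod (s ?i p))\<^sup>2)"
    by (simp add: herm_def Let_def complex_norm_square mult.assoc flip: of_real_power)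
  then show ?thesis using triv_at[OF p] H_pos[of ?i p] by (simp add: hnorm_def)
qed

text \<open>The derivative of \<open>flat_exp 1 0\<close> is \<open>flat_exp 1 2\<close>, and here
  is a smooth square root of it: exponent and power are halved, so no root has to be taken where the
  function vanishes.\<close>

lemma flat_exp_square: "(flat_exp (1/2) 1 x)\<^sup>2 = flat_exp 1 2 x"
  by (simp add: flat_exp_def power_mult_distrib exp_double[symmetric] flip: exp_add)

text \<open>In a disc of radius \<open>r\<close> with coordinate \<open>\<zeta>\<close> and \<open>x = r\<^sup>2 - \<bar>\<zeta>\<bar>\<^sup>2\<close>, the form
  \<open>\<phi> = (\<lambda>\<mu>/2) \<zeta> exp (-1/x)\<close> satisfies \<open>-2 \<partial>\<phi>/\<partial>(cnj \<zeta>) = \<lambda>\<mu> \<zeta>\<^sup>2 k\<^sup>2\<close> with \<open>k = exp (-1/(2x)) / x\<close>. This is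
  the product of \<open>\<lambda> \<zeta> k\<close> and the conjugate of \<open>\<mu> (cnj \<zeta>) k\<close>, and the difference of the squared norms of these two,
  \<open>(\<lambda>\<^sup>2 - \<mu>\<^sup>2) \<bar>\<zeta>\<bar>\<^sup>2 k\<^sup>2\<close>, can be made any real multiple of a fixed nonnegative function.\<close>

lemma disc_pair_dbar:
  fixes z0 :: complex and r m :: real
  defines "x \<equiv> \<lambda>z. r\<^sup>2 - (cmod (z - z0))\<^sup>2"
  shows "wirt_zbar (\<lambda>z. complex_of_real (m * flat_exp 1 0 (x z)) * (z - z0)) z =
    - complex_of_real (m * flat_exp 1 2 (x z)) * (z - z0)\<^sup>2"
proof -
  let ?w = "z - z0" and ?a = "complex_of_real (m * flat_exp 1 0 (x z))" and ?b = "complex_of_real (m * flat_exp 1 2 (x z))"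
  have x: "((\<lambda>z. x z) has_derivative (\<lambda>v. - (2 * ((z - z0) \<bullet> v)))) (at z)"
    unfolding x_def power2_norm_eq_inner
    by (auto intro!: derivative_eq_intros simp: inner_commute)
  have "(flat_exp 1 0 has_derivative (\<lambda>t. flat_exp 1 2 (x z) * t)) (at (x z))"
    using flat_exp_has_derivative[of 1 0 "x z"] by (simp add: has_field_derivative_def numeral_2_eq_2)
  from has_derivative_compose[OF x this]
  have "((\<lambda>z. flat_exp 1 0 (x z)) has_derivative (\<lambda>v. flat_exp 1 2 (x z) * - (2 * ((z - z0) \<bullet> v)))) (at z)" .
  then have "((\<lambda>z. complex_of_real (m * flat_exp 1 0 (x z)) * (z - z0)) has_derivative
     (\<lambda>v. ?a * v + complex_of_real (m * (flat_exp 1 2 (x z) * - (2 * (?w \<bullet> v)))) * ?w)) (at z)"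
    by (auto intro!: derivative_eq_intros)
  also have "(\<lambda>v. ?a * v + complex_of_real (m * (flat_exp 1 2 (x z) * - (2 * (?w \<bullet> v)))) * ?w) =
     (\<lambda>v. (?a - ?b * cnj ?w * ?w) * v + (- ?b * ?w\<^sup>2) * cnj v)"
  proof
    fix v
    \<comment> \<open>The real inner product is written through \<open>v\<close> and
      \<open>cnj v\<close> so that the antilinear part can be read off.\<close>
    have ip: "complex_of_real (2 * (?w \<bullet> v)) = ?w * cnj v + cnj ?w * v"
      by (simp add: inner_complex_def complex_eq_iff algebra_simps)
    have "complex_of_real (m * (flat_exp 1 2 (x z) * - (2 * (?w \<bullet> v)))) = - ?b * complex_of_real (2 * (?w \<bullet> v))"
      by simp
    then have e: "complex_of_real (m * (flat_exp 1 2 (x z) * - (2 * (?w \<bullet> v)))) = - ?b * (?w * cnj v + cnj ?w * v)"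
      unfolding ip .
    have alg: "s * v + - t * (w * cnj v + cnj w * v) * w = (s - t * cnj w * w) * v + (- t * w\<^sup>2) * cnj v"
      for s t w by (simp add: algebra_simps power2_eq_square)
    show "?a * v + complex_of_real (m * (flat_exp 1 2 (x z) * - (2 * (?w \<bullet> v)))) * ?w =
      (?a - ?b * cnj ?w * ?w) * v + (- ?b * ?w\<^sup>2) * cnj v"
      unfolding e by (rule alg)
  qed
  finally show ?thesis by (rule wirt_unique(2))
qed

lemma nontrivial_solution_exists:
  assumes "compact_space X" "points M \<noteq> {}"
  shows "\<exists>A \<Psi> \<Phi>. solution M h L H (A, \<Psi>, \<Phi>) \<and> nonzero_pair \<Psi> \<and> \<Phi> \<noteq> zero_form"
proof -
  obtain p0 where p0: "p0 \<in> points M" using assms(2) by blast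
  obtain c where c: "c \<in> atlas M" "p0 \<in> fst c" using chart_exists[OF p0] by blast
  define k where "k = triv_at L p0"
  have k: "k \<in> idx L" "p0 \<in> N k" using triv_at[OF p0] by (simp_all add: k_def)
  define z0 where "z0 = snd c p0"
  have oV: "open (snd c ` (fst c \<inter> N k))" by (rule open_chart_image[OF c(1) openin_nbhd[OF k(1)]])
  have "z0 \<in> snd c ` (fst c \<inter> N k)" using c k by (simp add: z0_def)
  then obtain a b where ab: "z0 \<in> box a b" "cbox a b \<subseteq> snd c ` (fst c \<inter> N k)"
    using oV by (meson open_contains_cbox)
  \<comment> \<open>The rectangle serves the Poincare lemma, the disc inside it the explicit
    sections; both lie within the chart and one trivialising set.\<close>
  obtain r where r: "r > 0" "cball z0 r \<subseteq> box a b"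
    using ab(1) open_contains_cball[of "box a b"] open_box by blast
  have Dbox: "cball z0 r \<subseteq> cbox a b" using r(2) box_subset_cbox by blast
  have boxV: "cbox a b \<subseteq> snd c ` fst c" using ab(2) by blast
  have DV: "cball z0 r \<subseteq> snd c ` fst c" using Dbox boxV by blast
  define K where "K = chart_inv c ` cball z0 r"
  have K: "closedin X K" unfolding K_def by (rule closedin_chart_inv_image[OF c(1) compact_cball DV])
  have Kc: "K \<subseteq> fst c" unfolding K_def by (rule chart_inv_image[OF DV])
  have KN: "K \<subseteq> N k"
  proof
    fix p assume "p \<in> K"
    then obtain z where z: "z \<in> cball z0 r" "p = chart_inv c z" by (auto simp: K_def)
    then obtain q where q: "q \<in> fst c \<inter> N k" "z = snd c q" using Dbox ab(2) by blast
    then have "p = q" using z(2) chart_inv_chart[OF c(1)] by simp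
    then show "p \<in> N k" using q(1) by blast
  qed
  define x where "x = (\<lambda>z. r\<^sup>2 - (cmod (z - z0))\<^sup>2)"
  have x_le: "x z \<le> 0" if "z \<notin> cball z0 r" for z
    using outside_cball[OF r(1) that] by (simp add: x_def)
  have x_smooth: "smooth_at x z" for z unfolding x_def by (intro smooth_intros smooth_at_norm_sq)
  define \<kappa> where "\<kappa> = (\<lambda>z. flat_exp (1/2) 1 (x z))"
  have \<kappa>0: "\<kappa> z = 0" if "z \<notin> cball z0 r" for z using x_le[OF that] by (simp add: \<kappa>_def flat_exp_def)
  have \<kappa>_smooth: "smooth_at \<kappa> z" for z unfolding \<kappa>_def by (intro smooth_intros x_smooth) simp
  \<comment> \<open>The common shape of both squared norms. Division by h^2 makes it a density
    relative to the metric, and \<open>chart_ext\<close> makes it vanish off the disc.\<close>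
  define \<tau> where "\<tau> = (\<lambda>p. chart_ext c (\<lambda>z. (\<kappa> z)\<^sup>2 * (cmod (z - z0))\<^sup>2) p / (h c p)\<^sup>2)"
  have outK: "chart_ext c f p = 0" if "\<forall>z. z \<notin> cball z0 r \<longrightarrow> f z = 0" "p \<notin> K"
    for f :: "complex \<Rightarrow> 'b::real_normed_vector" and p
    by (rule chart_ext_outside[OF c(1), of "cball z0 r"]) (use that in \<open>auto simp: K_def\<close>)
  have ext_smooth: "msmooth (chart_ext c f) p" if "\<forall>z. z \<notin> cball z0 r \<longrightarrow> f z = 0" "\<And>z. smooth_at f z" "p \<in> points M"
    for f :: "complex \<Rightarrow> 'b::real_normed_vector" and p
    by (rule msmooth_chart_ext[OF c(1) compact_cball DV _ _ that(3)]) (use that in auto)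
  have oK: "openin X (points M - K)" using K by (simp add: openin_diff)
  have \<tau>0: "\<tau> p = 0" if "p \<notin> K" for p
    unfolding \<tau>_def by (subst outK) (use that \<kappa>0 in auto)
  have \<tau>_smooth: "msmooth \<tau> p" if p: "p \<in> points M" for p
  proof (cases "p \<in> fst c")
    case True
    have "msmooth (chart_ext c (\<lambda>z. (\<kappa> z)\<^sup>2 * (cmod (z - z0))\<^sup>2)) p"
      by (rule ext_smooth) (auto simp: \<kappa>0 p intro!: smooth_at_mult smooth_at_power \<kappa>_smooth smooth_at_norm_sq)
    then show ?thesis
      unfolding \<tau>_def using h_smooth[OF c(1) True] h_pos[OF c(1) True]
      by (intro msmooth_divide msmooth_power) auto
  next
    case False
    show ?thesis
      by (rule msmooth_cong[OF oK _ _ msmooth_const[of 0]]) (use p False Kc \<tau>0 in auto)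
  qed
  \<comment> \<open>A point off the centre: the factor \<zeta> makes \<tau>, both sections and
    \<phi> vanish at the centre itself.\<close>
  define q where "q = chart_inv c (z0 + of_real (r/2))"
  have zq: "z0 + of_real (r/2) \<in> cball z0 r" using r(1) by (simp add: dist_norm)
  have q: "q \<in> fst c" "snd c q = z0 + of_real (r/2)" "q \<in> K"
    unfolding q_def K_def using chart_inv_in[of _ c] chart_chart_inv[of _ c] subsetD[OF DV zq] zq by auto
  have qM: "q \<in> points M" using q(1) chart_subset[OF c(1)] by blast
  have xq: "x (snd c q) > 0" using r(1) by (simp add: x_def q(2) power2_eq_square norm_divide)
  then have \<kappa>q: "\<kappa> (snd c q) > 0" by (simp add: \<kappa>_def flat_exp_def)
  have \<zeta>q: "snd c q - z0 \<noteq> 0" using r(1) by (simp add: q(2))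
  have \<tau>q: "\<tau> q > 0"
    using \<kappa>q \<zeta>q h_pos[OF c(1) q(1)] q(1) by (simp add: \<tau>_def chart_ext_def)
  have ab_lt: "Re a < Re b" "Im a < Im b" using ab(1) by (auto simp: in_box_complex_iff)
  have \<tau>_box: "\<tau> p = 0" if "p \<notin> chart_inv c ` cbox a b" for p
    using \<tau>0[of p] that Dbox by (auto simp: K_def)
  obtain A0 where A0: "A0 \<in> unitary_connections M L H"
    using unitary_connection_exists[OF assms(1)] by blast
  obtain \<kappa>0' where F0: "\<And>p. p \<in> points M \<Longrightarrow> msmooth \<kappa>0' p"
    "\<And>i d p. i \<in> idx L \<Longrightarrow> d \<in> atlas M \<Longrightarrow> p \<in> fst d \<inter> N i \<Longrightarrow>
      ext_d M (N i) (A0 i) d p = complex_of_real (\<kappa>0' p * (h d p)\<^sup>2)"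
    using curvature_density[OF A0] by blast
  have "\<exists>\<rho>. area_exact (\<lambda>p. \<kappa>0' p - \<rho> * \<tau> p)"
    by (rule area_exact_modulo[OF assms(1) c(1) ab_lt boxV \<tau>_smooth \<tau>_box _ q(1) _ \<tau>q F0(1)])
      (use r(2) zq q(2) in \<open>auto simp: \<tau>_def chart_ext_def\<close>)
  then obtain \<rho> \<alpha> where \<alpha>: "\<alpha> \<in> imaginary_forms M"
    "\<And>d p. d \<in> atlas M \<Longrightarrow> p \<in> fst d \<Longrightarrow>
      ext_d M (points M) \<alpha> d p = complex_of_real ((\<kappa>0' p - \<rho> * \<tau> p) * (h d p)\<^sup>2)"
    unfolding area_exact_def by blast
  define A where "A = (\<lambda>i c p. if i \<in> idx L \<and> p \<in> N i then A0 i c p - \<alpha> c p else (0, 0))"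
  have A: "A \<in> unitary_connections M L H" unfolding A_def by (rule unitary_connection_diff[OF A0 \<alpha>(1)])
  have curv: "curvature M L A d p = complex_of_real (\<rho> * \<tau> p * (h d p)\<^sup>2)"
    if d: "d \<in> atlas M" "p \<in> fst d" for d p
  proof -
    have "p \<in> points M" using d chart_subset[of d] by blast
    note i = triv_at[OF this]
    have "A (triv_at L p) = (\<lambda>c q. if q \<in> N (triv_at L p) then A0 (triv_at L p) c q + (-1) *\<^sub>R \<alpha> c q else (0, 0))"
      using i by (simp add: A_def fun_eq_iff cong: if_cong)
    then have "ext_d M (N (triv_at L p)) (A (triv_at L p)) d p =
        ext_d M (N (triv_at L p)) (A0 (triv_at L p)) d p + of_real (-1) * ext_d M (points M) \<alpha> d p"
      using i d ext_d_lincomb[OF connection_one_form[OF A0] imaginary_one_form[OF \<alpha>(1)] openin_nbhd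
          openin_topspace nbhd_subset, of "triv_at L p" d p "-1"] by simp
    then show ?thesis
      using F0(2)[of "triv_at L p" d p] \<alpha>(2)[OF d] i d by (simp add: curvature_def algebra_simps)
  qed
  \<comment> \<open>The product of i/2 with the i of the area form is -1/2, hence the difference 2
    \<rho>. Both amplitudes must be positive, since \<phi> carries their product and has to be
    nonzero.\<close>
  obtain l1 l2 :: real where l: "l1 > 0" "l2 > 0" "l2\<^sup>2 - l1\<^sup>2 = 2 * \<rho>"
  proof (cases "\<rho> \<ge> 0")
    case True
    then show ?thesis by (intro that[of 1 "sqrt (1 + 2 * \<rho>)"]) auto
  next
    case False
    then show ?thesis by (intro that[of "sqrt (1 - 2 * \<rho>)" 1]) auto
  qed
  define f1 where "f1 = (\<lambda>z. complex_of_real (l1 * \<kappa> z) * (z - z0))"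
  define f2 where "f2 = (\<lambda>z. complex_of_real (l2 * \<kappa> z) * cnj (z - z0))"
  \<comment> \<open>Division by h and by the root of the fibre metric turns the pairing of two such
    sections into \<open>f * cnj f'\<close> over h^2; the h^2 of the area form then cancels.\<close>
  define u where "u = (\<lambda>f p. chart_ext c f p / complex_of_real (h c p * sqrt (H k p)))"
  define \<psi>1 where "\<psi>1 = frame_section k (u f1)"
  define \<psi>2 where "\<psi>2 = frame_section k (u f2)"
  have f12: "\<forall>z. z \<notin> cball z0 r \<longrightarrow> f1 z = 0" "\<forall>z. z \<notin> cball z0 r \<longrightarrow> f2 z = 0"
    using \<kappa>0 by (simp_all add: f1_def f2_def)
  have f12_smooth: "smooth_at f1 z" "smooth_at f2 z" for z
    unfolding f1_def f2_def by (intro smooth_intros \<kappa>_smooth)+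
  have sect: "frame_section k (u f) \<in> sections M L"
    if f: "\<forall>z. z \<notin> cball z0 r \<longrightarrow> f z = 0" "\<And>z. smooth_at f z" for f
  proof (rule frame_section_in[OF k(1) K KN])
    show "u f p = 0" if "p \<in> points M - K" for p using outK[OF f(1)] that by (simp add: u_def)
    fix p assume p: "p \<in> N k"
    then have pM: "p \<in> points M" using nbhd_subset[OF k(1)] by blast
    show "msmooth (u f) p"
    proof (cases "p \<in> fst c")
      case True
      then show ?thesis
        unfolding u_def using h_smooth[OF c(1) True] h_pos[OF c(1) True] H_smooth[OF k(1) p] H_pos[OF k(1) p]
        by (intro msmooth_divide msmooth_of_real msmooth_mult msmooth_sqrt ext_smooth f pM) auto
    next
      case False
      show ?thesis
        by (rule msmooth_cong[OF oK _ _ msmooth_const[of 0]]) (use pM False Kc outK[OF f(1)] in \<open>auto simp: u_def\<close>)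
    qed
  qed
  have herm_u: "herm L H (frame_section k (u f)) (frame_section k (u f')) p =
      (if p \<in> fst c then f (snd c p) * cnj (f' (snd c p)) / complex_of_real ((h c p)\<^sup>2) else 0)"
    if f: "\<forall>z. z \<notin> cball z0 r \<longrightarrow> f z = 0" and p: "p \<in> points M" for f f' p
  proof (cases "p \<in> K")
    case True
    then have pk: "p \<in> N k" "p \<in> fst c" using KN Kc by blast+
    have "complex_of_real (H k p) = complex_of_real (sqrt (H k p)) * complex_of_real (sqrt (H k p))"
      using H_pos[OF k(1) pk(1)] by (simp flip: of_real_mult)
    then show ?thesis
      using pk H_pos[OF k(1) pk(1)] h_pos[OF c(1) pk(2)]
      by (simp add: herm_frame_section[OF k(1) p] u_def chart_ext_def power2_eq_square)
  next
    case False
    then have "chart_ext c f p = 0" using outK[OF f] by blast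
    then show ?thesis
      by (auto simp: herm_frame_section[OF k(1) p] u_def chart_ext_def)
  qed
  have norm1: "(hnorm L H \<psi>1 p)\<^sup>2 = l1\<^sup>2 * \<tau> p" and norm2: "(hnorm L H \<psi>2 p)\<^sup>2 = l2\<^sup>2 * \<tau> p"
    if p: "p \<in> points M" for p
  proof -
    have "f1 z * cnj (f1 z) = complex_of_real (l1\<^sup>2 * ((\<kappa> z)\<^sup>2 * (cmod (z - z0))\<^sup>2))"
      "f2 z * cnj (f2 z) = complex_of_real (l2\<^sup>2 * ((\<kappa> z)\<^sup>2 * (cmod (z - z0))\<^sup>2))" for z
      by (simp_all add: complex_norm_square[symmetric] f1_def f2_def norm_mult power_mult_distrib del: complex_cnj_mult complex_cnj_diff)
    then show "(hnorm L H \<psi>1 p)\<^sup>2 = l1\<^sup>2 * \<tau> p" "(hnorm L H \<psi>2 p)\<^sup>2 = l2\<^sup>2 * \<tau> p"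
      unfolding hnorm_power2[OF p] \<psi>1_def \<psi>2_def
      by (simp_all add: herm_u[OF f12(1) p] herm_u[OF f12(2) p] \<tau>_def chart_ext_def flip: of_real_divide of_real_mult of_real_power)
  qed
  define \<phi> where "\<phi> = (\<lambda>z. complex_of_real (l1 * l2 / 2 * flat_exp 1 0 (x z)) * (z - z0))"
  have \<phi>0: "\<phi> z = 0" if "z \<notin> cball z0 r" for z using x_le[OF that] by (simp add: \<phi>_def flat_exp_def)
  have \<phi>_smooth: "smooth_at \<phi> z" for z unfolding \<phi>_def by (intro smooth_intros x_smooth) simp
  \<comment> \<open>The value -1/2 cancels the factor 2 of the equation and the minus sign in
    \<open>dbar\<close>; on the other side -i meets the i of the area form.\<close>
  have \<phi>_dbar: "wirt_zbar \<phi> z = - (f1 z * cnj (f2 z)) / 2" for z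
    unfolding \<phi>_def x_def disc_pair_dbar
    by (simp add: f1_def f2_def \<kappa>_def x_def power2_eq_square flip: flat_exp_square)
  define \<Phi> where "\<Phi> = chart_form c \<phi>"
  have \<Phi>: "\<Phi> \<in> imaginary_forms M"
    unfolding \<Phi>_def by (rule chart_form_imaginary[OF c(1) compact_cball DV]) (use \<phi>0 \<phi>_smooth in auto)
  have "solution M h L H (A, (\<psi>1, \<psi>2), \<Phi>)"
    unfolding solution_def prod.case
  proof (intro conjI ext)
    show "(A, (\<psi>1, \<psi>2), \<Phi>) \<in> configs M L H"
      using A \<Phi> sect[OF f12(1) f12_smooth(1)] sect[OF f12(2) f12_smooth(2)]
      by (simp add: configs_def \<psi>1_def \<psi>2_def)
    fix d p
    show "curvature M L A d p = \<i> / 2 * complex_of_real ((hnorm L H \<psi>1 p)\<^sup>2 - (hnorm L H \<psi>2 p)\<^sup>2) * area_form M h d p"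
    proof (cases "d \<in> atlas M \<and> p \<in> fst d")
      case True
      then have p: "p \<in> points M" using chart_subset by blast
      have r: "\<rho> = (l2\<^sup>2 - l1\<^sup>2) / 2" using l(3) by simp
      have e: "\<rho> * \<tau> p = - (l1\<^sup>2 * \<tau> p - l2\<^sup>2 * \<tau> p) / 2" unfolding r by (simp add: algebra_simps)
      have ii: "\<i> / 2 * complex_of_real s * (\<i> * complex_of_real t) = complex_of_real (- s / 2 * t)" for s t
        by (simp add: complex_eq_iff)
      have area: "area_form M h d p = \<i> * complex_of_real ((h d p)\<^sup>2)" using True by (simp add: area_form_def)
      show ?thesis
        unfolding norm1[OF p] norm2[OF p] area curv[OF conjunct1[OF True] conjunct2[OF True]] e by (rule ii[symmetric])
    qed (auto simp: curvature_def ext_d_def area_form_def Let_def)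
    show "2 * dbar M \<Phi> d p = - \<i> * herm_form M h L H (\<psi>1, \<psi>2) d p"
    proof (cases "d \<in> atlas M \<and> p \<in> fst d")
      case True
      then have p: "p \<in> points M" using chart_subset by blast
      have "dbar M \<Phi> d p = (if p \<in> fst c then - wirt_zbar \<phi> (snd c p) * of_real ((cmod (dz_ratio d c p))\<^sup>2) else 0)"
        unfolding \<Phi>_def by (rule chart_form_derivs(2)[OF c(1) compact_cball DV]) (use \<phi>0 \<phi>_smooth True in auto)
      then have d: "2 * dbar M \<Phi> d p =
          (if p \<in> fst c then f1 (snd c p) * cnj (f2 (snd c p)) * of_real ((cmod (dz_ratio d c p))\<^sup>2) else 0)"
        by (simp add: \<phi>_dbar)
      have ii: "- \<i> * (s * (\<i> * t)) = s * t" for s t by (simp add: complex_eq_iff)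
      have "herm_form M h L H (\<psi>1, \<psi>2) d p = herm L H \<psi>1 \<psi>2 p * (\<i> * complex_of_real ((h d p)\<^sup>2))"
        using True by (simp add: herm_form_def area_form_def)
      then have "- \<i> * herm_form M h L H (\<psi>1, \<psi>2) d p = herm L H \<psi>1 \<psi>2 p * complex_of_real ((h d p)\<^sup>2)"
        by (simp only: ii)
      also have "\<dots> = 2 * dbar M \<Phi> d p"
      proof (cases "p \<in> fst c")
        case pc: True
        have "h d p = h c p * cmod (dz_ratio d c p)" "h c p > 0"
          using h_change[of d c p] h_pos[OF c(1) pc] True pc c(1) by auto
        then show ?thesis
          using pc by (simp add: d \<psi>1_def \<psi>2_def herm_u[OF f12(1) p] power_mult_distrib)
      qed (simp add: d \<psi>1_def \<psi>2_def herm_u[OF f12(1) p])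
      finally show ?thesis by simp
    qed (auto simp: dbar_def herm_form_def area_form_def)
  qed
  moreover have "\<psi>1 k q \<noteq> 0"
    using q KN k(1) g_self[OF k(1), of q] l(1) \<kappa>q \<zeta>q h_pos[OF c(1) q(1)] H_pos[OF k(1), of q]
    by (auto simp: \<psi>1_def frame_section_def u_def chart_ext_def f1_def)
  then have "nonzero_pair (\<psi>1, \<psi>2)" by (auto simp: nonzero_pair_def zero_section_def)
  moreover have "fst (\<Phi> c q) \<noteq> 0"
    using q(1) c(1) l \<zeta>q xq dz_ratio_self[OF c(1) q(1)] by (simp add: \<Phi>_def chart_form_def \<phi>_def flat_exp_def)
  then have "\<Phi> \<noteq> zero_form" by (auto simp: zero_form_def)
  ultimately show ?thesis by blast
qed

section \<open>Consequences for the moduli spaces\<close>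

lemma gauge_quotient_nonempty: "S \<noteq> {} \<Longrightarrow> gauge_quotient M L S \<noteq> {}"
  by (auto simp: gauge_quotient_def quotient_def)

text \<open>Dividing the second equation by -i gives the primitive 2 i \<Phi>, of which
  \<open>dbar\<close> sees only the (1,0)-part; that part alone is a form of the required
  type.\<close>

lemma solution_dbar_exact:
  assumes "solution M h L H (A, \<Psi>, \<Phi>)"
  shows "dbar_exact M (herm_form M h L H \<Psi>)"
proof -
  obtain \<psi>1 \<psi>2 where \<Psi>: "\<Psi> = (\<psi>1, \<psi>2)" by fastforce
  have im: "\<Phi> \<in> imaginary_forms M"
    and eq: "\<And>c p. 2 * dbar M \<Phi> c p = - \<i> * herm_form M h L H \<Psi> c p"
    using assms by (auto simp: \<Psi> solution_def configs_def dest: fun_cong)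
  note one = imaginary_one_form[OF im]
  define \<eta> where "\<eta> = (\<lambda>c p. (2 * \<i> * fst (\<Phi> c p), 0 :: complex))"
  have "\<eta> \<in> one_forms M (points M)"
  proof (rule one_formsI[OF openin_topspace])
    fix c p assume c: "c \<in> atlas M" "p \<in> fst c \<inter> points M"
    have "smooth_at (\<lambda>z. (2 * \<i> * fst ((\<Phi> c \<circ> chart_inv c) z), 0 :: complex)) (snd c p)"
      by (intro smooth_intros one_formsD(1)[OF one openin_topspace c])
    then show "smooth_at (\<eta> c \<circ> chart_inv c) (snd c p)" by (simp add: \<eta>_def o_def)
  next
    fix c d p assume "c \<in> atlas M" "d \<in> atlas M" "p \<in> fst c \<inter> fst d \<inter> points M"
    then show "fst (\<eta> c p) = fst (\<eta> d p) * dz_ratio c d p \<and> snd (\<eta> c p) = snd (\<eta> d p) * cnj (dz_ratio c d p)"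
      using one_formsD(2)[OF one openin_topspace, of c p d] by (simp add: \<eta>_def)
  next
    fix c p assume "\<not> (c \<in> atlas M \<and> p \<in> fst c \<inter> points M)"
    then show "\<eta> c p = (0, 0)" using one_forms_zero[OF one, of c p] by (simp add: \<eta>_def)
  qed
  then have "\<eta> \<in> forms_10 M" by (simp add: forms_10_def \<eta>_def)
  moreover have "herm_form M h L H \<Psi> = dbar M \<eta>"
  proof (intro ext)
    fix c p
    have "dbar M \<eta> c p = 2 * \<i> * dbar M \<Phi> c p"
    proof (cases "c \<in> atlas M \<and> p \<in> fst c")
      case True
      have "smooth_at (\<Phi> c \<circ> chart_inv c) (snd c p)"
        using True chart_subset[of c] by (intro one_formsD(1)[OF one openin_topspace]) auto
      from wirt_cmult(2)[OF form_differentiable(1)[OF this], of "2 * \<i>"]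
      have "wirt_zbar (fst \<circ> \<eta> c \<circ> chart_inv c) (snd c p) = 2 * \<i> * wirt_zbar (fst \<circ> \<Phi> c \<circ> chart_inv c) (snd c p)"
        by (simp add: \<eta>_def o_def)
      then show ?thesis using True by (simp add: dbar_def)
    qed (auto simp: dbar_def)
    also have "\<dots> = herm_form M h L H \<Psi> c p"
      using eq[of c p] by (simp add: mult.commute[of 2 \<i>] mult.assoc)
    finally show "herm_form M h L H \<Psi> c p = dbar M \<eta> c p" by simp
  qed
  ultimately show ?thesis unfolding dbar_exact_def by blast
qed

text \<open>The constant gauge transformation 1 fixes \<Psi>, so the solution itself lies over the
  orbit of \<Psi>.\<close>

lemma solution_sigma_space:
  assumes "solution M h L H (A, \<Psi>, \<Phi>)" "nonzero_pair \<Psi>"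
  shows "sigma_space M h L H \<Psi> \<noteq> {}"
proof -
  have "(\<lambda>p. 1) \<in> gauge_group M"
    by (simp add: gauge_group_def smooth_fun_iff[OF openin_topspace] msmooth_const)
  moreover have "act_pair (\<lambda>p. 1) \<Psi> = \<Psi>" by (cases \<Psi>) (simp add: act_pair_def)
  ultimately have "\<Psi> \<in> (\<lambda>u. act_pair u \<Psi>) ` gauge_group M" by (metis imageI)
  moreover have "A \<in> unitary_connections M L H" "\<Phi> \<in> imaginary_forms M"
    using assms(1) by (cases \<Psi>; auto simp: solution_def configs_def)+
  ultimately have "(A, \<Psi>, \<Phi>) \<in> orbit_configs M L H \<Psi> \<inter> nontrivial_solutions M h L H"
    using assms by (simp add: orbit_configs_def nontrivial_solutions_def)
  then show ?thesis unfolding sigma_space_def by (intro gauge_quotient_nonempty) blast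
qed

end

theorem proposition2p1:
  fixes M :: "'a surface" and g :: nat and h :: "'a chart \<Rightarrow> 'a \<Rightarrow> real"
    and L :: "('i, 'a) line_bundle_data" and H :: "'i \<Rightarrow> 'a \<Rightarrow> real"
  assumes "compact_riemann_surface M" and "has_genus M g" and "1 \<le> g"
    and "conformal_metric M h"
    and "line_bundle M L" and "hermitian_metric M L H"
  shows
    "(g = 1 \<and> bundle_isomorphic M L (trivial_bundle M) \<longrightarrow>
       (\<exists>A \<Psi> \<Phi>. solution M h L H (A, \<Psi>, \<Phi>) \<and> nonzero_pair \<Psi> \<and> \<Phi> \<noteq> zero_form) \<and>
       moduli_space M h L H \<noteq> {} \<and>
       (\<forall>A \<Psi> \<Phi>. solution M h L H (A, \<Psi>, \<Phi>) \<and> nonzero_pair \<Psi> \<and> \<Phi> \<noteq> zero_form \<longrightarrow>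
          dbar_exact M (herm_form M h L H \<Psi>) \<and> sigma_space M h L H \<Psi> \<noteq> {})) \<and>
     (1 < g \<and> bundle_isomorphic M L (dual_bundle (canonical_bundle M)) \<longrightarrow>
       (\<exists>A \<Psi> \<Phi>. solution M h L H (A, \<Psi>, \<Phi>) \<and> nonzero_pair \<Psi> \<and> \<Phi> \<noteq> zero_form) \<and>
       moduli_space M h L H \<noteq> {} \<and>
       (\<forall>A \<Psi> \<Phi>. solution M h L H (A, \<Psi>, \<Phi>) \<and> nonzero_pair \<Psi> \<and> \<Phi> \<noteq> zero_form \<longrightarrow>
          dbar_exact M (herm_form M h L H \<Psi>) \<and> sigma_space M h L H \<Psi> \<noteq> {}))"
proof -
  interpret hermitian_bundle M h L H
    using assms by unfold_locales (auto simp: compact_riemann_surface_def)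
  have "\<exists>A \<Psi> \<Phi>. solution M h L H (A, \<Psi>, \<Phi>) \<and> nonzero_pair \<Psi> \<and> \<Phi> \<noteq> zero_form"
    using assms(1) by (intro nontrivial_solution_exists)
      (auto simp: compact_riemann_surface_def riemann_surface_def)
  moreover from this have "moduli_space M h L H \<noteq> {}"
    unfolding moduli_space_def by (intro gauge_quotient_nonempty) (auto simp: nontrivial_solutions_def)
  ultimately show ?thesis using solution_dbar_exact solution_sigma_space by blast
qed

end
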